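(* Let $A,B,C,D$ be four independent random $3$-sided dice drawn from the balanced uniform model. The probabilities that the tournament formed by the dominance relation on $\{A,B,C,D\}$ belongs to each of the four isomorphism classes of tournaments on four vertices are: \begin{align*} P_{4\text{-line}} &= \frac{110413771}{258048000} \quad\text{(transitive chain)},\\ P_{\square} &= \frac{99930571}{258048000} \quad\text{(intransitive 4-cycle)},\\ P_{1\to\bigtriangleup} &= \frac{23851829}{258048000} \quad\text{(winner + 3-cycle)},\\ P_{1\leftarrow\bigtriangleup} &= \frac{23851829}{258048000} \quad\text{(loser + 3-cycle)}. \end{align*}
   Context: A random $3$-sided die in the balanced uniform model is a point $(a_1,a_2,a_3)\in[0,1]^3$ chosen uniformly conditioned on $a_1+a_2+a_3=3/2$; that is, it is distributed according to normalized two-dimensional area measure on the planar region $\{(a_1,a_2,a_3)\in[0,1]^3 : a_1+a_2+a_3=3/2\}$ (equivalently, $(a_1,a_2)$ is uniform on the projection of this region to the first two coordinates). For dice $A=(a_1,a_2,a_3)$ and $B=(b_1,b_2,b_3)$, $A$ dominates $B$, written $A\succ B$, if $\sum_{i,j=1}^{3}\operatorname{sgn}(a_i-b_j)>0$, where $\operatorname{sgn}$ takes the values $-1,0,1$. If the sum is $0$, the result is a tie. When there are no ties among the four dice, the dominance relation is a tournament (complete directed graph, with an edge from $X$ to $Y$ when $X\succ Y$) on the vertex set $\{A,B,C,D\}$. The four isomorphism classes of tournaments on four vertices are: (1) transitive chain: for some ordering $W,X,Y,Z$ of the dice, each dominates all later ones (24 labeled tournaments); (2) intransitive 4-cycle: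 for some ordering, $W\succ X\succ Y\succ Z\succ W$ (24 labeled tournaments); (3) winner + 3-cycle: one die dominates the other three, and those three form a cycle $X\succ Y\succ Z\succ X$ (8 labeled tournaments); (4) loser + 3-cycle: one die is dominated by each of the other three, and those three form a cycle $X\succ Y\succ Z\succ X$ (8 labeled tournaments). *)

theory Defs
  imports "HOL-Probability.Probability"
begin

definition balanced_projection :: "(real \<times> real) set" where
  "balanced_projection =
     {(x, y). 0 \<le> x \<and> x \<le> 1 \<and> 0 \<le> y \<and> y \<le> 1 \<and> 0 \<le> 3/2 - x - y \<and> 3/2 - x - y \<le> 1}"

(* Normalized area measure on {a \<in> [0,1]^3. a1 + a2 + a3 = 3/2}, in the coordinates (a1, a2):
   the graph map multiplies area by the constant sqrt 3, which normalization cancels. *)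
definition balanced_die :: "(real ^ 3) measure" where
  "balanced_die =
     distr (uniform_measure lborel balanced_projection) borel
       (\<lambda>(x, y). vector [x, y, 3/2 - x - y])"

definition dominates :: "real ^ 3 \<Rightarrow> real ^ 3 \<Rightarrow> bool" where
  "dominates a b \<longleftrightarrow> (\<Sum>i\<in>UNIV. \<Sum>j\<in>UNIV. sgn (a $ i - b $ j)) > 0"

definition tournament_on :: "'v set \<Rightarrow> ('v \<Rightarrow> 'v \<Rightarrow> bool) \<Rightarrow> bool" where
  "tournament_on V R \<longleftrightarrow>
     (\<forall>x\<in>V. \<not> R x x) \<and> (\<forall>x\<in>V. \<forall>y\<in>V. x \<noteq> y \<longrightarrow> (R x y \<longleftrightarrow> \<not> R y x))"

definition transitive_chain :: "'v set \<Rightarrow> ('v \<Rightarrow> 'v \<Rightarrow> bool) \<Rightarrow> bool" where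
  "transitive_chain V R \<longleftrightarrow> tournament_on V R \<and>
     (\<exists>w x y z. distinct [w, x, y, z] \<and> V = {w, x, y, z} \<and>
        R w x \<and> R w y \<and> R w z \<and> R x y \<and> R x z \<and> R y z)"

definition intransitive_4_cycle :: "'v set \<Rightarrow> ('v \<Rightarrow> 'v \<Rightarrow> bool) \<Rightarrow> bool" where
  "intransitive_4_cycle V R \<longleftrightarrow> tournament_on V R \<and>
     (\<exists>w x y z. distinct [w, x, y, z] \<and> V = {w, x, y, z} \<and>
        R w x \<and> R x y \<and> R y z \<and> R z w)"

definition winner_3_cycle :: "'v set \<Rightarrow> ('v \<Rightarrow> 'v \<Rightarrow> bool) \<Rightarrow> bool" where
  "winner_3_cycle V R \<longleftrightarrow> tournament_on V R \<and>
     (\<exists>w x y z. distinct [w, x, y, z] \<and> V = {w, x, y, z} \<and>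
        R w x \<and> R w y \<and> R w z \<and> R x y \<and> R y z \<and> R z x)"

definition loser_3_cycle :: "'v set \<Rightarrow> ('v \<Rightarrow> 'v \<Rightarrow> bool) \<Rightarrow> bool" where
  "loser_3_cycle V R \<longleftrightarrow> tournament_on V R \<and>
     (\<exists>w x y z. distinct [w, x, y, z] \<and> V = {w, x, y, z} \<and>
        R x w \<and> R y w \<and> R z w \<and> R x y \<and> R y z \<and> R z x)"

end

theory Submission
  imports Defs
begin

text \<open>
  Write the entries of a die in increasing order as \<open>p \<le> q \<le> r\<close>. Two dice have the same sum, so,
  coincidences apart, each of them is the larger one in one or two of the three sorted places, and it
  dominates exactly when it is the larger one in two of them (\<open>majority\<close>). The outcome of a comparison,
  counted as \<open>\<plusminus>1\<close>, is therefore the sum of the three signs of the differences of sorted entries; this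
  linearity is what makes an exact computation possible. In the coordinates \<open>x = 4p\<close> and
  \<open>y = 4(1 - r)\<close> a balanced die is a uniform point of a kite of area 2 (\<open>distr_balanced_die\<close>), the
  middle entry becomes \<open>w = 1 + y - x\<close>, and exchanging \<open>x\<close> and \<open>y\<close>, which replaces every entry \<open>a\<close> by
  \<open>1 - a\<close>, preserves the distribution and reverses every outcome.

  The isomorphism class of a tournament on four vertices can be read off from sums of products of the
  outcomes \<open>\<plusminus>1\<close>: over the three undirected 4-cycles, over triples of edges at a vertex and over pairs of
  edges at a vertex (\<open>tournament_classes\<close>). Taking expectations gives four linear equations for the four
  class probabilities. The triples contribute 0 by the reflection, so a winner and a loser over a 3-cycle
  are equally likely; the pairs contribute the second moment of the score of a random die
  (\<open>score_square\<close>); and the 4-cycles contribute \<open>\<kappa> = E[s(A,B) s(B,C) s(C,D) s(D,A)]\<close>, where \<open>s\<close> is the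
  outcome (\<open>two_step_cycle_value\<close>).

  For \<open>\<kappa>\<close>, integrate \<open>B\<close> and \<open>D\<close> first: \<open>\<kappa>\<close> is the integral of \<open>K(a,c) K(c,a)\<close> with
  \<open>K(a,c) = E[s(a,B) s(B,c)]\<close>. By linearity of \<open>s\<close> in its first argument, \<open>K(a,c)\<close> is a sum of three functions, each
  depending on \<open>c\<close> and on only one sorted coordinate of \<open>a\<close>. So \<open>\<kappa>\<close> is a sum of nine integrals of
  \<open>f(\<xi> a, c) g(\<eta> c, a)\<close> with coordinates \<open>\<xi>\<close> and \<open>\<eta>\<close>. Integrating \<open>a\<close> along the line of fixed \<open>\<xi>\<close>
  and \<open>c\<close> along the line of fixed \<open>\<eta>\<close> turns a fourfold integral into the integral over a square of a
  product of two one-dimensional fibre integrals (\<open>cycle_fibre\<close>). Symmetry leaves four of the nine.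

  The fibre integrals are piecewise polynomials of degree three. On each unit square they are written as
  sums of terms \<open>max 0 (affine form) * polynomial\<close>. To integrate a product of two such sums, the square
  is cut into trapezoids on which every affine form has a constant sign; that needs checking only at the
  corners, and the polynomial on each trapezoid is integrated by rewriting (\<open>grid_integral\<close>).
\<close>

section \<open>Exact integration of sums of ramps over trapezoids\<close>

fun poly1 :: "real list \<Rightarrow> real \<Rightarrow> real" where
  "poly1 [] z = 0" | "poly1 (c # p) z = c + z * poly1 p z"

text \<open>
  The outer list runs over the powers of \<open>x\<close>, the inner lists over the powers of
  \<open>z\<close>.
\<close>
fun poly2 :: "real list list \<Rightarrow> real \<Rightarrow> real \<Rightarrow> real" where
  "poly2 [] x z = 0" | "poly2 (p # P) x z = poly1 p z + x * poly2 P x z"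

fun add1 :: "real list \<Rightarrow> real list \<Rightarrow> real list" where
  "add1 [] q = q" | "add1 (a # p) [] = a # p" | "add1 (a # p) (b # q) = (a + b) # add1 p q"

primrec scale1 :: "real \<Rightarrow> real list \<Rightarrow> real list" where
  "scale1 c [] = []" | "scale1 c (a # p) = c * a # scale1 c p"

primrec mul1 :: "real list \<Rightarrow> real list \<Rightarrow> real list" where
  "mul1 [] q = []" | "mul1 (a # p) q = add1 (scale1 a q) (0 # mul1 p q)"

fun add2 :: "real list list \<Rightarrow> real list list \<Rightarrow> real list list" where
  "add2 [] q = q" | "add2 (a # p) [] = a # p" | "add2 (a # p) (b # q) = add1 a b # add2 p q"

primrec scale2 :: "real list \<Rightarrow> real list list \<Rightarrow> real list list" where
  "scale2 c [] = []" | "scale2 c (a # p) = mul1 c a # scale2 c p"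

primrec mul2 :: "real list list \<Rightarrow> real list list \<Rightarrow> real list list" where
  "mul2 [] q = []" | "mul2 (a # p) q = add2 (scale2 a q) ([] # mul2 p q)"

text \<open>
  Called with 1, this divides the coefficient of \<open>z ^ k\<close> by \<open>k + 1\<close>; the remaining
  factor \<open>z\<close> of the antiderivative is supplied by a leading zero.
\<close>
primrec primitive1 :: "real \<Rightarrow> real list \<Rightarrow> real list" where
  "primitive1 n [] = []" | "primitive1 n (a # p) = a / n # primitive1 (n + 1) p"

text \<open>
  The antiderivative in \<open>x\<close>, multiplied by 840, the least common multiple of 1, ..., 8:
  integrands have degree below 8 in \<open>x\<close>, so rewriting with concrete coefficients stays within the
  integers until a final division.
\<close>
primrec primitive2 :: "real \<Rightarrow> real list list \<Rightarrow> real list list" where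
  "primitive2 n [] = []" | "primitive2 n (a # p) = scale1 (840 / n) a # primitive2 (n + 1) p"

text \<open>
  Substitution of a polynomial in \<open>z\<close> for \<open>x\<close>, by Horner's scheme.
\<close>
primrec subst2 :: "real list list \<Rightarrow> real list \<Rightarrow> real list" where
  "subst2 [] r = []" | "subst2 (p # P) r = add1 p (mul1 r (subst2 P r))"

lemma poly1_add [simp]: "poly1 (add1 p q) z = poly1 p z + poly1 q z"
  by (induction p q rule: add1.induct) (auto simp: algebra_simps)

lemma poly1_scale [simp]: "poly1 (scale1 c p) z = c * poly1 p z"
  by (induction p) (auto simp: algebra_simps)

lemma poly1_mul [simp]: "poly1 (mul1 p q) z = poly1 p z * poly1 q z"
  by (induction p) (auto simp: algebra_simps)

lemma poly2_add [simp]: "poly2 (add2 P Q) x z = poly2 P x z + poly2 Q x z"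
  by (induction P Q rule: add2.induct) (auto simp: algebra_simps)

lemma poly2_scale [simp]: "poly2 (scale2 c P) x z = poly1 c z * poly2 P x z"
  by (induction P) (auto simp: algebra_simps)

lemma poly2_mul [simp]: "poly2 (mul2 P Q) x z = poly2 P x z * poly2 Q x z"
  by (induction P) (auto simp: algebra_simps)

lemma poly1_subst2 [simp]: "poly1 (subst2 P r) z = poly2 P (poly1 r z) z"
  by (induction P) (auto simp: algebra_simps)

lemma primitive1_deriv:
  "((\<lambda>z. z ^ Suc n * poly1 (primitive1 (real (Suc n)) p) z) has_real_derivative z ^ n * poly1 p z) (at z within S)"
proof (induction p arbitrary: n)
  case (Cons a p)
  have eq: "(\<lambda>z. z ^ Suc n * poly1 (primitive1 (real (Suc n)) (a # p)) z)
      = (\<lambda>z. a / real (Suc n) * z ^ Suc n + z ^ Suc (Suc n) * poly1 (primitive1 (real (Suc (Suc n))) p) z)"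
    by (simp add: algebra_simps fun_eq_iff)
  show ?case unfolding eq
    by (rule derivative_eq_intros Cons refl)+ (simp add: field_simps)
qed auto

lemma primitive2_deriv:
  "((\<lambda>x. x ^ Suc n * poly2 (primitive2 (real (Suc n)) P) x z) has_real_derivative 840 * x ^ n * poly2 P x z) (at x within S)"
proof (induction P arbitrary: n)
  case (Cons a p)
  have eq: "(\<lambda>x. x ^ Suc n * poly2 (primitive2 (real (Suc n)) (a # p)) x z)
      = (\<lambda>x. 840 * poly1 a z / real (Suc n) * x ^ Suc n + x ^ Suc (Suc n) * poly2 (primitive2 (real (Suc (Suc n))) p) x z)"
    by (simp add: algebra_simps fun_eq_iff)
  show ?case unfolding eq
    by (rule derivative_eq_intros Cons refl)+ (simp add: field_simps)
qed auto

lemma poly1_has_integral: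
  "a \<le> b \<Longrightarrow> (poly1 p has_integral poly1 (0 # primitive1 1 p) b - poly1 (0 # primitive1 1 p) a) {a..b}"
  using fundamental_theorem_of_calculus[of a b "\<lambda>z. z * poly1 (primitive1 1 p) z" "poly1 p"] primitive1_deriv[of 0 p]
  by (simp add: has_real_derivative_iff_has_vector_derivative)

lemma poly2_has_integral:
  assumes "a \<le> b"
  shows "((\<lambda>x. poly2 P x z) has_integral (poly2 ([] # primitive2 1 P) b z - poly2 ([] # primitive2 1 P) a z) / 840) {a..b}"
proof -
  have "((\<lambda>x. x * poly2 (primitive2 1 P) x z / 840) has_real_derivative poly2 P x z) (at x within {a..b})" for x
    using DERIV_cdivide[OF primitive2_deriv[of 0 P z x "{a..b}"], of 840] by simp
  then have "((\<lambda>x. poly2 P x z) has_integral b * poly2 (primitive2 1 P) b z / 840 - a * poly2 (primitive2 1 P) a z / 840) {a..b}"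
    by (intro fundamental_theorem_of_calculus[OF assms])
      (simp add: has_real_derivative_iff_has_vector_derivative)
  then show ?thesis by (simp add: diff_divide_distrib)
qed

text \<open>
  A term \<open>((c, p, q), P)\<close> stands for \<open>max 0 (c + p x + q z) * P(x, z)\<close>.
\<close>
type_synonym ramp_term = "(real \<times> real \<times> real) \<times> real list list"

fun aff :: "real \<times> real \<times> real \<Rightarrow> real \<Rightarrow> real \<Rightarrow> real" where
  "aff (c, p, q) x z = c + p * x + q * z"

fun ramp_sum :: "ramp_term list \<Rightarrow> real \<Rightarrow> real \<Rightarrow> real" where
  "ramp_sum [] x z = 0"
| "ramp_sum ((l, P) # ts) x z = max 0 (aff l x z) * poly2 P x z + ramp_sum ts x z"

text \<open>
  The lines \<open>x = \<alpha> z\<close> and \<open>x = \<beta> z\<close> together with \<open>z = a\<close>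
  and \<open>z = b\<close> bound a trapezoid. An affine form that is nonnegative, or nonpositive, at its
  corners is so everywhere in it.
\<close>
definition at_corners :: "(real \<Rightarrow> bool) \<Rightarrow> real \<Rightarrow> real \<Rightarrow> real list \<Rightarrow> real list \<Rightarrow> real \<times> real \<times> real \<Rightarrow> bool" where
  "at_corners T a b \<alpha> \<beta> l \<longleftrightarrow> T (aff l (poly1 \<alpha> a) a) \<and> T (aff l (poly1 \<beta> a) a) \<and> T (aff l (poly1 \<alpha> b) b) \<and> T (aff l (poly1 \<beta> b) b)"

fun decided :: "real \<Rightarrow> real \<Rightarrow> real list \<Rightarrow> real list \<Rightarrow> ramp_term list \<Rightarrow> bool" where
  "decided a b \<alpha> \<beta> [] \<longleftrightarrow> True"
| "decided a b \<alpha> \<beta> ((l, P) # ts) \<longleftrightarrow>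
     (at_corners (\<lambda>v. 0 \<le> v) a b \<alpha> \<beta> l \<or> at_corners (\<lambda>v. v \<le> 0) a b \<alpha> \<beta> l) \<and> decided a b \<alpha> \<beta> ts"

text \<open>
  The polynomial that a sum of ramps equals on a trapezoid where no ramp changes sign: the ramps with a
  positive affine form keep their factor, the others vanish.
\<close>
fun active :: "real \<Rightarrow> real \<Rightarrow> real list \<Rightarrow> real list \<Rightarrow> ramp_term list \<Rightarrow> real list list" where
  "active a b \<alpha> \<beta> [] = []"
| "active a b \<alpha> \<beta> (((c, p, q), P) # ts) =
     (if at_corners (\<lambda>v. 0 \<le> v) a b \<alpha> \<beta> (c, p, q) then add2 (mul2 [[c, q], [p]] P) (active a b \<alpha> \<beta> ts)
      else active a b \<alpha> \<beta> ts)"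

lemma affine_between:
  fixes c d :: real
  assumes "a \<le> z" "z \<le> b" "0 \<le> c + d * a" "0 \<le> c + d * b"
  shows "0 \<le> c + d * z"
proof (cases "d \<ge> 0")
  case True
  then have "d * a \<le> d * z" using assms by (intro mult_left_mono) auto
  then show ?thesis using assms by linarith
next
  case False
  then have "d * b \<le> d * z" using assms by (intro mult_left_mono_neg) auto
  then show ?thesis using assms by linarith
qed

text \<open>
  Along each of the two slanted sides the form is affine in \<open>z\<close>, hence nonnegative between its
  end points; between the two sides it is affine in \<open>x\<close>.
\<close>
lemma corners_nonneg:
  assumes "at_corners (\<lambda>v. 0 \<le> v) a b [\<alpha>, \<alpha>'] [\<beta>, \<beta>'] (c, p, q)"
    and z: "a \<le> z" "z \<le> b" and x: "poly1 [\<alpha>, \<alpha>'] z \<le> x" "x \<le> poly1 [\<beta>, \<beta>'] z"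
  shows "0 \<le> aff (c, p, q) x z"
proof -
  have "0 \<le> (c + p * \<alpha>) + (p * \<alpha>' + q) * z" "0 \<le> (c + p * \<beta>) + (p * \<beta>' + q) * z"
    by (rule affine_between[OF z]; use assms(1) in \<open>simp add: at_corners_def algebra_simps\<close>)+
  then have "0 \<le> (c + q * z) + p * poly1 [\<alpha>, \<alpha>'] z" "0 \<le> (c + q * z) + p * poly1 [\<beta>, \<beta>'] z"
    by (simp_all add: algebra_simps)
  from affine_between[OF x this] show ?thesis by (simp add: algebra_simps)
qed

lemma corners_nonpos:
  assumes "at_corners (\<lambda>v. v \<le> 0) a b [\<alpha>, \<alpha>'] [\<beta>, \<beta>'] (c, p, q)"
    and z: "a \<le> z" "z \<le> b" and x: "poly1 [\<alpha>, \<alpha>'] z \<le> x" "x \<le> poly1 [\<beta>, \<beta>'] z"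
  shows "aff (c, p, q) x z \<le> 0"
proof -
  have "at_corners (\<lambda>v. 0 \<le> v) a b [\<alpha>, \<alpha>'] [\<beta>, \<beta>'] (- c, - p, - q)"
    using assms(1) by (auto simp: at_corners_def algebra_simps)
  from corners_nonneg[OF this z x] show ?thesis by simp
qed

lemma ramp_sum_active:
  assumes "decided a b [\<alpha>, \<alpha>'] [\<beta>, \<beta>'] ts"
    and "a \<le> z" "z \<le> b" "poly1 [\<alpha>, \<alpha>'] z \<le> x" "x \<le> poly1 [\<beta>, \<beta>'] z"
  shows "ramp_sum ts x z = poly2 (active a b [\<alpha>, \<alpha>'] [\<beta>, \<beta>'] ts) x z"
  using assms(1)
proof (induction ts)
  case (Cons t ts)
  obtain c p q P where t: "t = ((c, p, q), P)" by (metis prod.exhaust)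
  show ?case
  proof (cases "at_corners (\<lambda>v. 0 \<le> v) a b [\<alpha>, \<alpha>'] [\<beta>, \<beta>'] (c, p, q)")
    case True
    have "0 \<le> aff (c, p, q) x z" by (rule corners_nonneg[OF True]) (use assms in auto)
    then show ?thesis using Cons t True by (simp add: algebra_simps)
  next
    case False
    then have "at_corners (\<lambda>v. v \<le> 0) a b [\<alpha>, \<alpha>'] [\<beta>, \<beta>'] (c, p, q)" using Cons.prems t by simp
    from corners_nonpos[OF this] have "aff (c, p, q) x z \<le> 0" using assms by auto
    then show ?thesis using Cons t False by simp
  qed
qed simp

lemma continuous_poly2: "continuous_on S (\<lambda>x. poly2 P x z)"
  by (induction P) (auto intro!: continuous_intros)

lemma continuous_ramp_sum: "continuous_on S (\<lambda>x. ramp_sum ts x z)"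
proof (induction ts)
  case (Cons t ts)
  obtain c p q P where t: "t = ((c, p, q), P)" by (metis prod.exhaust)
  show ?case unfolding t using Cons
    by (auto intro!: continuous_intros continuous_poly2)
qed simp

definition poly1_integral :: "real \<Rightarrow> real \<Rightarrow> real list \<Rightarrow> real" where
  "poly1_integral a b R = poly1 (0 # primitive1 1 R) b - poly1 (0 # primitive1 1 R) a"

text \<open>
  The increment in \<open>x\<close> of a polynomial between two lines, as a polynomial in \<open>z\<close>.
\<close>
definition between_lines :: "real list list \<Rightarrow> real list \<Rightarrow> real list \<Rightarrow> real list" where
  "between_lines P \<alpha> \<beta> = add1 (subst2 P \<beta>) (scale1 (- 1) (subst2 P \<alpha>))"

text \<open>
  A horizontal strip \<open>a \<le> z \<le> b\<close> is cut by consecutive lines \<open>x = \<alpha> +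
  \<alpha>' z\<close>, each given by the pair \<open>(\<alpha>, \<alpha>')\<close>.
\<close>
fun strip_ok :: "ramp_term list \<Rightarrow> ramp_term list \<Rightarrow> real \<Rightarrow> real \<Rightarrow> (real \<times> real) list \<Rightarrow> bool" where
  "strip_ok ts us a b ((\<alpha>, \<alpha>') # (\<beta>, \<beta>') # ls) \<longleftrightarrow>
     \<alpha> + a * \<alpha>' \<le> \<beta> + a * \<beta>' \<and> \<alpha> + b * \<alpha>' \<le> \<beta> + b * \<beta>' \<and>
     decided a b [\<alpha>, \<alpha>'] [\<beta>, \<beta>'] ts \<and> decided a b [\<alpha>, \<alpha>'] [\<beta>, \<beta>'] us \<and> strip_ok ts us a b ((\<beta>, \<beta>') # ls)"
| "strip_ok ts us a b _ \<longleftrightarrow> True"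

fun strip_value :: "ramp_term list \<Rightarrow> ramp_term list \<Rightarrow> real \<Rightarrow> real \<Rightarrow> (real \<times> real) list \<Rightarrow> real" where
  "strip_value ts us a b ((\<alpha>, \<alpha>') # (\<beta>, \<beta>') # ls) =
     poly1_integral a b (between_lines ([] # primitive2 1 (mul2 (active a b [\<alpha>, \<alpha>'] [\<beta>, \<beta>'] ts) (active a b [\<alpha>, \<alpha>'] [\<beta>, \<beta>'] us)))
        [\<alpha>, \<alpha>'] [\<beta>, \<beta>']) / 840
     + strip_value ts us a b ((\<beta>, \<beta>') # ls)"
| "strip_value ts us a b _ = 0"

text \<open>
  The region between the lines \<open>\<alpha>\<close> and \<open>\<beta>\<close> above \<open>z = a\<close>
  is cut into horizontal strips; an entry \<open>(b, ls)\<close> gives the upper end of a strip and the lines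
  inside it.
\<close>
fun grid_ok :: "ramp_term list \<Rightarrow> ramp_term list \<Rightarrow> (real \<times> real) \<Rightarrow> (real \<times> real) \<Rightarrow> real \<Rightarrow> (real \<times> (real \<times> real) list) list \<Rightarrow> bool" where
  "grid_ok ts us \<alpha> \<beta> a [] \<longleftrightarrow> True"
| "grid_ok ts us \<alpha> \<beta> a ((b, ls) # gs) \<longleftrightarrow>
     a \<le> b \<and> strip_ok ts us a b (\<alpha> # ls @ [\<beta>]) \<and> grid_ok ts us \<alpha> \<beta> b gs"

fun grid_value :: "ramp_term list \<Rightarrow> ramp_term list \<Rightarrow> (real \<times> real) \<Rightarrow> (real \<times> real) \<Rightarrow> real \<Rightarrow> (real \<times> (real \<times> real) list) list \<Rightarrow> real" where
  "grid_value ts us \<alpha> \<beta> a [] = 0"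
| "grid_value ts us \<alpha> \<beta> a ((b, ls) # gs) = strip_value ts us a b (\<alpha> # ls @ [\<beta>]) + grid_value ts us \<alpha> \<beta> b gs"

fun grid_end :: "real \<Rightarrow> (real \<times> 'c) list \<Rightarrow> real" where
  "grid_end a [] = a" | "grid_end a ((b, ls) # gs) = grid_end b gs"

lemma cell_integral:
  assumes ab: "a \<le> b"
    and le: "\<alpha> + a * \<alpha>' \<le> \<beta> + a * \<beta>'" "\<alpha> + b * \<alpha>' \<le> \<beta> + b * \<beta>'"
    and "decided a b [\<alpha>, \<alpha>'] [\<beta>, \<beta>'] ts" "decided a b [\<alpha>, \<alpha>'] [\<beta>, \<beta>'] us"
  shows "((\<lambda>z. integral {\<alpha> + z * \<alpha>'..\<beta> + z * \<beta>'} (\<lambda>x. ramp_sum ts x z * ramp_sum us x z)) has_integral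
     poly1_integral a b (between_lines ([] # primitive2 1 (mul2 (active a b [\<alpha>, \<alpha>'] [\<beta>, \<beta>'] ts) (active a b [\<alpha>, \<alpha>'] [\<beta>, \<beta>'] us)))
        [\<alpha>, \<alpha>'] [\<beta>, \<beta>']) / 840) {a..b}"
    and "\<And>z. z \<in> {a..b} \<Longrightarrow> \<alpha> + z * \<alpha>' \<le> \<beta> + z * \<beta>'"
proof -
  show ord: "\<alpha> + z * \<alpha>' \<le> \<beta> + z * \<beta>'" if "z \<in> {a..b}" for z
    using affine_between[of a z b "\<beta> - \<alpha>" "\<beta>' - \<alpha>'"] le that by (simp add: algebra_simps)
  define P where "P = mul2 (active a b [\<alpha>, \<alpha>'] [\<beta>, \<beta>'] ts) (active a b [\<alpha>, \<alpha>'] [\<beta>, \<beta>'] us)"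
  have inner: "integral {\<alpha> + z * \<alpha>'..\<beta> + z * \<beta>'} (\<lambda>x. ramp_sum ts x z * ramp_sum us x z)
      = poly1 (between_lines ([] # primitive2 1 P) [\<alpha>, \<alpha>'] [\<beta>, \<beta>']) z / 840" if z: "z \<in> {a..b}" for z
  proof (rule integral_unique, rule has_integral_eq[rotated])
    show "((\<lambda>x. poly2 P x z) has_integral poly1 (between_lines ([] # primitive2 1 P) [\<alpha>, \<alpha>'] [\<beta>, \<beta>']) z / 840)
       {\<alpha> + z * \<alpha>'..\<beta> + z * \<beta>'}"
      using poly2_has_integral[OF ord[OF z], of P z] by (simp add: between_lines_def algebra_simps)
    show "poly2 P x z = ramp_sum ts x z * ramp_sum us x z" if "x \<in> {\<alpha> + z * \<alpha>'..\<beta> + z * \<beta>'}" for x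
      using that z assms by (simp add: P_def ramp_sum_active[of a b \<alpha> \<alpha>' \<beta> \<beta>'])
  qed
  have "((\<lambda>z. poly1 (between_lines ([] # primitive2 1 P) [\<alpha>, \<alpha>'] [\<beta>, \<beta>']) z / 840) has_integral
      poly1_integral a b (between_lines ([] # primitive2 1 P) [\<alpha>, \<alpha>'] [\<beta>, \<beta>']) / 840) {a..b}"
    unfolding poly1_integral_def by (rule has_integral_divide[OF poly1_has_integral[OF ab]])
  then show "((\<lambda>z. integral {\<alpha> + z * \<alpha>'..\<beta> + z * \<beta>'} (\<lambda>x. ramp_sum ts x z * ramp_sum us x z)) has_integral
     poly1_integral a b (between_lines ([] # primitive2 1 (mul2 (active a b [\<alpha>, \<alpha>'] [\<beta>, \<beta>'] ts) (active a b [\<alpha>, \<alpha>'] [\<beta>, \<beta>'] us)))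
        [\<alpha>, \<alpha>'] [\<beta>, \<beta>']) / 840) {a..b}"
    unfolding P_def[symmetric] by (rule has_integral_eq[rotated]) (simp add: inner)
qed

lemma strip_integral:
  assumes ab: "a \<le> b" and ok: "strip_ok ts us a b (\<alpha> # ls @ [\<beta>])"
  shows "((\<lambda>z. integral {fst \<alpha> + z * snd \<alpha>..fst \<beta> + z * snd \<beta>} (\<lambda>x. ramp_sum ts x z * ramp_sum us x z)) has_integral
      strip_value ts us a b (\<alpha> # ls @ [\<beta>])) {a..b} \<and>
    (\<forall>z\<in>{a..b}. fst \<alpha> + z * snd \<alpha> \<le> fst \<beta> + z * snd \<beta>)"
  using ok
proof (induction ls arbitrary: \<alpha>)
  case Nil
  obtain c c' d d' where [simp]: "\<alpha> = (c, c')" "\<beta> = (d, d')" by (metis prod.exhaust)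
  show ?case using Nil cell_integral[OF ab, of c c' d d' ts us] by simp
next
  case (Cons \<gamma> ls)
  obtain c c' d d' e e' where [simp]: "\<alpha> = (c, c')" "\<beta> = (d, d')" "\<gamma> = (e, e')" by (metis prod.exhaust)
  have ok: "strip_ok ts us a b (\<gamma> # ls @ [\<beta>])" using Cons.prems by simp
  note IH = Cons.IH[OF ok]
  have cell: "((\<lambda>z. integral {c + z * c'..e + z * e'} (\<lambda>x. ramp_sum ts x z * ramp_sum us x z)) has_integral
     poly1_integral a b (between_lines ([] # primitive2 1 (mul2 (active a b [c, c'] [e, e'] ts) (active a b [c, c'] [e, e'] us)))
        [c, c'] [e, e']) / 840) {a..b}"
    and ord: "\<And>z. z \<in> {a..b} \<Longrightarrow> c + z * c' \<le> e + z * e'"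
    using cell_integral[OF ab, of c c' e e' ts us] Cons.prems by auto
  have ord': "\<And>z. z \<in> {a..b} \<Longrightarrow> e + z * e' \<le> d + z * d'" using IH by simp
  have split: "integral {c + z * c'..e + z * e'} (\<lambda>x. ramp_sum ts x z * ramp_sum us x z)
       + integral {e + z * e'..d + z * d'} (\<lambda>x. ramp_sum ts x z * ramp_sum us x z)
     = integral {c + z * c'..d + z * d'} (\<lambda>x. ramp_sum ts x z * ramp_sum us x z)" if "z \<in> {a..b}" for z
    by (rule Henstock_Kurzweil_Integration.integral_combine)
      (use ord[OF that] ord'[OF that] in \<open>auto intro!: integrable_continuous_interval continuous_intros continuous_ramp_sum\<close>)
  have "((\<lambda>z. integral {c + z * c'..d + z * d'} (\<lambda>x. ramp_sum ts x z * ramp_sum us x z)) has_integral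
      strip_value ts us a b (\<alpha> # (\<gamma> # ls) @ [\<beta>])) {a..b}"
  proof (rule has_integral_eq)
    show "((\<lambda>z. integral {c + z * c'..e + z * e'} (\<lambda>x. ramp_sum ts x z * ramp_sum us x z) +
        integral {e + z * e'..d + z * d'} (\<lambda>x. ramp_sum ts x z * ramp_sum us x z)) has_integral
      strip_value ts us a b (\<alpha> # (\<gamma> # ls) @ [\<beta>])) {a..b}"
      using has_integral_add[OF cell conjunct1[OF IH]] by simp
  qed (rule split)
  then show ?case using ord ord' by fastforce
qed

text \<open>
  Both the admissibility of a subdivision and its value are computed by rewriting, so that this reduces a
  double integral of a piecewise polynomial to a choice of cut lines.
\<close>
lemma grid_integral:
  assumes "grid_ok ts us \<alpha> \<beta> a gs"
  shows "((\<lambda>z. integral {fst \<alpha> + z * snd \<alpha>..fst \<beta> + z * snd \<beta>} (\<lambda>x. ramp_sum ts x z * ramp_sum us x z)) has_integral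
      grid_value ts us \<alpha> \<beta> a gs) {a..grid_end a gs} \<and> a \<le> grid_end a gs"
  using assms
proof (induction gs arbitrary: a)
  case (Cons g gs)
  obtain b ls where [simp]: "g = (b, ls)" by (cases g)
  have 1: "((\<lambda>z. integral {fst \<alpha> + z * snd \<alpha>..fst \<beta> + z * snd \<beta>} (\<lambda>x. ramp_sum ts x z * ramp_sum us x z)) has_integral
      strip_value ts us a b (\<alpha> # ls @ [\<beta>])) {a..b}"
    using strip_integral[of a b ts us \<alpha> ls \<beta>] Cons.prems by simp
  have 2: "grid_ok ts us \<alpha> \<beta> b gs" "a \<le> b" using Cons.prems by auto
  show ?case
    using has_integral_combine[OF 2(2) _ 1 conjunct1[OF Cons.IH[OF 2(1)]]] Cons.IH[OF 2(1)] 2 by simp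
qed (simp add: has_integral_refl)

section \<open>The kite and its fibrations by lines\<close>

text \<open>
  The inequalities say that \<open>p \<ge> 0\<close>, \<open>r \<le> 1\<close>, \<open>p \<le> q\<close> and
  \<open>q \<le> r\<close> for the sorted entries, with \<open>x = 4 p\<close> and \<open>y = 4 (1 -
  r)\<close>.
\<close>
definition kite :: "(real \<times> real) set" where
  "kite = {(x, y). 0 \<le> x \<and> 0 \<le> y \<and> 2 * x \<le> 2 + y \<and> 2 * y \<le> 2 + x}"

definition seg :: "real measure" where
  "seg = uniform_measure lborel {0..2}"

definition die :: "(real \<times> real) measure" where
  "die = uniform_measure lborel kite"

text \<open>
  The fibre of the kite over \<open>x\<close> (and by symmetry over \<open>y\<close>) is the interval from
  \<open>lo\<close> to \<open>hi\<close>.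
\<close>
definition lo :: "real \<Rightarrow> real" where "lo x = (if x \<le> 1 then 0 else 2 * x - 2)"
definition hi :: "real \<Rightarrow> real" where "hi x = 1 + x / 2"

lemma kite_sets [measurable]: "kite \<in> sets borel"
proof -
  have "closed kite" unfolding kite_def case_prod_unfold
    by (intro closed_Collect_conj closed_Collect_le continuous_intros)
  then show ?thesis by simp
qed

lemma kite_iff: "(x, y) \<in> kite \<longleftrightarrow> x \<in> {0..2} \<and> y \<in> {lo x..hi x}"
  by (auto simp: kite_def lo_def hi_def field_simps)

lemma kite_bounds: "(x, y) \<in> kite \<Longrightarrow> 0 \<le> x \<and> x \<le> 2 \<and> 0 \<le> y \<and> y \<le> 2"
  by (auto simp: kite_def)

lemma kite_swap: "(y, x) \<in> kite \<longleftrightarrow> (x, y) \<in> kite"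
  by (auto simp: kite_def)

lemma FTC_Icc:
  fixes f F :: "real \<Rightarrow> real"
  assumes "a \<le> b" "\<And>x. (F has_real_derivative f x) (at x)" "\<And>x. isCont f x"
  shows "has_bochner_integral lborel (\<lambda>x. f x * indicator {a..b} x) (F b - F a)"
  by (rule has_bochner_integral_FTC_Icc_real) (use assms in auto)

lemma lo_le_hi: "x \<in> {0..2} \<Longrightarrow> lo x \<le> hi x"
  by (auto simp: lo_def hi_def)

lemma nn_integral_lborel_Pair:
  fixes f :: "real \<times> real \<Rightarrow> ennreal"
  assumes "f \<in> borel_measurable borel"
  shows "(\<integral>\<^sup>+z. f z \<partial>lborel) = (\<integral>\<^sup>+x. \<integral>\<^sup>+y. f (x, y) \<partial>lborel \<partial>lborel)"
    and "(\<integral>\<^sup>+z. f z \<partial>lborel) = (\<integral>\<^sup>+y. \<integral>\<^sup>+x. f (x, y) \<partial>lborel \<partial>lborel)"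
  using lborel.nn_integral_fst[of f lborel] lborel_pair.nn_integral_snd[of f] assms
  by (simp_all add: lborel_prod)

lemma kite_measure: "emeasure lborel kite = 2"
proof -
  have "emeasure lborel kite = (\<integral>\<^sup>+x. (\<integral>\<^sup>+y. indicator kite (x, y) \<partial>lborel) \<partial>lborel)"
    using nn_integral_lborel_Pair(1)[of "indicator kite"] by simp
  also have "\<dots> = (\<integral>\<^sup>+x. ennreal ((hi x - lo x) * indicator {0..2} x) \<partial>lborel)"
  proof (rule nn_integral_cong)
    fix x :: real
    have "(\<lambda>y. indicator kite (x, y) :: ennreal) = (\<lambda>y. indicator (if x \<in> {0..2} then {lo x..hi x} else {}) y)"
      by (auto simp: kite_iff indicator_def fun_eq_iff)
    then show "(\<integral>\<^sup>+y. indicator kite (x, y) \<partial>lborel) = ennreal ((hi x - lo x) * indicator {0..2} x)"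
      using lo_le_hi[of x] by simp
  qed
  also have "\<dots> = ennreal 2"
  proof (rule nn_integral_eq_integral[THEN trans])
    let ?H = "\<lambda>x::real. x + x\<^sup>2 / 4 - (max 0 (x - 1))\<^sup>2"
    have *: "(hi x - lo x) * indicator {0..2} x
        = (1 + x / 2) * indicator {0..2} x - (2 * x - 2) * indicator {1..2::real} x" for x
      by (auto simp: hi_def lo_def indicator_def)
    have "has_bochner_integral lborel (\<lambda>x. (1 + x / 2) * indicator {0..2} x) ((2 + 2\<^sup>2 / 4) - (0 + 0\<^sup>2 / 4 :: real))"
      by (rule FTC_Icc[where F = "\<lambda>x. x + x\<^sup>2 / 4"]) (auto intro!: derivative_eq_intros)
    moreover have "has_bochner_integral lborel (\<lambda>x. (2 * x - 2) * indicator {1..2} x) ((2\<^sup>2 - 2 * 2) - (1\<^sup>2 - 2 * 1 :: real))"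
      by (rule FTC_Icc[where F = "\<lambda>x. x\<^sup>2 - 2 * x"]) (auto intro!: derivative_eq_intros)
    ultimately have "has_bochner_integral lborel (\<lambda>x. (hi x - lo x) * indicator {0..2} x) 2"
      unfolding * using has_bochner_integral_diff by fastforce
    then show "integrable lborel (\<lambda>x. (hi x - lo x) * indicator {0..2} x)"
      "ennreal (\<integral>x. (hi x - lo x) * indicator {0..2} x \<partial>lborel) = ennreal 2"
      by (auto simp: has_bochner_integral_iff)
    show "AE x in lborel. 0 \<le> (hi x - lo x) * indicator {0..2} x"
      using lo_le_hi by (auto simp: indicator_def)
  qed
  finally show ?thesis by simp
qed

lemma seg_props: "prob_space seg" "sets seg = sets borel" "space seg = UNIV"
  by (auto simp: seg_def intro!: prob_space_uniform_measure)

lemma die_props: "prob_space die" "sets die = sets borel" "space die = UNIV"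
  by (auto simp: die_def kite_measure intro!: prob_space_uniform_measure)

interpretation seg: prob_space seg by (rule seg_props)
interpretation die: prob_space die by (rule die_props)
interpretation die_die: pair_prob_space die die ..
interpretation seg_seg: pair_prob_space seg seg ..

declare seg_props(2,3)[simp, measurable_cong] die_props(2,3)[simp, measurable_cong]

lemma seg_integral:
  fixes f :: "real \<Rightarrow> real"
  assumes [measurable]: "f \<in> borel_measurable borel"
  shows "(\<integral>x. f x \<partial>seg) = (\<integral>x. f x * indicator {0..2} x \<partial>lborel) / 2"
proof -
  have "seg = density lborel (\<lambda>x. ennreal (indicator {0..2} x / 2))"
    unfolding seg_def uniform_measure_def
    by (intro density_cong) (auto simp: indicator_def simp flip: ennreal_divide_numeral)
  then have "(\<integral>x. f x \<partial>seg) = (\<integral>x. f x \<partial>density lborel (\<lambda>x. ennreal (indicator {0..2} x / 2)))" by metis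
  also have "\<dots> = (\<integral>x. (indicator {0..2} x / 2) *\<^sub>R f x \<partial>lborel)"
    by (rule integral_density) auto
  also have "\<dots> = (\<integral>x. f x * indicator {0..2} x / 2 \<partial>lborel)"
    by (intro Bochner_Integration.integral_cong) auto
  finally show ?thesis by simp
qed

lemma die_integral:
  fixes f :: "real \<times> real \<Rightarrow> real"
  assumes [measurable]: "f \<in> borel_measurable borel"
  shows "(\<integral>x. f x \<partial>die) = (\<integral>x. f x * indicator kite x \<partial>lborel) / 2"
proof -
  have "die = density lborel (\<lambda>x. ennreal (indicator kite x / 2))"
    unfolding die_def uniform_measure_def kite_measure
    by (intro density_cong) (auto simp: indicator_def simp flip: ennreal_divide_numeral)
  then have "(\<integral>x. f x \<partial>die) = (\<integral>x. f x \<partial>density lborel (\<lambda>x. ennreal (indicator kite x / 2)))" by metis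
  also have "\<dots> = (\<integral>x. (indicator kite x / 2) *\<^sub>R f x \<partial>lborel)"
    by (rule integral_density) auto
  also have "\<dots> = (\<integral>x. f x * indicator kite x / 2 \<partial>lborel)"
    by (intro Bochner_Integration.integral_cong) auto
  finally show ?thesis by simp
qed

text \<open>
  An area-preserving parametrization of the plane whose first parameter will be one of the three sorted
  coordinates \<open>x\<close>, \<open>y\<close>, \<open>w\<close>; all of these vary over the interval from 0
  to 2.
\<close>
definition chart :: "(real \<Rightarrow> real \<Rightarrow> real \<times> real) \<Rightarrow> bool" where
  "chart p \<longleftrightarrow> (\<lambda>z. p (fst z) (snd z)) \<in> borel_measurable borel \<and>
     distr lborel borel (\<lambda>z. p (fst z) (snd z)) = lborel \<and>
     (\<forall>t y. p t y \<in> kite \<longrightarrow> t \<in> {0..2} \<and> y \<in> {0..2})"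

text \<open>
  The factor 2 is the quotient of the area 4 of the parameter square and the area 2 of the kite, so that
  integrating \<open>fibre\<close> over \<open>seg\<close> gives the expectation over \<open>die\<close>. In
  terms of Lebesgue measure, \<open>fibre p g t\<close> is just the integral of \<open>g\<close> along the
  line.
\<close>
definition fibre :: "(real \<Rightarrow> real \<Rightarrow> real \<times> real) \<Rightarrow> (real \<times> real \<Rightarrow> real) \<Rightarrow> real \<Rightarrow> real" where
  "fibre p g t = (\<integral>y. 2 * indicator kite (p t y) * g (p t y) \<partial>seg)"

definition px :: "real \<Rightarrow> real \<Rightarrow> real \<times> real" where "px t y = (t, y)"
definition py :: "real \<Rightarrow> real \<Rightarrow> real \<times> real" where "py t x = (x, t)"
text \<open>
  On this line the middle coordinate \<open>1 + y - x\<close> has the value \<open>t\<close>.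
\<close>
definition pw :: "real \<Rightarrow> real \<Rightarrow> real \<times> real" where "pw t x = (x, t + x - 1)"

lemma chart_px: "chart px"
proof -
  have "distr lborel borel (\<lambda>z::real \<times> real. z) = lborel"
    by (rule distr_id2) simp
  then show ?thesis by (auto simp: chart_def px_def dest!: kite_bounds)
qed

lemma swap_lborel: "distr lborel borel (\<lambda>z. (snd z, fst z)) = (lborel :: (real \<times> real) measure)"
proof -
  have "distr lborel borel (\<lambda>z. (snd z, fst z)) = distr (lborel :: (real \<times> real) measure) lborel (\<lambda>z. (snd z, fst z))"
    by (rule distr_cong) auto
  then show ?thesis
    using lborel_pair.distr_pair_swap[where ?'a = real and ?'b = real]
    by (simp add: lborel_prod case_prod_unfold)
qed

lemma chart_py: "chart py"
  unfolding chart_def py_def using swap_lborel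
  by (auto dest!: kite_bounds simp: borel_prod[symmetric])

lemma nn_integral_lborel_shift:
  fixes f :: "real \<Rightarrow> ennreal"
  assumes "f \<in> borel_measurable borel"
  shows "(\<integral>\<^sup>+x. f (c + x) \<partial>lborel) = (\<integral>\<^sup>+x. f x \<partial>lborel)"
  using nn_integral_real_affine[of f 1 c] assms by simp

lemma chart_pw: "chart pw"
proof -
  have [measurable]: "(\<lambda>z. pw (fst z) (snd z)) \<in> borel_measurable borel"
    unfolding pw_def by (intro borel_measurable_continuous_onI continuous_intros)
  have "distr lborel borel (\<lambda>z. pw (fst z) (snd z)) = (lborel :: (real \<times> real) measure)"
  proof (rule measure_eqI)
    fix A assume "A \<in> sets (distr lborel borel (\<lambda>z. pw (fst z) (snd z)))"
    then have [measurable]: "A \<in> sets borel" by simp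
    have "emeasure (distr lborel borel (\<lambda>z. pw (fst z) (snd z))) A = (\<integral>\<^sup>+z. indicator A z \<partial>distr lborel borel (\<lambda>z. pw (fst z) (snd z)))"
      by simp
    also have "\<dots> = (\<integral>\<^sup>+z. indicator A (pw (fst z) (snd z)) \<partial>lborel)"
      by (subst nn_integral_distr) (auto simp: case_prod_unfold)
    also have "\<dots> = (\<integral>\<^sup>+c. \<integral>\<^sup>+t. indicator A (c, (c - 1) + t) \<partial>lborel \<partial>lborel)"
      by (subst nn_integral_lborel_Pair(2)) (auto simp: pw_def algebra_simps, simp flip: pw_def)
    also have "\<dots> = (\<integral>\<^sup>+c. \<integral>\<^sup>+t. indicator A (c, t) \<partial>lborel \<partial>lborel)"
    proof (rule nn_integral_cong)
      fix c :: real
      have "(\<lambda>t. indicator A (c, t) :: ennreal) \<in> borel_measurable borel"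
        by (rule measurable_compose[OF borel_measurable_continuous_onI[of "\<lambda>t. (c, t)"]]) (auto intro!: continuous_intros)
      from nn_integral_lborel_shift[OF this, of "c - 1"]
      show "(\<integral>\<^sup>+t. indicator A (c, (c - 1) + t) \<partial>lborel) = (\<integral>\<^sup>+t. indicator A (c, t) \<partial>lborel)" .
    qed
    also have "\<dots> = emeasure lborel A"
      by (subst nn_integral_lborel_Pair(1)[symmetric]) auto
    finally show "emeasure (distr lborel borel (\<lambda>z. pw (fst z) (snd z))) A = emeasure lborel A" .
  qed simp
  moreover have "(\<lambda>z. pw (fst z) (snd z)) \<in> borel_measurable borel" by fact
  ultimately show ?thesis
    unfolding chart_def by (simp only: simp_thms) (auto simp: pw_def kite_def)
qed

lemma chartD:
  assumes "chart p"
  shows "(\<lambda>z. p (fst z) (snd z)) \<in> borel_measurable borel"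
    and "distr lborel borel (\<lambda>z. p (fst z) (snd z)) = lborel"
    and "p t y \<in> kite \<Longrightarrow> t \<in> {0..2} \<and> y \<in> {0..2}"
  using assms by (auto simp: chart_def)

lemma bounded_kite_integrable:
  fixes f :: "real \<times> real \<Rightarrow> real"
  assumes [measurable]: "f \<in> borel_measurable borel" and B: "\<And>z. \<bar>f z\<bar> \<le> B"
  shows "integrable lborel (\<lambda>z. f z * indicator kite z)"
proof (rule integrableI_bounded_set[of kite _ _ B])
  show "emeasure lborel kite < \<infinity>" by (simp add: kite_measure)
  show "AE z in lborel. z \<in> kite \<longrightarrow> norm (f z * indicator kite z) \<le> B" using B by (auto simp: indicator_def)
qed (auto simp: indicator_def)

lemma die_fibre:
  fixes g :: "real \<times> real \<Rightarrow> real"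
  assumes p: "chart p" and g [measurable]: "g \<in> borel_measurable borel" and B: "\<And>z. \<bar>g z\<bar> \<le> B"
  shows "(\<integral>z. g z \<partial>die) = (\<integral>t. fibre p g t \<partial>seg)"
proof -
  note [measurable] = chartD(1)[OF p]
  have p2 [measurable]: "(\<lambda>z. p (fst z) (snd z)) \<in> borel_measurable (borel \<Otimes>\<^sub>M borel)"
    using chartD(1)[OF p] by (simp add: borel_prod)
  have pt [measurable]: "p t \<in> borel_measurable borel" for t
    using measurable_compose[OF measurable_Pair1' p2, of t] by simp
  have m [measurable]: "(\<lambda>z. g (p (fst z) (snd z)) * indicator kite (p (fst z) (snd z))) \<in> borel_measurable (borel \<Otimes>\<^sub>M borel)"
    by measurable
  have int: "integrable (distr lborel borel (\<lambda>z. p (fst z) (snd z))) (\<lambda>z. g z * indicator kite z)"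
    unfolding chartD(2)[OF p] by (rule bounded_kite_integrable[OF g B])
  have int': "integrable (lborel \<Otimes>\<^sub>M lborel) (\<lambda>z. g (p (fst z) (snd z)) * indicator kite (p (fst z) (snd z)))"
    using integrable_distr[OF _ int] by (simp add: lborel_prod)
  have "(\<integral>z. g z \<partial>die) = (\<integral>z. g z * indicator kite z \<partial>distr lborel borel (\<lambda>z. p (fst z) (snd z))) / 2"
    unfolding chartD(2)[OF p] by (rule die_integral[OF g])
  also have "\<dots> = (\<integral>z. g (p (fst z) (snd z)) * indicator kite (p (fst z) (snd z)) \<partial>lborel) / 2"
    by (subst integral_distr) auto
  also have "\<dots> = (\<integral>t. \<integral>y. g (p t y) * indicator kite (p t y) \<partial>lborel \<partial>lborel) / 2"
    using lborel_pair.integral_fst'[OF int'] by (simp add: lborel_prod)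
  also have "\<dots> = (\<integral>t. (\<integral>y. 2 * indicator kite (p t y) * g (p t y) * indicator {0..2} y \<partial>lborel) / 2 * indicator {0..2} t \<partial>lborel) / 2"
  proof -
    have "(\<integral>y. g (p t y) * indicator kite (p t y) \<partial>lborel)
        = (\<integral>y. 2 * indicator kite (p t y) * g (p t y) * indicator {0..2} y \<partial>lborel) / 2 * indicator {0..2} t" for t
    proof -
      have "(\<lambda>y. 2 * indicator kite (p t y) * g (p t y) * indicator {0..2} y) = (\<lambda>y. 2 * (g (p t y) * indicator kite (p t y)))"
        using chartD(3)[OF p, of t] by (auto simp: indicator_def fun_eq_iff)
      moreover have "(\<lambda>y. g (p t y) * indicator kite (p t y)) = (\<lambda>y. 0)" if "t \<notin> {0..2}"
        using chartD(3)[OF p, of t] that by (auto simp: indicator_def fun_eq_iff)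
      ultimately show ?thesis by (cases "t \<in> {0..2}") (auto simp: indicator_def)
    qed
    then show ?thesis by (intro arg_cong[where f = "\<lambda>x. x / 2"] Bochner_Integration.integral_cong refl)
  qed
  also have "\<dots> = (\<integral>t. fibre p g t * indicator {0..2} t \<partial>lborel) / 2"
    unfolding fibre_def by (subst seg_integral) auto
  also have "\<dots> = (\<integral>t. fibre p g t \<partial>seg)"
    unfolding fibre_def by (subst (2) seg_integral) auto
  finally show ?thesis .
qed

lemma (in prob_space) expectation_bound:
  fixes f :: "'a \<Rightarrow> real"
  assumes B: "\<And>x. \<bar>f x\<bar> \<le> B"
  shows "\<bar>expectation f\<bar> \<le> B"
proof (cases "integrable M f")
  case True
  then show ?thesis
    using integral_le_const[OF True, of B] integral_ge_const[OF True, of "- B"] B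
    by (force simp: abs_le_iff minus_le_iff intro!: AE_I2)
next
  case False
  then show ?thesis using B[of undefined] by (simp add: not_integrable_integral_eq)
qed

lemma fibre_bound:
  assumes "\<And>z. \<bar>g z\<bar> \<le> B"
  shows "\<bar>fibre p g t\<bar> \<le> 2 * B"
  unfolding fibre_def
proof (rule seg.expectation_bound)
  have "0 \<le> B" using assms[of undefined] by linarith
  then show "\<bar>2 * indicator kite (p t y) * g (p t y)\<bar> \<le> 2 * B" for y
    using assms[of "p t y"] by (auto simp: indicator_def abs_mult)
qed

text \<open>
  For fixed values of \<open>\<xi> a\<close> and \<open>\<eta> c\<close> the first factor depends on
  \<open>c\<close> only and the second on \<open>a\<close> only, so the two inner integrals along the lines
  separate. This is where the four-dimensional integral becomes a two-dimensional one.
\<close>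
lemma cycle_fibre:
  fixes f g :: "real \<Rightarrow> real \<times> real \<Rightarrow> real"
  assumes p: "chart p" and q: "chart q"
    and f: "(\<lambda>z. f (fst z) (snd z)) \<in> borel_measurable (borel \<Otimes>\<^sub>M borel)"
    and g: "(\<lambda>z. g (fst z) (snd z)) \<in> borel_measurable (borel \<Otimes>\<^sub>M borel)"
    and fB: "\<And>t z. \<bar>f t z\<bar> \<le> B" and gB: "\<And>t z. \<bar>g t z\<bar> \<le> B"
    and \<xi> [measurable]: "\<xi> \<in> borel_measurable borel" and \<eta> [measurable]: "\<eta> \<in> borel_measurable borel"
    and \<xi>p: "\<And>t y. \<xi> (p t y) = t" and \<eta>q: "\<And>t y. \<eta> (q t y) = t"
  shows "(\<integral>a. \<integral>c. f (\<xi> a) c * g (\<eta> c) a \<partial>die \<partial>die) = (\<integral>t. \<integral>r. fibre q (f t) r * fibre p (g r) t \<partial>seg \<partial>seg)"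
proof -
  have B: "0 \<le> B" using fB[of undefined undefined] by linarith
  have pm: "(\<lambda>z. p (fst z) (snd z)) \<in> borel_measurable (borel \<Otimes>\<^sub>M borel)"
    and qm: "(\<lambda>z. q (fst z) (snd z)) \<in> borel_measurable (borel \<Otimes>\<^sub>M borel)"
    using chartD(1)[OF p] chartD(1)[OF q] by (simp_all add: borel_prod)
  have [measurable]: "(\<lambda>w. p (u w) (v w)) \<in> borel_measurable M" "(\<lambda>w. q (u w) (v w)) \<in> borel_measurable M"
    if "u \<in> borel_measurable M" "v \<in> borel_measurable M" for u v :: "'c \<Rightarrow> real" and M
    using measurable_compose[OF measurable_Pair[OF that] pm] measurable_compose[OF measurable_Pair[OF that] qm] by simp_all
  have [measurable]: "(\<lambda>w. f (u w) (v w)) \<in> borel_measurable M" "(\<lambda>w. g (u w) (v w)) \<in> borel_measurable M"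
    if "u \<in> borel_measurable M" "v \<in> borel_measurable M" for u :: "'c \<Rightarrow> real" and v and M
    using measurable_compose[OF measurable_Pair[OF that] f] measurable_compose[OF measurable_Pair[OF that] g] by simp_all
  define F where "F t r = fibre q (f t) r" for t r
  have Fm [measurable]: "(\<lambda>w. F (u w) (v w)) \<in> borel_measurable M"
    if [measurable]: "u \<in> borel_measurable M" "v \<in> borel_measurable M" for u v :: "'c \<Rightarrow> real" and M
    unfolding F_def fibre_def by measurable
  have FB: "\<bar>F t r\<bar> \<le> 2 * B" for t r unfolding F_def by (rule fibre_bound) (rule fB)
  define h where "h a = (\<integral>c. f (\<xi> a) c * g (\<eta> c) a \<partial>die)" for a
  have fg: "\<bar>f t c * g r a\<bar> \<le> B * B" for t c r a
    unfolding abs_mult by (rule mult_mono) (auto simp: fB gB B)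
  have hB: "\<bar>h a\<bar> \<le> B * B" for a unfolding h_def by (rule die.expectation_bound) (rule fg)
  have h: "h a = (\<integral>r. F (\<xi> a) r * g r a \<partial>seg)" for a
  proof -
    have "h a = (\<integral>r. fibre q (\<lambda>c. f (\<xi> a) c * g (\<eta> c) a) r \<partial>seg)"
      unfolding h_def by (rule die_fibre[OF q]) (measurable, rule fg)
    also have "\<dots> = (\<integral>r. F (\<xi> a) r * g r a \<partial>seg)"
      unfolding F_def fibre_def \<eta>q
      by (subst Bochner_Integration.integral_mult_left_zero[symmetric]) (simp add: mult.assoc)
    finally show ?thesis .
  qed
  have hm [measurable]: "h \<in> borel_measurable borel"
    unfolding h by measurable
  have "(\<integral>a. h a \<partial>die) = (\<integral>t. fibre p h t \<partial>seg)"
    by (rule die_fibre[OF p hm hB])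
  also have "\<dots> = (\<integral>t. \<integral>r. F t r * fibre p (g r) t \<partial>seg \<partial>seg)"
  proof (rule Bochner_Integration.integral_cong[OF refl])
    fix t
    let ?k = "\<lambda>y r. 2 * indicator kite (p t y) * (F t r * g r (p t y))"
    have "integrable (seg \<Otimes>\<^sub>M seg) (\<lambda>(y, r). ?k y r)"
    proof (rule seg_seg.integrable_const_bound[where B = "2 * (2 * B * B)"])
      have "\<bar>F t r\<bar> * \<bar>g r z\<bar> \<le> 2 * B * B" for r z
        by (rule mult_mono) (auto simp: FB gB B)
      then have "\<bar>?k y r\<bar> \<le> 2 * (2 * B * B)" for y r
        using B by (simp add: indicator_def abs_mult mult.assoc)
      then show "AE x in seg \<Otimes>\<^sub>M seg. norm (case x of (y, r) \<Rightarrow> ?k y r) \<le> 2 * (2 * B * B)"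
        by auto
    qed measurable
    from seg_seg.Fubini_integral[OF this]
    have "(\<integral>y. \<integral>r. ?k y r \<partial>seg \<partial>seg) = (\<integral>r. \<integral>y. ?k y r \<partial>seg \<partial>seg)" by simp
    moreover have "(\<integral>y. ?k y r \<partial>seg) = F t r * fibre p (g r) t" for r
      unfolding fibre_def by (subst Bochner_Integration.integral_mult_right_zero[symmetric]) (simp add: ac_simps)
    moreover have "fibre p h t = (\<integral>y. \<integral>r. ?k y r \<partial>seg \<partial>seg)"
      unfolding fibre_def h \<xi>p by simp
    ultimately show "fibre p h t = (\<integral>r. F t r * fibre p (g r) t \<partial>seg)" by simp
  qed
  finally show ?thesis unfolding h_def F_def .
qed

section \<open>Correlations of coordinate signs\<close>

text \<open>
  For \<open>n \<ge> 2\<close> these powers of the positive part are differentiable, with a derivative of the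
  same kind. Piecewise polynomials written with them can be integrated without case distinctions. (For
  \<open>n = 0\<close> the function is constantly 1.)
\<close>
definition ramp :: "nat \<Rightarrow> real \<Rightarrow> real" where "ramp n u = (max 0 u) ^ n"

lemma ramp_pos: "0 \<le> u \<Longrightarrow> ramp n u = u ^ n" by (simp add: ramp_def)
lemma ramp_neg: "u \<le> 0 \<Longrightarrow> 0 < n \<Longrightarrow> ramp n u = 0" by (simp add: ramp_def)

lemma continuous_ramp [continuous_intros]:
  "continuous F f \<Longrightarrow> continuous F (\<lambda>x. ramp n (f x))"
  unfolding ramp_def by (intro continuous_intros)

lemma ramp_deriv0:
  assumes n: "1 < n" shows "(ramp n has_real_derivative real n * ramp (n - 1) x) (at x)"
proof (cases x "0 :: real" rule: linorder_cases)
  case less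
  have "((\<lambda>_. 0) has_real_derivative 0) (at x)" by simp
  moreover have "\<forall>\<^sub>F y in nhds x. ramp n y = 0"
    using eventually_nhds_in_open[of "{..<0}" x] less n by (auto elim!: eventually_mono simp: ramp_neg)
  ultimately have "(ramp n has_real_derivative 0) (at x)" by (subst DERIV_cong_ev[OF refl _ refl]) auto
  then show ?thesis using less n by (simp add: ramp_neg)
next
  case greater
  have "((\<lambda>y. y ^ n) has_real_derivative real n * x ^ (n - 1)) (at x)" by (auto intro!: derivative_eq_intros)
  moreover have "\<forall>\<^sub>F y in nhds x. ramp n y = y ^ n"
    using eventually_nhds_in_open[of "{0<..}" x] greater n by (auto elim!: eventually_mono simp: ramp_pos)
  ultimately have "(ramp n has_real_derivative real n * x ^ (n - 1)) (at x)" by (subst DERIV_cong_ev[OF refl _ refl]) auto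
  then show ?thesis using greater n by (simp add: ramp_pos)
next
  case equal
  have "(ramp n (0 + h) - ramp n 0) / h = ramp (n - 1) h" if "h \<noteq> 0" for h
    using n that by (cases "0 \<le> h") (auto simp: ramp_pos ramp_neg power_diff)
  moreover have "(ramp (n - 1) \<longlongrightarrow> 0) (at 0)"
  proof -
    have "isCont (ramp (n - 1)) 0" using continuous_ramp[of "at 0" "\<lambda>x. x" "n - 1"] by simp
    then show ?thesis using n by (simp add: isCont_def ramp_neg)
  qed
  ultimately have "((\<lambda>h. (ramp n (0 + h) - ramp n 0) / h) \<longlongrightarrow> 0) (at 0)"
    by (subst tendsto_cong[where g = "ramp (n - 1)"]) (auto simp: eventually_at_filter)
  then show ?thesis using equal n by (simp add: DERIV_def ramp_neg)
qed

lemma ramp_deriv: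
  "1 < n \<Longrightarrow> (u has_real_derivative D) (at x) \<Longrightarrow>
   ((\<lambda>x. ramp n (u x)) has_real_derivative real n * ramp (n - 1) (u x) * D) (at x)"
  using DERIV_chain2[OF ramp_deriv0] by blast

lemmas deriv_rules = DERIV_const DERIV_ident DERIV_add DERIV_diff DERIV_minus DERIV_cmult DERIV_cdivide ramp_deriv DERIV_power

text \<open>
  The sign changes once, at \<open>c\<close>; the clamp to the interval covers values of \<open>c\<close>
  outside of it.
\<close>
lemma sgn_FTC:
  fixes f F :: "real \<Rightarrow> real"
  assumes ab: "a \<le> b" and F: "\<And>x. (F has_real_derivative f x) (at x)" "\<And>x. isCont f x"
  shows "has_bochner_integral lborel (\<lambda>x. sgn (c - x) * f x * indicator {a..b} x) (2 * F (max a (min b c)) - F a - F b)"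
proof -
  let ?c = "max a (min b c)"
  have c: "a \<le> ?c" "?c \<le> b" using ab by auto
  have "has_bochner_integral lborel (\<lambda>x. f x * indicator {a..?c} x - f x * indicator {?c..b} x)
      ((F ?c - F a) - (F b - F ?c))"
    by (intro has_bochner_integral_diff FTC_Icc F c)
  moreover have "AE x in lborel. sgn (c - x) * f x * indicator {a..b} x
      = f x * indicator {a..?c} x - f x * indicator {?c..b} x"
    using AE_lborel_singleton[of c] AE_lborel_singleton[of a] AE_lborel_singleton[of b]
  proof eventually_elim
    case (elim x)
    then consider "x < a" | "b < x" | "a < x" "x < b" "x < c" | "a < x" "x < b" "c < x" by linarith
    then show ?case by cases (use ab in \<open>auto simp: indicator_def sgn_if\<close>)
  qed
  moreover have "(\<lambda>x. sgn (c - x) * f x * indicator {a..b} x) \<in> borel_measurable lborel"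
  proof -
    have [measurable]: "f \<in> borel_measurable borel"
      by (rule borel_measurable_continuous_onI) (simp add: F continuous_at_imp_continuous_on)
    show ?thesis by measurable
  qed
  ultimately show ?thesis
    by (subst has_bochner_integral_cong_AE) (auto simp: has_bochner_integral_iff)
qed

lemma abs_FTC: "(l::real) \<le> h \<Longrightarrow> has_bochner_integral lborel (\<lambda>x. sgn (c - x) * indicator {l..h} x) (\<bar>c - l\<bar> - \<bar>c - h\<bar>)"
proof -
  assume "l \<le> h"
  then have "2 * max l (min h c) - l - h = \<bar>c - l\<bar> - \<bar>c - h\<bar>" by (auto simp: max_def min_def)
  then show ?thesis using sgn_FTC[of l h "\<lambda>x. x" "\<lambda>x. 1" c] \<open>l \<le> h\<close> by simp
qed

text \<open>
  The fibre of the kite is an interval; this turns the average over \<open>seg\<close> back into a plain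
  integral.
\<close>
lemma fibre_interval:
  fixes k :: "real \<Rightarrow> real"
  assumes k: "has_bochner_integral lborel (\<lambda>y. k y * indicator {l..h} y) I"
    and kite: "\<And>y. p t y \<in> kite \<longleftrightarrow> y \<in> {l..h}" and sub: "0 \<le> l" "h \<le> 2"
    and g: "\<And>y. y \<in> {l..h} \<Longrightarrow> g (p t y) = k y"
  shows "fibre p g t = I"
proof -
  have [measurable]: "(\<lambda>y. k y * indicator {l..h} y) \<in> borel_measurable borel"
    using borel_measurable_has_bochner_integral[OF k] by simp
  have "fibre p g t = (\<integral>y. 2 * (k y * indicator {l..h} y) \<partial>seg)"
    unfolding fibre_def by (intro Bochner_Integration.integral_cong) (auto simp: indicator_def kite g)
  also have "\<dots> = (\<integral>y. 2 * (k y * indicator {l..h} y) * indicator {0..2} y \<partial>lborel) / 2"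
    by (rule seg_integral) measurable
  also have "\<dots> = (\<integral>y. 2 * (k y * indicator {l..h} y) \<partial>lborel) / 2"
    using sub by (intro arg_cong[where f = "\<lambda>x. x / 2"] Bochner_Integration.integral_cong) (auto simp: indicator_def)
  also have "\<dots> = I"
    using k by (simp add: has_bochner_integral_iff)
  finally show ?thesis .
qed

text \<open>
  The fibre of the kite over a value of the middle coordinate, parametrized by \<open>x\<close>.
\<close>
definition mid_lo :: "real \<Rightarrow> real" where "mid_lo t = (if t \<le> 1 then 1 - t else 0)"
definition mid_hi :: "real \<Rightarrow> real" where "mid_hi t = (if t \<le> 1 then 1 + t else 4 - 2 * t)"

lemma px_kite: "t \<in> {0..2} \<Longrightarrow> px t y \<in> kite \<longleftrightarrow> y \<in> {lo t..hi t}" by (simp add: px_def kite_iff)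
lemma py_kite: "t \<in> {0..2} \<Longrightarrow> py t y \<in> kite \<longleftrightarrow> y \<in> {lo t..hi t}"
  using kite_swap[of t y] by (simp add: py_def kite_iff)
lemma pw_kite: "t \<in> {0..2} \<Longrightarrow> pw t y \<in> kite \<longleftrightarrow> y \<in> {mid_lo t..mid_hi t}"
  by (auto simp: pw_def kite_def mid_lo_def mid_hi_def)

lemma lo_hi_bounds: "t \<in> {0..2} \<Longrightarrow> 0 \<le> lo t \<and> lo t \<le> hi t \<and> hi t \<le> 2" by (auto simp: lo_def hi_def)
lemma lw_hw_bounds: "t \<in> {0..2} \<Longrightarrow> 0 \<le> mid_lo t \<and> mid_lo t \<le> mid_hi t \<and> mid_hi t \<le> 2" by (auto simp: mid_lo_def mid_hi_def)

text \<open>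
  For a die with sorted entries \<open>p \<le> q \<le> r\<close> this is \<open>4 q - 1\<close>.
\<close>
definition mid :: "real \<times> real \<Rightarrow> real" where "mid z = 1 + snd z - fst z"
text \<open>
  The effect on sorted coordinates of replacing each entry \<open>a\<close> of a die by \<open>1 - a\<close>.
\<close>
definition flip :: "real \<times> real \<Rightarrow> real \<times> real" where "flip z = (snd z, fst z)"

lemma flip_simps [simp]: "fst (flip z) = snd z" "snd (flip z) = fst z" "flip (flip z) = z" "mid (flip z) = 2 - mid z"
  by (auto simp: flip_def mid_def)

lemma projections_measurable [measurable]: "mid \<in> borel_measurable borel" "flip \<in> borel_measurable borel"
   "(fst :: real \<times> real \<Rightarrow> real) \<in> borel_measurable borel" "(snd :: real \<times> real \<Rightarrow> real) \<in> borel_measurable borel"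
  unfolding mid_def flip_def by (intro borel_measurable_continuous_onI continuous_intros)+

lemma kite_flip: "flip z \<in> kite \<longleftrightarrow> z \<in> kite"
  using kite_swap[of "snd z" "fst z"] by (simp add: flip_def)

lemma die_flip:
  fixes g :: "real \<times> real \<Rightarrow> real"
  assumes [measurable]: "g \<in> borel_measurable borel"
  shows "(\<integral>z. g (flip z) \<partial>die) = (\<integral>z. g z \<partial>die)"
proof -
  have "(\<integral>z. g z \<partial>die) = (\<integral>z. g z * indicator kite z \<partial>distr lborel borel flip) / 2"
    using swap_lborel by (simp add: die_integral flip_def[abs_def])
  also have "\<dots> = (\<integral>z. g (flip z) * indicator kite (flip z) \<partial>lborel) / 2"
    by (subst integral_distr) auto
  also have "\<dots> = (\<integral>z. g (flip z) * indicator kite z \<partial>lborel) / 2"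
    by (simp add: indicator_def kite_flip)
  also have "\<dots> = (\<integral>z. g (flip z) \<partial>die)" by (subst die_integral) auto
  finally show ?thesis by simp
qed

lemma fibre_outside: "chart p \<Longrightarrow> t \<notin> {0..2} \<Longrightarrow> fibre p g t = 0"
proof -
  assume "chart p" "t \<notin> {0..2}"
  then have "p t y \<notin> kite" for y using chartD(3)[of p t y] by blast
  then show ?thesis by (simp add: fibre_def)
qed

lemma seg_interval:
  fixes f g :: "real \<Rightarrow> real" and I :: real
  assumes "has_bochner_integral lborel (\<lambda>x. f x * indicator {0..2} x) I"
    and g: "\<And>x. x \<in> {0..2} \<Longrightarrow> g x = f x" "\<And>x. x \<notin> {0..2} \<Longrightarrow> g x = 0"
  shows "(\<integral>x. g x \<partial>seg) = I / 2"
proof -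
  have g': "g = (\<lambda>x. f x * indicator {0..2} x)"
  proof
    fix x show "g x = f x * indicator {0..2} x" using g[of x] by (cases "x \<in> {0..2}") auto
  qed
  have [measurable]: "g \<in> borel_measurable borel"
    using borel_measurable_has_bochner_integral[OF assms(1)] by (simp add: g')
  have "(\<integral>x. g x \<partial>seg) = (\<integral>x. g x * indicator {0..2} x \<partial>lborel) / 2" by (rule seg_integral) measurable
  also have "\<dots> = (\<integral>x. f x * indicator {0..2} x \<partial>lborel) / 2"
    by (intro arg_cong[where f = "\<lambda>x. x / 2"] Bochner_Integration.integral_cong) (auto simp: g' indicator_def)
  also have "\<dots> = I / 2" using assms(1) by (simp add: has_bochner_integral_iff)
  finally show ?thesis .
qed

lemma die_sgn:
  assumes p: "chart p" and m: "g \<in> borel_measurable borel" and B: "\<And>z. \<bar>g z\<bar> \<le> B"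
    and F: "\<And>x. (F has_real_derivative f x) (at x)" "\<And>x. isCont f x" and t: "t \<in> {0..2}"
    and g: "\<And>x. x \<in> {0..2} \<Longrightarrow> fibre p g x = sgn (t - x) * f x"
  shows "(\<integral>z. g z \<partial>die) = F t - (F 0 + F 2) / 2"
proof -
  have S: "has_bochner_integral lborel (\<lambda>x. sgn (t - x) * f x * indicator {0..2} x) (2 * F t - F 0 - F 2)"
    using sgn_FTC[of 0 2 F f t] F t by auto
  have "(\<integral>z. g z \<partial>die) = (\<integral>x. fibre p g x \<partial>seg)" by (rule die_fibre) fact+
  also have "\<dots> = (2 * F t - F 0 - F 2) / 2"
    by (rule seg_interval[OF S]) (auto simp: g fibre_outside[OF p])
  finally show ?thesis by (simp add: field_simps)
qed

lemma sgn_bound: "\<bar>sgn (a::real)\<bar> \<le> 1" "\<bar>sgn (a::real) * sgn b\<bar> \<le> 1"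
  by (auto simp: sgn_if)

text \<open>
  This and the next function are closed forms of the expected product of two coordinate signs of a random die:
  \<open>x\<close> against \<open>y\<close>, and \<open>x\<close> against the middle coordinate
  \<open>w\<close>. Two integrations, each of which turns a sign into ramps, produce them.
\<close>
definition corr_xy :: "real \<Rightarrow> real \<Rightarrow> real" where
  "corr_xy t y = 1 - t - y - t\<^sup>2 / 4 - y\<^sup>2 / 4 + 2 * t * y - ramp 2 (t - 1) - ramp 2 (y - 1)
     + 2 * ramp 2 (t - 1 - y / 2) + 2 * ramp 2 (y - 1 - t / 2)"

definition corr_xw :: "real \<Rightarrow> real \<Rightarrow> real" where
  "corr_xw t w = - 1 + t + t\<^sup>2 / 4 + w\<^sup>2 + ramp 2 (t - 1) - ramp 2 (w - 1) - ramp 2 (t + w - 1)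
     - ramp 2 (t - w - 1) + ramp 2 (t + 2 * w - 4) / 2"

lemma corr_xy_integral:
  assumes t: "t \<in> {0..2}" and y: "y \<in> {0..2}"
  shows "(\<integral>b. sgn (t - fst b) * sgn (y - snd b) \<partial>die) = corr_xy t y"
proof -
  define f where "f = (\<lambda>x. 2 * y - 1 - x / 2 - 2 * ramp 1 (x - 1) + 4 * ramp 1 (x - 1 - y / 2) - 2 * ramp 1 (y - 1 - x / 2))"
  define F where "F = (\<lambda>x. (2 * y - 1) * x - x\<^sup>2 / 4 - ramp 2 (x - 1) + 2 * ramp 2 (x - 1 - y / 2) + 2 * ramp 2 (y - 1 - x / 2))"
  have DF: "(F has_real_derivative f x) (at x)" for x
    unfolding F_def f_def by (rule DERIV_cong, (rule deriv_rules | simp; fail)+, simp?)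
  have Cf: "isCont f x" for x unfolding f_def by (intro continuous_intros; simp)
  have fib: "fibre px (\<lambda>b. sgn (t - fst b) * sgn (y - snd b)) x = sgn (t - x) * f x" if x: "x \<in> {0..2}" for x
  proof -
    have "fibre px (\<lambda>b. sgn (t - fst b) * sgn (y - snd b)) x = sgn (t - x) * (\<bar>y - lo x\<bar> - \<bar>y - hi x\<bar>)"
    proof (rule fibre_interval)
      show "has_bochner_integral lborel (\<lambda>u. sgn (t - x) * sgn (y - u) * indicator {lo x..hi x} u)
          (sgn (t - x) * (\<bar>y - lo x\<bar> - \<bar>y - hi x\<bar>))"
        using has_bochner_integral_mult_right[OF abs_FTC[of "lo x" "hi x" y], of "sgn (t - x)"] lo_hi_bounds[OF x]
        by (simp add: mult.assoc)
    qed (use x in \<open>auto simp: px_kite lo_hi_bounds\<close>, auto simp: px_def)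
    also have "\<bar>y - lo x\<bar> - \<bar>y - hi x\<bar> = f x"
      using x y by (cases "x \<le> 1"; cases "0 \<le> x - 1 - y / 2"; cases "0 \<le> y - 1 - x / 2")
        (auto simp: f_def lo_def hi_def ramp_pos ramp_neg abs_if)
    finally show ?thesis .
  qed
  have "(\<integral>b. sgn (t - fst b) * sgn (y - snd b) \<partial>die) = F t - (F 0 + F 2) / 2"
    by (rule die_sgn[OF chart_px _ _ DF Cf t fib, where B = 1]) (auto simp: sgn_bound)
  also have "\<dots> = corr_xy t y"
  proof -
    have "ramp 2 (y - 1 - 2 / 2) = 0" "ramp 2 (0 - 1 - y / 2) = 0" "ramp 2 (0 - 1) = 0" "ramp 2 (2 - 1 - y / 2) = (1 - y / 2)\<^sup>2"
      "ramp 2 (2 - 1) = 1" "ramp 2 (y - 1 - 0 / 2) = ramp 2 (y - 1)"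
      using y by (auto simp: ramp_pos ramp_neg)
    then show ?thesis unfolding corr_xy_def F_def by (simp only:) (simp add: field_simps power2_eq_square)
  qed
  finally show ?thesis .
qed

lemma corr_xw_integral:
  assumes t: "t \<in> {0..2}" and w: "w \<in> {0..2}"
  shows "(\<integral>b. sgn (t - fst b) * sgn (mid b - w) \<partial>die) = corr_xw t w"
proof -
  define f where "f = (\<lambda>x. 3 - 2 * w - 3 * x / 2 + 2 * ramp 1 (w + x / 2 - 2) + 2 * ramp 1 (x - 1)
     - 2 * ramp 1 (x - 1 - w) - 2 * ramp 1 (1 - x - w))"
  define F where "F = (\<lambda>x. (3 - 2 * w) * x - 3 * x\<^sup>2 / 4 + 2 * ramp 2 (w + x / 2 - 2) + ramp 2 (x - 1)
     - ramp 2 (x - 1 - w) + ramp 2 (1 - x - w))"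
  have DF: "(F has_real_derivative f x) (at x)" for x
    unfolding F_def f_def by (rule DERIV_cong, (rule deriv_rules | simp; fail)+, simp?)
  have Cf: "isCont f x" for x unfolding f_def by (intro continuous_intros; simp)
  have fib: "fibre px (\<lambda>b. sgn (t - fst b) * sgn (mid b - w)) x = sgn (t - x) * f x" if x: "x \<in> {0..2}" for x
  proof -
    have "fibre px (\<lambda>b. sgn (t - fst b) * sgn (mid b - w)) x
        = - sgn (t - x) * (\<bar>(w + x - 1) - lo x\<bar> - \<bar>(w + x - 1) - hi x\<bar>)"
    proof (rule fibre_interval)
      show "has_bochner_integral lborel (\<lambda>u. - sgn (t - x) * sgn ((w + x - 1) - u) * indicator {lo x..hi x} u)
          (- sgn (t - x) * (\<bar>(w + x - 1) - lo x\<bar> - \<bar>(w + x - 1) - hi x\<bar>))"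
        using has_bochner_integral_mult_right[OF abs_FTC[of "lo x" "hi x" "w + x - 1"], of "- sgn (t - x)"] lo_hi_bounds[OF x]
        by (simp add: mult.assoc)
      show "sgn (t - fst (px x u)) * sgn (mid (px x u) - w) = - sgn (t - x) * sgn ((w + x - 1) - u)" for u
        using sgn_minus[of "(w + x - 1) - u"] by (simp add: px_def mid_def algebra_simps)
    qed (use x in \<open>auto simp: px_kite lo_hi_bounds\<close>)
    also have "\<bar>(w + x - 1) - lo x\<bar> - \<bar>(w + x - 1) - hi x\<bar> = - f x"
      using x w by (cases "x \<le> 1"; cases "0 \<le> w + x / 2 - 2"; cases "0 \<le> x - 1 - w"; cases "0 \<le> 1 - x - w")
        (auto simp: f_def lo_def hi_def ramp_pos ramp_neg abs_if)
    finally show ?thesis by simp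
  qed
  have "(\<integral>b. sgn (t - fst b) * sgn (mid b - w) \<partial>die) = F t - (F 0 + F 2) / 2"
    by (rule die_sgn[OF chart_px _ _ DF Cf t fib, where B = 1]) (auto simp: sgn_bound)
  also have "\<dots> = corr_xw t w"
  proof -
    have r: "ramp 2 (- u) = u\<^sup>2 - ramp 2 u" for u by (cases "0 \<le> u") (auto simp: ramp_pos ramp_neg)
    have s: "ramp 2 (u / 2) = ramp 2 u / 4" for u by (cases "0 \<le> u") (auto simp: ramp_pos ramp_neg power2_eq_square)
    have "ramp 2 (w + 0 / 2 - 2) = 0" "ramp 2 (0 - 1) = 0" "ramp 2 (0 - 1 - w) = 0" "ramp 2 (2 - 1) = 1" "ramp 2 (1 - 2 - w) = 0"
      "ramp 2 (w + 2 / 2 - 2) = ramp 2 (w - 1)" "ramp 2 (2 - 1 - w) = (w - 1)\<^sup>2 - ramp 2 (w - 1)"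
      "ramp 2 (1 - 0 - w) = (w - 1)\<^sup>2 - ramp 2 (w - 1)" "ramp 2 (1 - t - w) = (t + w - 1)\<^sup>2 - ramp 2 (t + w - 1)"
      "ramp 2 (w + t / 2 - 2) = ramp 2 (t + 2 * w - 4) / 4" "ramp 2 (t - 1 - w) = ramp 2 (t - w - 1)"
      using w r[of "w - 1"] r[of "t + w - 1"] s[of "t + 2 * w - 4"]
      by (auto simp: ramp_pos ramp_neg algebra_simps diff_divide_distrib add_divide_distrib)
    then show ?thesis unfolding corr_xw_def F_def by (simp only:) (simp add: field_simps power2_eq_square)
  qed
  finally show ?thesis .
qed

text \<open>
  The distribution functions of the coordinates \<open>x\<close> and \<open>w\<close>, both piecewise
  quadratic with a break at 1, are the members \<open>(1, 1/4, 1)\<close> and \<open>(0, 1, 2)\<close> of this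
  family, up to the factor 2.
\<close>
definition self_primitive :: "real \<Rightarrow> real \<Rightarrow> real \<Rightarrow> real \<Rightarrow> real" where
  "self_primitive a b c t = a * t + b * t\<^sup>2 - c * ramp 2 (t - 1)"

text \<open>
  The increment of \<open>self_primitive\<close> between the smaller and the larger of \<open>t\<close> and
  \<open>u\<close>, minus 1. Its expansion into ramps makes it easy to integrate in \<open>u\<close>.
\<close>
definition corr_self :: "real \<Rightarrow> real \<Rightarrow> real \<Rightarrow> real \<Rightarrow> real \<Rightarrow> real" where
  "corr_self a b c t u = self_primitive a b c t - self_primitive a b c u - 1
     + 2 * ((a + 2 * b * t - 2 * c * ramp 1 (t - 1)) * ramp 1 (u - t) + b * ramp 2 (u - t) - c * ramp 2 (u - max t 1))"

lemma corr_self_eq: "self_primitive a b c (max t u) - self_primitive a b c (min t u) - 1 = corr_self a b c t u"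
proof (cases "t \<le> u")
  case True
  then show ?thesis
    by (cases "1 \<le> t"; cases "1 \<le> u")
      (auto simp: self_primitive_def corr_self_def ramp_pos ramp_neg max_def min_def power2_eq_square algebra_simps)
next
  case False
  then show ?thesis
    by (auto simp: self_primitive_def corr_self_def ramp_neg max_def min_def)
qed

text \<open>
  Almost everywhere \<open>sgn (t - x) * sgn (x - u)\<close> is 1 between \<open>t\<close> and
  \<open>u\<close> and \<open>- 1\<close> elsewhere, which makes it a combination of two signs and a constant.
\<close>
lemma die_sgn_sgn:
  assumes p: "chart p" and \<xi> [measurable]: "\<xi> \<in> borel_measurable borel" "\<And>x y. \<xi> (p x y) = x"
    and len: "\<And>x. x \<in> {0..2} \<Longrightarrow> fibre p (\<lambda>_. 1) x = f x"
    and F: "\<And>x. (F has_real_derivative f x) (at x)" "\<And>x. isCont f x" "F 0 = 0" "F 2 = 2"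
    and t: "t \<in> {0..2}" and u: "u \<in> {0..2}"
  shows "(\<integral>b. sgn (t - \<xi> b) * sgn (\<xi> b - u) \<partial>die) = F (max t u) - F (min t u) - 1"
proof -
  have fib: "fibre p (\<lambda>b. sgn (t - \<xi> b) * sgn (\<xi> b - u)) x = sgn (t - x) * sgn (x - u) * f x" if "x \<in> {0..2}" for x
  proof -
    have "fibre p (\<lambda>b. sgn (t - \<xi> b) * sgn (\<xi> b - u)) x
        = (\<integral>y. sgn (t - x) * sgn (x - u) * (2 * indicator kite (p x y) * 1) \<partial>seg)"
      unfolding fibre_def \<xi>(2) by (intro Bochner_Integration.integral_cong) auto
    also have "\<dots> = sgn (t - x) * sgn (x - u) * fibre p (\<lambda>_. 1) x"
      unfolding fibre_def by (rule integral_mult_right_zero)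
    finally show ?thesis using len[OF that] by simp
  qed
  have abs: "has_bochner_integral lborel (\<lambda>x. sgn (t - x) * sgn (x - u) * f x * indicator {0..2} x) (2 * (F m - F n) - 2)"
    if m: "m = max t u" and n: "n = min t u" for m n
  proof -
    have "has_bochner_integral lborel (\<lambda>x. sgn (m - x) * f x * indicator {0..2} x) (2 * F (max 0 (min 2 m)) - F 0 - F 2)"
      "has_bochner_integral lborel (\<lambda>x. sgn (n - x) * f x * indicator {0..2} x) (2 * F (max 0 (min 2 n)) - F 0 - F 2)"
      "has_bochner_integral lborel (\<lambda>x. f x * indicator {0..2} x) (F 2 - F 0)"
      by (intro sgn_FTC FTC_Icc F; simp)+
    moreover have "max 0 (min 2 m) = m" "max 0 (min 2 n) = n" using t u m n by auto
    ultimately have S: "has_bochner_integral lborel (\<lambda>x. sgn (m - x) * f x * indicator {0..2} x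
        - sgn (n - x) * f x * indicator {0..2} x - f x * indicator {0..2} x) (2 * (F m - F n) - 2)"
      using has_bochner_integral_diff[OF has_bochner_integral_diff] F(3,4) by fastforce
    have "AE x in lborel. sgn (t - x) * sgn (x - u) * f x * indicator {0..2} x
       = sgn (m - x) * f x * indicator {0..2} x - sgn (n - x) * f x * indicator {0..2} x - f x * indicator {0..2} x"
      using AE_lborel_singleton[of t] AE_lborel_singleton[of u]
    proof eventually_elim
      case (elim x)
      then have "sgn (t - x) * sgn (x - u) = sgn (m - x) - sgn (n - x) - 1"
        unfolding m n by (auto simp: sgn_if max_def min_def)
      then show ?case by (simp only: left_diff_distrib mult_1)
    qed
    moreover have [measurable]: "f \<in> borel_measurable borel"
      by (rule borel_measurable_continuous_onI) (simp add: F continuous_at_imp_continuous_on)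
    ultimately show ?thesis
      using S by (subst has_bochner_integral_cong_AE) (auto simp: has_bochner_integral_iff)
  qed
  have "(\<integral>b. sgn (t - \<xi> b) * sgn (\<xi> b - u) \<partial>die) = (\<integral>x. fibre p (\<lambda>b. sgn (t - \<xi> b) * sgn (\<xi> b - u)) x \<partial>seg)"
    by (rule die_fibre[OF p, where B = 1]) (auto simp: sgn_bound)
  also have "\<dots> = (2 * (F (max t u) - F (min t u)) - 2) / 2"
    by (rule seg_interval[OF abs[OF refl refl]]) (auto simp: fib fibre_outside[OF p])
  also have "\<dots> = F (max t u) - F (min t u) - 1" by (simp add: field_simps)
  finally show ?thesis .
qed

lemma integral_one: "l \<le> h \<Longrightarrow> has_bochner_integral lborel (\<lambda>y. 1 * indicator {l..h} y) (h - l :: real)"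
  by (rule FTC_Icc[where F = "\<lambda>x. x"]) auto

lemma corr_x_self:
  assumes "t \<in> {0..2}" "u \<in> {0..2}"
  shows "(\<integral>b. sgn (t - fst b) * sgn (fst b - u) \<partial>die) = corr_self 1 (1 / 4) 1 t u"
  unfolding corr_self_eq[symmetric]
proof (rule die_sgn_sgn[where f = "\<lambda>x. 1 + x / 2 - 2 * ramp 1 (x - 1)", OF chart_px])
  show "fibre px (\<lambda>_. 1) x = 1 + x / 2 - 2 * ramp 1 (x - 1)" if x: "x \<in> {0..2}" for x
  proof -
    have "fibre px (\<lambda>_. 1) x = hi x - lo x"
      by (rule fibre_interval[OF integral_one]) (use x px_kite lo_hi_bounds in auto)
    then show ?thesis by (auto simp: hi_def lo_def ramp_pos ramp_neg)
  qed
  show "(self_primitive 1 (1 / 4) 1 has_real_derivative 1 + x / 2 - 2 * ramp 1 (x - 1)) (at x)" for x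
    unfolding self_primitive_def[abs_def] by (rule DERIV_cong, (rule deriv_rules | simp; fail)+, simp?)
  show "isCont (\<lambda>x. 1 + x / 2 - 2 * ramp 1 (x - 1)) x" for x by (intro continuous_intros; simp)
qed (use assms in \<open>auto simp: px_def self_primitive_def ramp_def\<close>)

lemma corr_mid_self:
  assumes "t \<in> {0..2}" "u \<in> {0..2}"
  shows "(\<integral>b. sgn (t - mid b) * sgn (mid b - u) \<partial>die) = corr_self 0 1 2 t u"
  unfolding corr_self_eq[symmetric]
proof (rule die_sgn_sgn[where f = "\<lambda>x. 2 * x - 4 * ramp 1 (x - 1)", OF chart_pw])
  show "fibre pw (\<lambda>_. 1) x = 2 * x - 4 * ramp 1 (x - 1)" if x: "x \<in> {0..2}" for x
  proof -
    have "fibre pw (\<lambda>_. 1) x = mid_hi x - mid_lo x"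
      by (rule fibre_interval[OF integral_one]) (use x pw_kite lw_hw_bounds in auto)
    then show ?thesis by (auto simp: mid_hi_def mid_lo_def ramp_pos ramp_neg)
  qed
  show "(self_primitive 0 1 2 has_real_derivative 2 * x - 4 * ramp 1 (x - 1)) (at x)" for x
    unfolding self_primitive_def[abs_def] by (rule DERIV_cong, (rule deriv_rules | simp; fail)+, simp?)
  show "isCont (\<lambda>x. 2 * x - 4 * ramp 1 (x - 1)) x" for x by (intro continuous_intros; simp)
qed (use assms in \<open>auto simp: pw_def mid_def self_primitive_def ramp_def\<close>)

text \<open>
  The coordinate \<open>snd\<close> decreases as the largest entry grows, hence the order of the last
  difference.
\<close>
definition beat :: "real \<times> real \<Rightarrow> real \<times> real \<Rightarrow> real" where
  "beat a b = sgn (fst a - fst b) + sgn (mid a - mid b) + sgn (snd b - snd a)"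

lemma beat_flip: "beat (flip a) (flip b) = - beat a b"
  using sgn_minus[of "mid b - mid a"] sgn_minus[of "fst b - fst a"] sgn_minus[of "snd b - snd a"]
  by (simp add: beat_def algebra_simps)

lemma beat_bound: "\<bar>beat a b\<bar> \<le> 3"
  using sgn_bound(1)[of "fst a - fst b"] sgn_bound(1)[of "mid a - mid b"] sgn_bound(1)[of "snd b - snd a"]
  unfolding beat_def by linarith

text \<open>
  The expected product of the sign of one coordinate against \<open>b\<close> and the outcome of
  \<open>b\<close> against \<open>c\<close>. The corresponding function for \<open>snd\<close> arises from
  \<open>via_fst\<close> by \<open>flip\<close>.
\<close>
definition via_fst :: "real \<Rightarrow> real \<times> real \<Rightarrow> real" where "via_fst t c = (\<integral>b. sgn (t - fst b) * beat b c \<partial>die)"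
definition via_mid :: "real \<Rightarrow> real \<times> real \<Rightarrow> real" where "via_mid t c = (\<integral>b. sgn (t - mid b) * beat b c \<partial>die)"

lemma kite_coords: "c \<in> kite \<Longrightarrow> fst c \<in> {0..2} \<and> snd c \<in> {0..2} \<and> mid c \<in> {0..2}"
  by (cases c) (auto simp: kite_def mid_def)

lemma die_integrable:
  fixes f :: "real \<times> real \<Rightarrow> real"
  assumes "f \<in> borel_measurable borel" "\<And>z. \<bar>f z\<bar> \<le> B"
  shows "integrable die f"
  by (rule die.integrable_const_bound[of _ B]) (use assms in auto)

lemma die_integral_sum3:
  fixes u v w :: "real \<times> real \<Rightarrow> real"
  assumes "u \<in> borel_measurable borel" "v \<in> borel_measurable borel" "w \<in> borel_measurable borel"
    "\<And>z. \<bar>u z\<bar> \<le> 1" "\<And>z. \<bar>v z\<bar> \<le> 1" "\<And>z. \<bar>w z\<bar> \<le> 1"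
  shows "(\<integral>z. u z + v z + w z \<partial>die) = (\<integral>z. u z \<partial>die) + (\<integral>z. v z \<partial>die) + (\<integral>z. w z \<partial>die)"
  using die_integrable[OF assms(1,4)] die_integrable[OF assms(2,5)] die_integrable[OF assms(3,6)] by simp

lemma via_fst_eq:
  assumes t: "t \<in> {0..2}" and c: "c \<in> kite"
  shows "via_fst t c = corr_self 1 (1 / 4) 1 t (fst c) + corr_xw t (mid c) + corr_xy t (snd c)"
proof -
  have "via_fst t c = (\<integral>b. sgn (t - fst b) * sgn (fst b - fst c) + sgn (t - fst b) * sgn (mid b - mid c)
      + sgn (t - fst b) * sgn (snd c - snd b) \<partial>die)"
    unfolding via_fst_def beat_def by (simp add: algebra_simps)
  also have "\<dots> = corr_self 1 (1 / 4) 1 t (fst c) + corr_xw t (mid c) + corr_xy t (snd c)"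
    using kite_coords[OF c] t
    by (subst die_integral_sum3) (auto simp: sgn_bound corr_x_self corr_xw_integral corr_xy_integral)
  finally show ?thesis .
qed

text \<open>
  The middle coordinate against \<open>snd\<close> is reduced to the middle coordinate against
  \<open>fst\<close> by \<open>flip\<close>.
\<close>
lemma via_mid_eq:
  assumes t: "t \<in> {0..2}" and c: "c \<in> kite"
  shows "via_mid t c = corr_self 0 1 2 t (mid c) + corr_xw (fst c) t + corr_xw (snd c) (2 - t)"
proof -
  have "via_mid t c = (\<integral>b. sgn (t - mid b) * sgn (mid b - mid c) + sgn (fst c - fst b) * sgn (mid b - t)
      + sgn (t - mid b) * sgn (snd c - snd b) \<partial>die)"
  proof -
    have "sgn (t - w) * sgn (x - y) = sgn (y - x) * sgn (w - t)" for w x y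
      using sgn_minus[of "t - w"] sgn_minus[of "x - y"] by (simp add: algebra_simps)
    from this[of "mid b" "fst b" "fst c" for b]
    have "sgn (t - mid b) * beat b c = sgn (t - mid b) * sgn (mid b - mid c) + sgn (fst c - fst b) * sgn (mid b - t)
      + sgn (t - mid b) * sgn (snd c - snd b)" for b
      by (simp add: beat_def distrib_left)
    then show ?thesis unfolding via_mid_def by presburger
  qed
  also have "\<dots> = (\<integral>b. sgn (t - mid b) * sgn (mid b - mid c) \<partial>die) + (\<integral>b. sgn (fst c - fst b) * sgn (mid b - t) \<partial>die)
      + (\<integral>b. sgn (t - mid b) * sgn (snd c - snd b) \<partial>die)"
    by (rule die_integral_sum3) (auto simp: sgn_bound)
  also have "(\<integral>b. sgn (t - mid b) * sgn (snd c - snd b) \<partial>die) = (\<integral>b. sgn (t - mid (flip b)) * sgn (snd c - snd (flip b)) \<partial>die)"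
    by (rule die_flip[symmetric]) measurable
  also have "\<dots> = (\<integral>b. sgn (snd c - fst b) * sgn (mid b - (2 - t)) \<partial>die)"
    by (simp add: algebra_simps)
  finally show ?thesis
    using kite_coords[OF c] t by (simp add: corr_mid_self corr_xw_integral)
qed

text \<open>
  Antiderivatives of the correlations in the variable along a fibre. The constants of integration are
  immaterial, since only differences over a fibre occur.
\<close>
definition corr_xy_int :: "real \<Rightarrow> real \<Rightarrow> real" where
  "corr_xy_int t y = (1 - t - t\<^sup>2 / 4 - ramp 2 (t - 1)) * y + (2 * t - 1) * y\<^sup>2 / 2 - y ^ 3 / 12 - ramp 3 (y - 1) / 3
     - 4 / 3 * ramp 3 (t - 1 - y / 2) + 2 / 3 * ramp 3 (y - 1 - t / 2)"

definition corr_xw_int_w :: "real \<Rightarrow> real \<Rightarrow> real" where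
  "corr_xw_int_w t w = (- 1 + t + t\<^sup>2 / 4 + ramp 2 (t - 1)) * w + w ^ 3 / 3 - ramp 3 (w - 1) / 3 - ramp 3 (t + w - 1) / 3
     + ramp 3 (t - w - 1) / 3 + ramp 3 (t + 2 * w - 4) / 12"

definition corr_xw_int_x :: "real \<Rightarrow> real \<Rightarrow> real" where
  "corr_xw_int_x w t = (- 1 + w\<^sup>2 - ramp 2 (w - 1)) * t + t\<^sup>2 / 2 + t ^ 3 / 12 + ramp 3 (t - 1) / 3 - ramp 3 (t + w - 1) / 3
     - ramp 3 (t - w - 1) / 3 + ramp 3 (t + 2 * w - 4) / 6"

definition corr_self_int :: "real \<Rightarrow> real \<Rightarrow> real \<Rightarrow> real \<Rightarrow> real \<Rightarrow> real" where
  "corr_self_int a b c t u = (self_primitive a b c t - 1) * u - a * u\<^sup>2 / 2 - b * u ^ 3 / 3 + c * ramp 3 (u - 1) / 3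
     + 2 * ((a + 2 * b * t - 2 * c * ramp 1 (t - 1)) * ramp 2 (u - t) / 2 + b * ramp 3 (u - t) / 3 - c * ramp 3 (u - max t 1) / 3)"

lemma corr_xy_int_deriv: "(corr_xy_int t has_real_derivative corr_xy t y) (at y)"
  unfolding corr_xy_int_def[abs_def] corr_xy_def
  by (rule DERIV_cong, (rule deriv_rules | simp; fail)+, (simp add: field_simps power2_eq_square)?)

lemma corr_xw_int_w_deriv: "(corr_xw_int_w t has_real_derivative corr_xw t w) (at w)"
  unfolding corr_xw_int_w_def[abs_def] corr_xw_def
  by (rule DERIV_cong, (rule deriv_rules | simp; fail)+, (simp add: field_simps power2_eq_square)?)

lemma corr_xw_int_x_deriv: "(corr_xw_int_x w has_real_derivative corr_xw t w) (at t)"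
  unfolding corr_xw_int_x_def[abs_def] corr_xw_def
  by (rule DERIV_cong, (rule deriv_rules | simp; fail)+, (simp add: field_simps power2_eq_square)?)

lemma corr_self_int_deriv: "(corr_self_int a b c t has_real_derivative corr_self a b c t u) (at u)"
  unfolding corr_self_int_def[abs_def] corr_self_def
  by (rule DERIV_cong, (rule deriv_rules | simp; fail)+, (simp add: self_primitive_def field_simps power2_eq_square)?)

section \<open>Integrals over a square of products of fibre integrals\<close>

text \<open>
  In a product of two fibre integrals the roles of the two variables are exchanged, since each factor treats
  its own coordinate as the first variable.
\<close>
fun transpose_poly :: "real list list \<Rightarrow> real list list" where
  "transpose_poly [] = []" | "transpose_poly (p # P) = add2 (map (\<lambda>a. [a]) p) (map (\<lambda>q. 0 # q) (transpose_poly P))"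

fun transpose_terms :: "ramp_term list \<Rightarrow> ramp_term list" where
  "transpose_terms [] = []" | "transpose_terms (((c, p, q), P) # ts) = ((c, q, p), transpose_poly P) # transpose_terms ts"

lemma poly2_transpose: "poly2 (transpose_poly P) x z = poly2 P z x"
proof (induction P)
  case (Cons p P)
  have "poly2 (map (\<lambda>a. [a]) p) x z = poly1 p x" by (induction p) auto
  moreover have "poly2 (map (\<lambda>q. 0 # q) Q) x z = z * poly2 Q x z" for Q
    by (induction Q) (auto simp: algebra_simps)
  ultimately show ?case using Cons by simp
qed simp

lemma ramp_sum_transpose: "ramp_sum (transpose_terms ts) x z = ramp_sum ts z x"
  by (induction ts rule: transpose_terms.induct) (auto simp: poly2_transpose add.commute add.left_commute)

text \<open>
  The subdivision \<open>gs\<close> of the unit square with lower left corner \<open>(of_bool i, of_bool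
  j)\<close> certifies \<open>v\<close> as the integral over it of the product of the two sums of ramps. All
  piecewise formulas below change at the lines where a variable is 1, so Booleans number the four unit squares
  of the square of side 2.
\<close>
definition square_value :: "ramp_term list \<Rightarrow> ramp_term list \<Rightarrow> bool \<Rightarrow> bool \<Rightarrow> (real \<times> (real \<times> real) list) list \<Rightarrow> real \<Rightarrow> bool" where
  "square_value ts us i j gs v \<longleftrightarrow>
     grid_ok ts (transpose_terms us) (of_bool i, 0) (of_bool i + 1, 0) (of_bool j) gs \<and>
     grid_end (of_bool j) gs = of_bool j + 1 \<and>
     grid_value ts (transpose_terms us) (of_bool i, 0) (of_bool i + 1, 0) (of_bool j) gs = v"

lemma seg_integral_HK:
  fixes g :: "real \<Rightarrow> real"
  assumes [measurable]: "g \<in> borel_measurable borel" and B: "\<And>x. \<bar>g x\<bar> \<le> B" and I: "(g has_integral I) {0..2}"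
  shows "(\<integral>x. g x \<partial>seg) = I / 2"
proof -
  have "integrable lborel (\<lambda>x. g x * indicator {0..2} x)"
    by (rule integrableI_bounded_set[of "{0..2}" _ _ B]) (use B in \<open>auto simp: indicator_def\<close>)
  from has_integral_integral_lborel[OF this]
  have "((\<lambda>x. g x * indicator {0..2} x) has_integral (\<integral>x. g x * indicator {0..2} x \<partial>lborel)) UNIV" .
  moreover have "((\<lambda>x. g x * indicator {0..2} x) has_integral I) UNIV"
  proof -
    have "(\<lambda>x. g x * indicator {0..2} x) = (\<lambda>x. if x \<in> {0..2} then g x else 0)" by (auto simp: fun_eq_iff)
    then show ?thesis using I by (simp only: has_integral_restrict_UNIV)
  qed
  ultimately have "(\<integral>x. g x * indicator {0..2} x \<partial>lborel) = I" by (rule has_integral_unique)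
  then show ?thesis by (simp add: seg_integral)
qed

lemma fibre_measurable:
  fixes f :: "real \<Rightarrow> real \<times> real \<Rightarrow> real"
  assumes p: "chart p" and f: "(\<lambda>z. f (fst z) (snd z)) \<in> borel_measurable (borel \<Otimes>\<^sub>M borel)"
    and u: "u \<in> borel_measurable M" and v: "v \<in> borel_measurable M"
  shows "(\<lambda>w. fibre p (f (u w)) (v w)) \<in> borel_measurable M"
proof -
  have pm: "(\<lambda>z. p (fst z) (snd z)) \<in> borel_measurable (borel \<Otimes>\<^sub>M borel)"
    using chartD(1)[OF p] by (simp add: borel_prod)
  have [measurable]: "(\<lambda>w. p (u w) (v w)) \<in> borel_measurable M"
    if "u \<in> borel_measurable M" "v \<in> borel_measurable M" for u v :: "'c \<Rightarrow> real" and M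
    using measurable_compose[OF measurable_Pair[OF that] pm] by simp
  have [measurable]: "(\<lambda>w. f (u w) (v w)) \<in> borel_measurable M"
    if "u \<in> borel_measurable M" "v \<in> borel_measurable M" for u :: "'c \<Rightarrow> real" and v and M
    using measurable_compose[OF measurable_Pair[OF that] f] by simp
  note [measurable] = u v
  show ?thesis unfolding fibre_def by measurable
qed

lemma unit_blocks:
  fixes F G :: "real \<Rightarrow> real \<Rightarrow> real"
  assumes T: "\<And>i j x z. x \<in> {of_bool i..of_bool i + 1} \<Longrightarrow> z \<in> {of_bool j..of_bool j + 1} \<Longrightarrow> a * F x z = ramp_sum (T i j) x z"
    and S: "\<And>i j x z. x \<in> {of_bool i..of_bool i + 1} \<Longrightarrow> z \<in> {of_bool j..of_bool j + 1} \<Longrightarrow> b * G x z = ramp_sum (S i j) x z"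
    and grid: "\<And>i j. square_value (T i j) (S j i) i j (gs i j) (v i j)"
    and ab: "a > 0" "b > 0"
  shows "\<And>z. z \<in> {0..2} \<Longrightarrow> ((\<lambda>x. F x z * G z x) has_integral (integral {0..2} (\<lambda>x. F x z * G z x))) {0..2}"
    and "((\<lambda>z. integral {0..2} (\<lambda>x. F x z * G z x)) has_integral
      (v False False + v True False + v False True + v True True) / (a * b)) {0..2}"
proof -
  let ?P = "\<lambda>i j x z. ramp_sum (T i j) x z * ramp_sum (transpose_terms (S j i)) x z / (a * b)"
  let ?I = "\<lambda>i j z. integral {of_bool i..of_bool i + 1} (\<lambda>x. ?P i j x z)"
  have eq: "F x z * G z x = ?P i j x z"
    if "x \<in> {of_bool i..of_bool i + 1}" "z \<in> {of_bool j..of_bool j + 1}" for i j x z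
    using T[OF that] S[OF that(2,1)] ab by (simp add: ramp_sum_transpose field_simps)
  have piece: "((\<lambda>x. F x z * G z x) has_integral ?I i j z) {of_bool i..of_bool i + 1}"
    if z: "z \<in> {of_bool j..of_bool j + 1}" for i j z
  proof (rule has_integral_eq)
    show "((\<lambda>x. ?P i j x z) has_integral ?I i j z) {of_bool i..of_bool i + 1}"
      by (rule integrable_integral, rule integrable_continuous_interval)
        (use ab in \<open>auto intro!: continuous_intros continuous_ramp_sum\<close>)
  qed (simp add: eq[OF _ z])
  have inner: "((\<lambda>x. F x z * G z x) has_integral ?I False j z + ?I True j z) {0..2}"
    if z: "z \<in> {of_bool j..of_bool j + 1}" for j z
    using has_integral_combine[OF _ _ piece[OF z, of False] ] piece[OF z, of True] by simp
  have outer: "((\<lambda>z. ?I i j z) has_integral v i j / (a * b)) {of_bool j..of_bool j + 1}" for i j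
  proof -
    have ok: "grid_ok (T i j) (transpose_terms (S j i)) (of_bool i, 0) (of_bool i + 1, 0) (of_bool j) (gs i j)"
      using grid[of i j] by (simp add: square_value_def)
    from has_integral_divide[OF conjunct1[OF grid_integral[OF ok]], of "a * b"] show ?thesis
      using grid[of i j] by (simp add: square_value_def)
  qed
  have strip: "((\<lambda>z. integral {0..2} (\<lambda>x. F x z * G z x)) has_integral (v False j + v True j) / (a * b)) {of_bool j..of_bool j + 1}" for j
  proof (rule has_integral_eq)
    show "((\<lambda>z. ?I False j z + ?I True j z) has_integral (v False j + v True j) / (a * b)) {of_bool j..of_bool j + 1}"
      unfolding add_divide_distrib by (rule has_integral_add[OF outer outer])
  qed (use inner in \<open>auto intro: integral_unique[symmetric]\<close>)
  show "((\<lambda>z. integral {0..2} (\<lambda>x. F x z * G z x)) has_integral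
      (v False False + v True False + v False True + v True True) / (a * b)) {0..2}"
    using has_integral_combine[OF _ _ strip[of False]] strip[of True] by (simp add: add_divide_distrib add.assoc)
  show "((\<lambda>x. F x z * G z x) has_integral (integral {0..2} (\<lambda>x. F x z * G z x))) {0..2}" if "z \<in> {0..2}" for z
  proof -
    have "z \<in> {of_bool (1 < z)..of_bool (1 < z) + 1}" using that by auto
    from inner[OF this] show ?thesis by (auto simp: has_integral_integral[symmetric] intro: has_integral_integrable)
  qed
qed

text \<open>
  The factors \<open>a\<close> and \<open>b\<close> clear the denominators of the two sums of ramps; the 4 is
  the area of the square.
\<close>
lemma cycle_value:
  fixes f g :: "real \<Rightarrow> real \<times> real \<Rightarrow> real"
  assumes p: "chart p" and q: "chart q"
    and f: "(\<lambda>z. f (fst z) (snd z)) \<in> borel_measurable (borel \<Otimes>\<^sub>M borel)"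
    and g: "(\<lambda>z. g (fst z) (snd z)) \<in> borel_measurable (borel \<Otimes>\<^sub>M borel)"
    and fB: "\<And>t z. \<bar>f t z\<bar> \<le> B" and gB: "\<And>t z. \<bar>g t z\<bar> \<le> B"
    and T: "\<And>i j t r. t \<in> {of_bool i..of_bool i + 1} \<Longrightarrow> r \<in> {of_bool j..of_bool j + 1} \<Longrightarrow> a * fibre q (f t) r = ramp_sum (T i j) t r"
    and S: "\<And>i j t r. t \<in> {of_bool i..of_bool i + 1} \<Longrightarrow> r \<in> {of_bool j..of_bool j + 1} \<Longrightarrow> b * fibre p (g t) r = ramp_sum (S i j) t r"
    and grid: "\<And>i j. square_value (T i j) (S j i) i j (gs i j) (v i j)"
    and ab: "a > 0" "b > 0"
  shows "(\<integral>r. \<integral>t. fibre q (f t) r * fibre p (g r) t \<partial>seg \<partial>seg)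
     = (v False False + v True False + v False True + v True True) / (4 * a * b)"
proof -
  let ?K = "\<lambda>t r. fibre q (f t) r * fibre p (g r) t"
  have B: "0 \<le> B" using fB[of undefined undefined] by linarith
  have KB: "\<bar>?K t r\<bar> \<le> (2 * B) * (2 * B)" for t r
    unfolding abs_mult by (rule mult_mono) (auto intro!: fibre_bound fB gB B)
  have Km [measurable]: "(\<lambda>w. ?K (u w) (v w)) \<in> borel_measurable M"
    if "u \<in> borel_measurable M" "v \<in> borel_measurable M" for u v :: "'c \<Rightarrow> real" and M
    using fibre_measurable[OF q f that] fibre_measurable[OF p g that(2,1)] by measurable
  define I where "I r = integral {0..2} (\<lambda>t. ?K t r)" for r
  have slice: "((\<lambda>t. ?K t r) has_integral I r) {0..2}" if "r \<in> {0..2}" for r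
    unfolding I_def
    by (rule unit_blocks(1)[where F = "\<lambda>t r. fibre q (f t) r" and G = "\<lambda>r t. fibre p (g r) t", OF T S grid ab])
      (use that in auto)
  have total: "(I has_integral (v False False + v True False + v False True + v True True) / (a * b)) {0..2}"
    unfolding I_def
    by (rule unit_blocks(2)[where F = "\<lambda>t r. fibre q (f t) r" and G = "\<lambda>r t. fibre p (g r) t", OF T S grid ab]) auto
  have inner: "(\<integral>t. ?K t r \<partial>seg) = I r / 2" if "r \<in> {0..2}" for r
    by (rule seg_integral_HK[OF _ KB slice[OF that]]) measurable
  have "(\<integral>r. (\<integral>t. ?K t r \<partial>seg) \<partial>seg) = ((v False False + v True False + v False True + v True True) / (a * b) / 2) / 2"
  proof (rule seg_integral_HK)
    show "\<bar>\<integral>t. ?K t r \<partial>seg\<bar> \<le> (2 * B) * (2 * B)" for r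
      by (rule seg.expectation_bound[OF KB])
    show "((\<lambda>r. \<integral>t. ?K t r \<partial>seg) has_integral (v False False + v True False + v False True + v True True) / (a * b) / 2) {0..2}"
      by (rule has_integral_eq[OF _ has_integral_divide[OF total, of 2]]) (simp add: inner)
  qed measurable
  then show ?thesis by (simp add: field_simps)
qed

section \<open>Fibre integrals as sums of ramps\<close>

lemma isCont_corr_xw_x: "isCont (\<lambda>t. corr_xw t w) x" and isCont_corr_xw_w: "isCont (corr_xw t) x" and isCont_corr_xy: "isCont (corr_xy t) x"
  and isCont_corr_self: "isCont (corr_self a b c t) x"
  unfolding corr_xw_def[abs_def] corr_xy_def[abs_def] corr_self_def[abs_def] self_primitive_def by (intro continuous_intros; simp)+

lemma fibre_FTC:
  assumes F: "\<And>y. (F has_real_derivative k y) (at y)" "\<And>y. isCont k y"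
    and kite: "\<And>y. p r y \<in> kite \<longleftrightarrow> y \<in> {l..h}" and sub: "0 \<le> l \<and> l \<le> h \<and> h \<le> 2"
    and g: "\<And>y. p r y \<in> kite \<Longrightarrow> g (p r y) = k y"
  shows "fibre p g r = F h - F l"
  by (rule fibre_interval[where k = k, OF FTC_Icc]) (use assms in auto)

lemma fibre_px_via_fst:
  assumes t: "t \<in> {0..2}" and r: "r \<in> {0..2}"
  shows "fibre px (via_fst t) r = (corr_self 1 (1 / 4) 1 t r * hi r + corr_xw_int_w t (1 + hi r - r) + corr_xy_int t (hi r))
    - (corr_self 1 (1 / 4) 1 t r * lo r + corr_xw_int_w t (1 + lo r - r) + corr_xy_int t (lo r))"
proof (rule fibre_FTC[where F = "\<lambda>y. corr_self 1 (1 / 4) 1 t r * y + corr_xw_int_w t (1 + y - r) + corr_xy_int t y"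
      and k = "\<lambda>y. corr_self 1 (1 / 4) 1 t r + corr_xw t (1 + y - r) + corr_xy t y" and p = px])
  show "((\<lambda>y. corr_self 1 (1 / 4) 1 t r * y + corr_xw_int_w t (1 + y - r) + corr_xy_int t y) has_real_derivative
      corr_self 1 (1 / 4) 1 t r + corr_xw t (1 + y - r) + corr_xy t y) (at y)" for y
    by (auto intro!: derivative_eq_intros corr_xy_int_deriv DERIV_chain2[OF corr_xw_int_w_deriv])
  show "isCont (\<lambda>y. corr_self 1 (1 / 4) 1 t r + corr_xw t (1 + y - r) + corr_xy t y) y" for y
    by (intro continuous_intros isCont_corr_xy isCont_o2[OF _ isCont_corr_xw_w])
qed (use assms in \<open>auto simp: px_kite lo_hi_bounds via_fst_eq px_def mid_def kite_iff\<close>)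

lemma fibre_py_via_fst:
  assumes t: "t \<in> {0..2}" and r: "r \<in> {0..2}"
  shows "fibre py (via_fst t) r = (corr_self_int 1 (1 / 4) 1 t (hi r) - corr_xw_int_w t (1 + r - hi r) + corr_xy t r * hi r)
    - (corr_self_int 1 (1 / 4) 1 t (lo r) - corr_xw_int_w t (1 + r - lo r) + corr_xy t r * lo r)"
proof (rule fibre_FTC[where F = "\<lambda>y. corr_self_int 1 (1 / 4) 1 t y - corr_xw_int_w t (1 + r - y) + corr_xy t r * y"
      and k = "\<lambda>y. corr_self 1 (1 / 4) 1 t y + corr_xw t (1 + r - y) + corr_xy t r" and p = py])
  show "((\<lambda>y. corr_self_int 1 (1 / 4) 1 t y - corr_xw_int_w t (1 + r - y) + corr_xy t r * y) has_real_derivative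
      corr_self 1 (1 / 4) 1 t y + corr_xw t (1 + r - y) + corr_xy t r) (at y)" for y
    by (auto intro!: derivative_eq_intros corr_self_int_deriv DERIV_chain2[OF corr_xw_int_w_deriv])
  show "isCont (\<lambda>y. corr_self 1 (1 / 4) 1 t y + corr_xw t (1 + r - y) + corr_xy t r) y" for y
    by (intro continuous_intros isCont_corr_self isCont_o2[OF _ isCont_corr_xw_w])
  show "via_fst t (py r y) = corr_self 1 (1 / 4) 1 t y + corr_xw t (1 + r - y) + corr_xy t r" if "py r y \<in> kite" for y
    using via_fst_eq[OF t that] by (simp add: py_def mid_def)
qed (use assms in \<open>auto simp: py_kite lo_hi_bounds\<close>)

lemma fibre_pw_via_fst:
  assumes t: "t \<in> {0..2}" and r: "r \<in> {0..2}"
  shows "fibre pw (via_fst t) r = (corr_self_int 1 (1 / 4) 1 t (mid_hi r) + corr_xw t r * mid_hi r + corr_xy_int t (r + mid_hi r - 1))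
    - (corr_self_int 1 (1 / 4) 1 t (mid_lo r) + corr_xw t r * mid_lo r + corr_xy_int t (r + mid_lo r - 1))"
proof (rule fibre_FTC[where F = "\<lambda>y. corr_self_int 1 (1 / 4) 1 t y + corr_xw t r * y + corr_xy_int t (r + y - 1)"
      and k = "\<lambda>y. corr_self 1 (1 / 4) 1 t y + corr_xw t r + corr_xy t (r + y - 1)" and p = pw])
  show "((\<lambda>y. corr_self_int 1 (1 / 4) 1 t y + corr_xw t r * y + corr_xy_int t (r + y - 1)) has_real_derivative
      corr_self 1 (1 / 4) 1 t y + corr_xw t r + corr_xy t (r + y - 1)) (at y)" for y
    by (auto intro!: derivative_eq_intros corr_self_int_deriv DERIV_chain2[OF corr_xy_int_deriv])
  show "isCont (\<lambda>y. corr_self 1 (1 / 4) 1 t y + corr_xw t r + corr_xy t (r + y - 1)) y" for y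
    by (intro continuous_intros isCont_corr_self isCont_o2[OF _ isCont_corr_xy])
  show "via_fst t (pw r y) = corr_self 1 (1 / 4) 1 t y + corr_xw t r + corr_xy t (r + y - 1)" if "pw r y \<in> kite" for y
    using via_fst_eq[OF t that] by (simp add: pw_def mid_def)
qed (use assms in \<open>auto simp: pw_kite lw_hw_bounds\<close>)

lemma fibre_px_via_mid:
  assumes t: "t \<in> {0..2}" and r: "r \<in> {0..2}"
  shows "fibre px (via_mid t) r = (corr_self_int 0 1 2 t (1 + hi r - r) + corr_xw r t * hi r + corr_xw_int_x (2 - t) (hi r))
    - (corr_self_int 0 1 2 t (1 + lo r - r) + corr_xw r t * lo r + corr_xw_int_x (2 - t) (lo r))"
proof (rule fibre_FTC[where F = "\<lambda>y. corr_self_int 0 1 2 t (1 + y - r) + corr_xw r t * y + corr_xw_int_x (2 - t) y"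
      and k = "\<lambda>y. corr_self 0 1 2 t (1 + y - r) + corr_xw r t + corr_xw y (2 - t)" and p = px])
  show "((\<lambda>y. corr_self_int 0 1 2 t (1 + y - r) + corr_xw r t * y + corr_xw_int_x (2 - t) y) has_real_derivative
      corr_self 0 1 2 t (1 + y - r) + corr_xw r t + corr_xw y (2 - t)) (at y)" for y
    by (auto intro!: derivative_eq_intros corr_xw_int_x_deriv DERIV_chain2[OF corr_self_int_deriv])
  show "isCont (\<lambda>y. corr_self 0 1 2 t (1 + y - r) + corr_xw r t + corr_xw y (2 - t)) y" for y
    by (intro continuous_intros isCont_corr_xw_x isCont_o2[OF _ isCont_corr_self])
  show "via_mid t (px r y) = corr_self 0 1 2 t (1 + y - r) + corr_xw r t + corr_xw y (2 - t)" if "px r y \<in> kite" for y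
    using via_mid_eq[OF t that] by (simp add: px_def mid_def)
qed (use assms in \<open>auto simp: px_kite lo_hi_bounds\<close>)

lemma fibre_pw_via_mid:
  assumes t: "t \<in> {0..2}" and r: "r \<in> {0..2}"
  shows "fibre pw (via_mid t) r = (corr_self 0 1 2 t r * mid_hi r + corr_xw_int_x t (mid_hi r) + corr_xw_int_x (2 - t) (r + mid_hi r - 1))
    - (corr_self 0 1 2 t r * mid_lo r + corr_xw_int_x t (mid_lo r) + corr_xw_int_x (2 - t) (r + mid_lo r - 1))"
proof (rule fibre_FTC[where F = "\<lambda>y. corr_self 0 1 2 t r * y + corr_xw_int_x t y + corr_xw_int_x (2 - t) (r + y - 1)"
      and k = "\<lambda>y. corr_self 0 1 2 t r + corr_xw y t + corr_xw (r + y - 1) (2 - t)" and p = pw])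
  show "((\<lambda>y. corr_self 0 1 2 t r * y + corr_xw_int_x t y + corr_xw_int_x (2 - t) (r + y - 1)) has_real_derivative
      corr_self 0 1 2 t r + corr_xw y t + corr_xw (r + y - 1) (2 - t)) (at y)" for y
    by (auto intro!: derivative_eq_intros corr_xw_int_x_deriv DERIV_chain2[OF corr_xw_int_x_deriv])
  show "isCont (\<lambda>y. corr_self 0 1 2 t r + corr_xw y t + corr_xw (r + y - 1) (2 - t)) y" for y
    by (intro continuous_intros isCont_corr_xw_x isCont_o2[OF _ isCont_corr_xw_x])
  show "via_mid t (pw r y) = corr_self 0 1 2 t r + corr_xw y t + corr_xw (r + y - 1) (2 - t)" if "pw r y \<in> kite" for y
    using via_mid_eq[OF t that] by (simp add: pw_def mid_def)
qed (use assms in \<open>auto simp: pw_kite lw_hw_bounds\<close>)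

text \<open>
  A ramp that does change sign within a unit square is rewritten with a single factor \<open>max 0 v\<close>,
  where \<open>v\<close> has integer coefficients, so that ramps with proportional arguments share it.
\<close>
lemma ramp_kept:
  assumes "u = v / k" "0 < k"
  shows "ramp 1 u = max 0 v / k" "ramp 2 u = max 0 v * v / k\<^sup>2" "ramp 3 u = max 0 v * v\<^sup>2 / k ^ 3"
  using assms by (cases "0 \<le> v"; simp add: ramp_def power_divide power2_eq_square power3_eq_cube divide_nonpos_pos)+

text \<open>
  The fibre integrals of \<open>via_fst\<close> along lines of constant \<open>x\<close>, \<open>y\<close>,
  \<open>w\<close> (\<open>xx\<close>, \<open>xy\<close>, \<open>xw\<close>) and of \<open>via_mid\<close>
  along lines of constant \<open>x\<close>, \<open>w\<close> (\<open>wx\<close>, \<open>ww\<close>), on the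
  four unit squares and multiplied by a common denominator. The affine form 1 carries the polynomial part, the
  other forms are the ramps that change sign within the square. The coefficients were found by expanding the
  closed forms of the fibre integrals, and the lemmas below confirm them.
\<close>
fun terms_xx :: "bool \<Rightarrow> bool \<Rightarrow> ramp_term list" where
  "terms_xx False False = [
     ((1, 0, 0), [[8, - 204, - 186, 19], [96, 240], [- 72, 60], [- 32]]),
     ((0, - 1, 1), [[192, 144, 32], [48, 8], [8]]),
     ((0, 1, - 1), [[0, 0, 40], [0, - 80], [40]])]"
| "terms_xx False True = [
     ((1, 0, 0), [[- 280, 708, - 570, 147], [- 672, 1104, - 408], [- 168, 108], [- 40]]),
     ((- 2, 1, 1), [[128, - 128, 32], [- 128, 64], [32]]),
     ((- 3, 0, 2), [[288, - 384, 128]]),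
     ((- 6, - 1, 4), [[- 288, 384, - 128], [- 96, 64], [- 8]])]"
| "terms_xx True False = [
     ((1, 0, 0), [[- 216, - 252, - 186, - 21], [672, 336, 120], [- 552, - 108], [136]]),
     ((- 6, 4, - 1), [[- 72, - 24, - 2], [96, 16], [- 32]]),
     ((- 2, 1, 1), [[- 128, 128, - 32], [128, - 64], [- 32]])]"
| "terms_xx True True = [
     ((1, 0, 0), [[- 248, - 780, 534, - 45], [864, 144, - 288], [- 504, 252]]),
     ((0, - 1, 1), [[1728, - 1296, 224], [- 432, 200], [8]]),
     ((0, 1, - 1), [[0, 0, 104], [0, - 208], [104]]),
     ((- 6, 4, - 1), [[- 72, - 24, - 2], [96, 16], [- 32]]),
     ((- 3, 0, 2), [[288, - 384, 128]]),
     ((- 6, - 1, 4), [[- 288, 384, - 128], [- 96, 64], [- 8]])]"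

fun terms_xy :: "bool \<Rightarrow> bool \<Rightarrow> ramp_term list" where
  "terms_xy False False = [
     ((1, 0, 0), [[- 8, 12, 42, - 51], [- 96, 144], [72, - 108]]),
     ((- 2, 2, 1), [[16, - 16, 4], [- 32, 16], [16]]),
     ((- 2, 1, 2), [[32, - 64, 32], [- 32, 32], [8]])]"
| "terms_xy False True = [
     ((1, 0, 0), [[- 40, 348, - 582, 269], [- 288, 720, - 384], [- 72, 36]]),
     ((- 2, 2, 1), [[16, - 16, 4], [- 32, 16], [16]]),
     ((- 2, - 1, 2), [[- 160, 368, - 208], [- 16, 40], [32]]),
     ((- 3, 0, 2), [[288, - 384, 128]]),
     ((2, 1, - 2), [[32, - 64, 32], [32, - 32], [8]])]"
| "terms_xy True False = [
     ((1, 0, 0), [[- 248, - 108, - 18, - 41], [384, 240, 24], [- 168, - 84]]),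
     ((2, - 2, 1), [[120, 48, - 6], [- 168, - 12], [48]]),
     ((- 2, 2, - 1), [[- 112, - 112, - 28], [128, 64], [- 16]]),
     ((- 2, 1, 2), [[32, - 64, 32], [- 32, 32], [8]])]"
| "terms_xy True True = [
     ((1, 0, 0), [[- 472, 420, - 642, 279], [576, 432, - 360], [- 504, 252]]),
     ((2, - 2, 1), [[120, 48, - 6], [- 168, - 12], [48]]),
     ((- 2, 2, - 1), [[- 304, - 16, 68], [320, - 128], [- 16]]),
     ((- 2, - 1, 2), [[480, - 528, 48], [48, 168], [- 96]]),
     ((- 3, 0, 2), [[- 288, 384, - 128]]),
     ((2, 1, - 2), [[32, - 64, 32], [32, - 32], [8]])]"

fun terms_xw :: "bool \<Rightarrow> bool \<Rightarrow> ramp_term list" where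
  "terms_xw False False = [
     ((1, 0, 0), [[14, - 24, - 6, 12], [- 24, 0, 48], [6], [4]]),
     ((- 1, 1, 1), [[0, 24, - 24], [0, - 24]]),
     ((- 1, 0, 2), [[- 4, 16, - 16]]),
     ((- 2, - 1, 4), [[4, - 16, 16], [4, - 8], [1]]),
     ((1, - 1, - 1), [[- 14, 16, - 2], [10, 2], [4]])]"
| "terms_xw False True = [
     ((1, 0, 0), [[- 412, 558, - 252, 38], [240, - 216, 48], [- 36, 18]]),
     ((3, 0, - 2), [[- 36, 48, - 16]]),
     ((4, - 1, - 2), [[96, - 72, 12], [- 12], [- 3]]),
     ((- 4, 1, 2), [[- 96, 96, - 24], [24, - 12]])]"
| "terms_xw True False = [
     ((1, 0, 0), [[- 16, - 102, 24, - 6], [48, 120], [- 48, - 42], [16]]),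
     ((1, - 1, 1), [[30, 24, - 6], [- 42, - 6], [12]]),
     ((- 1, 1, - 1), [[- 16, - 8, 8], [32, 8], [- 16]]),
     ((- 1, 0, 2), [[- 4, 16, - 16]]),
     ((- 2, - 1, 4), [[4, - 16, 16], [4, - 8], [1]])]"
| "terms_xw True True = [
     ((1, 0, 0), [[- 460, 582, - 252, 38], [336, - 264, 48], [- 84, 42]]),
     ((3, 0, - 2), [[36, - 48, 16]]),
     ((4, - 1, - 2), [[64, 8, - 20], [- 68, 16], [13]]),
     ((- 4, 1, 2), [[- 96, 96, - 24], [24, - 12]]),
     ((- 5, 2, 1), [[- 50, 20, - 2], [40, - 8], [- 8]]),
     ((- 1, 2, - 1), [[2, 4, 2], [- 8, - 8], [8]])]"

fun terms_wx :: "bool \<Rightarrow> bool \<Rightarrow> ramp_term list" where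
  "terms_wx False False = [
     ((1, 0, 0), [[56, - 228, 138, - 15], [96, 96, 24], [- 288, 144], [128]]),
     ((- 1, 1, 1), [[96, - 48, - 48], [- 96, - 48]]),
     ((2, - 4, 1), [[8, 8, 2], [- 32, - 16], [32]]),
     ((1, - 1, - 1), [[- 64, 128, - 64], [- 64, 64], [128]])]"
| "terms_wx False True = [
     ((1, 0, 0), [[- 200, 540, - 582, 193], [288, 0, - 72], [- 384, 96], [128]]),
     ((- 1, - 1, 1), [[96, - 48, - 48], [96, 48]]),
     ((2, - 4, 1), [[8, 8, 2], [- 32, - 16], [32]]),
     ((- 3, 0, 2), [[- 288, 384, - 128]])]"
| "terms_wx True False = [
     ((1, 0, 0), [[- 648, 12, 138, - 71], [768, 192, - 72], [- 288, - 96], [32]]),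
     ((4, - 2, - 1), [[256, - 32, - 8], [- 256, 16], [64]]),
     ((- 4, 2, 1), [[- 256, - 16, 20], [160, 32], [- 16]])]"
| "terms_wx True True = [
     ((1, 0, 0), [[- 1128, 828, - 198, - 71], [1536, - 960, 312], [- 480, 96], [32]]),
     ((4, - 2, - 1), [[256, - 32, - 8], [- 256, 16], [64]]),
     ((- 4, 2, 1), [[- 640, 464, - 76], [352, - 160], [- 16]]),
     ((- 3, 0, 2), [[- 288, 384, - 128]]),
     ((- 1, - 1, 2), [[32, - 128, 128], [64, - 128], [32]]),
     ((- 5, 1, 2), [[800, - 640, 128], [- 320, 128], [32]])]"

fun terms_ww :: "bool \<Rightarrow> bool \<Rightarrow> ramp_term list" where
  "terms_ww False False = [
     ((1, 0, 0), [[0, 3, - 12, - 23], [0, 0, 18], [0, 6], [- 2]]),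
     ((0, - 1, 1), [[0, 0, 30], [0, 12], [6]]),
     ((- 1, 0, 2), [[2, - 8, 8]]),
     ((0, 1, - 1), [[0, 0, 2], [0, - 4], [2]])]"
| "terms_ww False True = [
     ((1, 0, 0), [[- 42, 69, - 42, 9], [48, - 24], [- 24, 12]]),
     ((3, 0, - 2), [[18, - 24, 8]]),
     ((3, 1, - 2), [[- 18, 24, - 8], [- 12, 8], [- 2]]),
     ((3, - 1, - 2), [[- 18, 24, - 8], [12, - 8], [- 2]]),
     ((3, - 2, - 1), [[9, - 6, 1], [- 12, 4], [4]]),
     ((- 1, - 2, 1), [[- 1, 2, - 1], [- 4, 4], [- 4]])]"
| "terms_ww True False = [
     ((1, 0, 0), [[0, - 9, 12, - 9], [0, 24], [0, - 12]]),
     ((- 3, 2, 1), [[9, - 6, 1], [- 12, 4], [4]]),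
     ((- 1, 0, 2), [[2, - 8, 8]]),
     ((1, - 1, 2), [[- 2, - 8, - 8], [4, 8], [- 2]]),
     ((- 3, 1, 2), [[- 18, 24, - 8], [12, - 8], [- 2]]),
     ((- 3, 2, - 1), [[- 9, - 6, - 1], [12, 4], [- 4]])]"
| "terms_ww True True = [
     ((1, 0, 0), [[- 50, - 39, 30, - 1], [96, 0, - 18], [- 48, 18], [2]]),
     ((0, - 1, 1), [[192, - 144, 26], [- 48, 20], [2]]),
     ((3, 0, - 2), [[18, - 24, 8]]),
     ((0, 1, - 1), [[0, 0, 6], [0, - 12], [6]])]"

text \<open>
  On a unit square every ramp in the closed form either has a constant sign, and then is a power or zero, or
  is one of those kept in the list of terms. All blocks follow this pattern.
\<close>
lemma fibre_xx_00:
  assumes t: "t \<in> {0..1}" and r: "r \<in> {0..1}"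
  shows "96 * fibre px (via_fst t) r = ramp_sum (terms_xx False False) t r"
proof -
  have e: "hi r = (1 + r / 2)" "lo r = 0" "max t 1 = 1"
    using t r by (auto simp: hi_def lo_def)
  define m0 where "m0 = max 0 (0 + (- 1) * t + 1 * r)"
  define m1 where "m1 = max 0 (0 + 1 * t + (- 1) * r)"
  have k: "ramp 1 (r - t) = m0 / 1"
    "ramp 2 (r - t) = m0 * (0 + (- 1) * t + 1 * r) / 1^2"
    "ramp 3 (t + 2 * (1 + (1 + r / 2) - r) - 4) = m1 * (0 + 1 * t + (- 1) * r)^2 / 1^3"
    "ramp 3 ((1 + r / 2) - 1 - t / 2) = m0 * (0 + (- 1) * t + 1 * r)^2 / 2^3"
    "ramp 3 (t + (1 + 0 - r) - 1) = m1 * (0 + 1 * t + (- 1) * r)^2 / 1^3"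
    unfolding m0_def m1_def by (rule ramp_kept; simp add: field_simps)+
  have "max 0 (1 + 0 * t + 0 * r) = 1" by simp
  note pevs = terms_xx.simps ramp_sum.simps aff.simps poly2.simps poly1.simps this m0_def[symmetric] m1_def[symmetric]
  have "t \<in> {0..2}" "r \<in> {0..2}" using t r by auto
  note Q = fibre_px_via_fst[OF this]
  show ?thesis
    using t r unfolding Q corr_self_def self_primitive_def corr_xw_int_w_def corr_xy_int_def e pevs k
    by (simp add: ramp_pos ramp_neg field_simps power2_eq_square power3_eq_cube)
qed

lemma fibre_xx_01:
  assumes t: "t \<in> {0..1}" and r: "r \<in> {1..2}"
  shows "96 * fibre px (via_fst t) r = ramp_sum (terms_xx False True) t r"
proof -
  have e: "hi r = (1 + r / 2)" "lo r = (2 * r - 2)" "max t 1 = 1"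
    using t r by (auto simp: hi_def lo_def)
  define m0 where "m0 = max 0 ((- 2) + 1 * t + 1 * r)"
  define m1 where "m1 = max 0 ((- 3) + 0 * t + 2 * r)"
  define m2 where "m2 = max 0 ((- 6) + (- 1) * t + 4 * r)"
  have k: "ramp 3 (t + (1 + (2 * r - 2) - r) - 1) = m0 * ((- 2) + 1 * t + 1 * r)^2 / 1^3"
    "ramp 3 ((2 * r - 2) - 1) = m1 * ((- 3) + 0 * t + 2 * r)^2 / 1^3"
    "ramp 3 ((2 * r - 2) - 1 - t / 2) = m2 * ((- 6) + (- 1) * t + 4 * r)^2 / 2^3"
    unfolding m0_def m1_def m2_def by (rule ramp_kept; simp add: field_simps)+
  have "max 0 (1 + 0 * t + 0 * r) = 1" by simp
  note pevs = terms_xx.simps ramp_sum.simps aff.simps poly2.simps poly1.simps this m0_def[symmetric] m1_def[symmetric] m2_def[symmetric]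
  have "t \<in> {0..2}" "r \<in> {0..2}" using t r by auto
  note Q = fibre_px_via_fst[OF this]
  show ?thesis
    using t r unfolding Q corr_self_def self_primitive_def corr_xw_int_w_def corr_xy_int_def e pevs k
    by (simp add: ramp_pos ramp_neg field_simps power2_eq_square power3_eq_cube)
qed

lemma fibre_xx_10:
  assumes t: "t \<in> {1..2}" and r: "r \<in> {0..1}"
  shows "96 * fibre px (via_fst t) r = ramp_sum (terms_xx True False) t r"
proof -
  have e: "hi r = (1 + r / 2)" "lo r = 0" "max t 1 = t"
    using t r by (auto simp: hi_def lo_def)
  define m0 where "m0 = max 0 ((- 6) + 4 * t + (- 1) * r)"
  define m1 where "m1 = max 0 ((- 2) + 1 * t + 1 * r)"
  have k: "ramp 3 (t - 1 - (1 + r / 2) / 2) = m0 * ((- 6) + 4 * t + (- 1) * r)^2 / 4^3"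
    "ramp 3 (t - (1 + 0 - r) - 1) = m1 * ((- 2) + 1 * t + 1 * r)^2 / 1^3"
    unfolding m0_def m1_def by (rule ramp_kept; simp add: field_simps)+
  have "max 0 (1 + 0 * t + 0 * r) = 1" by simp
  note pevs = terms_xx.simps ramp_sum.simps aff.simps poly2.simps poly1.simps this m0_def[symmetric] m1_def[symmetric]
  have "t \<in> {0..2}" "r \<in> {0..2}" using t r by auto
  note Q = fibre_px_via_fst[OF this]
  show ?thesis
    using t r unfolding Q corr_self_def self_primitive_def corr_xw_int_w_def corr_xy_int_def e pevs k
    by (simp add: ramp_pos ramp_neg field_simps power2_eq_square power3_eq_cube)
qed

lemma fibre_xx_11:
  assumes t: "t \<in> {1..2}" and r: "r \<in> {1..2}"
  shows "96 * fibre px (via_fst t) r = ramp_sum (terms_xx True True) t r"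
proof -
  have e: "hi r = (1 + r / 2)" "lo r = (2 * r - 2)" "max t 1 = t"
    using t r by (auto simp: hi_def lo_def)
  define m0 where "m0 = max 0 (0 + (- 1) * t + 1 * r)"
  define m1 where "m1 = max 0 (0 + 1 * t + (- 1) * r)"
  define m2 where "m2 = max 0 ((- 6) + 4 * t + (- 1) * r)"
  define m3 where "m3 = max 0 ((- 3) + 0 * t + 2 * r)"
  define m4 where "m4 = max 0 ((- 6) + (- 1) * t + 4 * r)"
  have k: "ramp 1 (r - t) = m0 / 1"
    "ramp 2 (r - t) = m0 * (0 + (- 1) * t + 1 * r) / 1^2"
    "ramp 3 (t + 2 * (1 + (1 + r / 2) - r) - 4) = m1 * (0 + 1 * t + (- 1) * r)^2 / 1^3"
    "ramp 3 (t - 1 - (1 + r / 2) / 2) = m2 * ((- 6) + 4 * t + (- 1) * r)^2 / 4^3"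
    "ramp 3 ((1 + r / 2) - 1 - t / 2) = m0 * (0 + (- 1) * t + 1 * r)^2 / 2^3"
    "ramp 3 (t - (1 + (2 * r - 2) - r) - 1) = m1 * (0 + 1 * t + (- 1) * r)^2 / 1^3"
    "ramp 3 ((2 * r - 2) - 1) = m3 * ((- 3) + 0 * t + 2 * r)^2 / 1^3"
    "ramp 3 (t - 1 - (2 * r - 2) / 2) = m1 * (0 + 1 * t + (- 1) * r)^2 / 1^3"
    "ramp 3 ((2 * r - 2) - 1 - t / 2) = m4 * ((- 6) + (- 1) * t + 4 * r)^2 / 2^3"
    unfolding m0_def m1_def m2_def m3_def m4_def by (rule ramp_kept; simp add: field_simps)+
  have "max 0 (1 + 0 * t + 0 * r) = 1" by simp
  note pevs = terms_xx.simps ramp_sum.simps aff.simps poly2.simps poly1.simps this m0_def[symmetric] m1_def[symmetric] m2_def[symmetric] m3_def[symmetric] m4_def[symmetric]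
  have "t \<in> {0..2}" "r \<in> {0..2}" using t r by auto
  note Q = fibre_px_via_fst[OF this]
  show ?thesis
    using t r unfolding Q corr_self_def self_primitive_def corr_xw_int_w_def corr_xy_int_def e pevs k
    by (simp add: ramp_pos ramp_neg field_simps power2_eq_square power3_eq_cube)
qed

lemma fibre_xx:
  "t \<in> {of_bool i..of_bool i + 1} \<Longrightarrow> r \<in> {of_bool j..of_bool j + 1} \<Longrightarrow> 96 * fibre px (via_fst t) r = ramp_sum (terms_xx i j) t r"
  using fibre_xx_00 fibre_xx_01 fibre_xx_10 fibre_xx_11 by (cases i; cases j) auto

lemma fibre_xy_00:
  assumes t: "t \<in> {0..1}" and r: "r \<in> {0..1}"
  shows "96 * fibre py (via_fst t) r = ramp_sum (terms_xy False False) t r"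
proof -
  have e: "hi r = (1 + r / 2)" "lo r = 0" "max t 1 = 1"
    using t r by (auto simp: hi_def lo_def)
  define m0 where "m0 = max 0 ((- 2) + 2 * t + 1 * r)"
  define m1 where "m1 = max 0 ((- 2) + 1 * t + 2 * r)"
  have k: "ramp 3 (t + (1 + r - (1 + r / 2)) - 1) = m0 * ((- 2) + 2 * t + 1 * r)^2 / 2^3"
    "ramp 3 (t + 2 * (1 + r - 0) - 4) = m1 * ((- 2) + 1 * t + 2 * r)^2 / 1^3"
    unfolding m0_def m1_def by (rule ramp_kept; simp add: field_simps)+
  have "max 0 (1 + 0 * t + 0 * r) = 1" by simp
  note pevs = terms_xy.simps ramp_sum.simps aff.simps poly2.simps poly1.simps this m0_def[symmetric] m1_def[symmetric]
  have "t \<in> {0..2}" "r \<in> {0..2}" using t r by auto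
  note Q = fibre_py_via_fst[OF this]
  show ?thesis
    using t r unfolding Q corr_self_int_def self_primitive_def corr_xw_int_w_def corr_xy_def e pevs k
    by (simp add: ramp_pos ramp_neg field_simps power2_eq_square power3_eq_cube)
qed

lemma fibre_xy_01:
  assumes t: "t \<in> {0..1}" and r: "r \<in> {1..2}"
  shows "96 * fibre py (via_fst t) r = ramp_sum (terms_xy False True) t r"
proof -
  have e: "hi r = (1 + r / 2)" "lo r = (2 * r - 2)" "max t 1 = 1"
    using t r by (auto simp: hi_def lo_def)
  define m0 where "m0 = max 0 ((- 2) + 2 * t + 1 * r)"
  define m1 where "m1 = max 0 ((- 2) + (- 1) * t + 2 * r)"
  define m2 where "m2 = max 0 ((- 3) + 0 * t + 2 * r)"
  define m3 where "m3 = max 0 (2 + 1 * t + (- 2) * r)"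
  have k: "ramp 3 (t + (1 + r - (1 + r / 2)) - 1) = m0 * ((- 2) + 2 * t + 1 * r)^2 / 2^3"
    "ramp 2 (r - 1 - t / 2) = m1 * ((- 2) + (- 1) * t + 2 * r) / 2^2"
    "ramp 3 ((2 * r - 2) - 1) = m2 * ((- 3) + 0 * t + 2 * r)^2 / 1^3"
    "ramp 2 ((2 * r - 2) - t) = m1 * ((- 2) + (- 1) * t + 2 * r) / 1^2"
    "ramp 3 ((2 * r - 2) - t) = m1 * ((- 2) + (- 1) * t + 2 * r)^2 / 1^3"
    "ramp 3 (t + 2 * (1 + r - (2 * r - 2)) - 4) = m3 * (2 + 1 * t + (- 2) * r)^2 / 1^3"
    unfolding m0_def m1_def m2_def m3_def by (rule ramp_kept; simp add: field_simps)+
  have "max 0 (1 + 0 * t + 0 * r) = 1" by simp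
  note pevs = terms_xy.simps ramp_sum.simps aff.simps poly2.simps poly1.simps this m0_def[symmetric] m1_def[symmetric] m2_def[symmetric] m3_def[symmetric]
  have "t \<in> {0..2}" "r \<in> {0..2}" using t r by auto
  note Q = fibre_py_via_fst[OF this]
  show ?thesis
    using t r unfolding Q corr_self_int_def self_primitive_def corr_xw_int_w_def corr_xy_def e pevs k
    by (simp add: ramp_pos ramp_neg field_simps power2_eq_square power3_eq_cube)
qed

lemma fibre_xy_10:
  assumes t: "t \<in> {1..2}" and r: "r \<in> {0..1}"
  shows "96 * fibre py (via_fst t) r = ramp_sum (terms_xy True False) t r"
proof -
  have e: "hi r = (1 + r / 2)" "lo r = 0" "max t 1 = t"
    using t r by (auto simp: hi_def lo_def)
  define m0 where "m0 = max 0 (2 + (- 2) * t + 1 * r)"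
  define m1 where "m1 = max 0 ((- 2) + 2 * t + (- 1) * r)"
  define m2 where "m2 = max 0 ((- 2) + 1 * t + 2 * r)"
  have k: "ramp 2 ((1 + r / 2) - t) = m0 * (2 + (- 2) * t + 1 * r) / 2^2"
    "ramp 3 ((1 + r / 2) - t) = m0 * (2 + (- 2) * t + 1 * r)^2 / 2^3"
    "ramp 3 (t - (1 + r - (1 + r / 2)) - 1) = m1 * ((- 2) + 2 * t + (- 1) * r)^2 / 2^3"
    "ramp 2 (t - 1 - r / 2) = m1 * ((- 2) + 2 * t + (- 1) * r) / 2^2"
    "ramp 3 (t + 2 * (1 + r - 0) - 4) = m2 * ((- 2) + 1 * t + 2 * r)^2 / 1^3"
    unfolding m0_def m1_def m2_def by (rule ramp_kept; simp add: field_simps)+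
  have "max 0 (1 + 0 * t + 0 * r) = 1" by simp
  note pevs = terms_xy.simps ramp_sum.simps aff.simps poly2.simps poly1.simps this m0_def[symmetric] m1_def[symmetric] m2_def[symmetric]
  have "t \<in> {0..2}" "r \<in> {0..2}" using t r by auto
  note Q = fibre_py_via_fst[OF this]
  show ?thesis
    using t r unfolding Q corr_self_int_def self_primitive_def corr_xw_int_w_def corr_xy_def e pevs k
    by (simp add: ramp_pos ramp_neg field_simps power2_eq_square power3_eq_cube)
qed

lemma fibre_xy_11:
  assumes t: "t \<in> {1..2}" and r: "r \<in> {1..2}"
  shows "96 * fibre py (via_fst t) r = ramp_sum (terms_xy True True) t r"
proof -
  have e: "hi r = (1 + r / 2)" "lo r = (2 * r - 2)" "max t 1 = t"
    using t r by (auto simp: hi_def lo_def)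
  define m0 where "m0 = max 0 (2 + (- 2) * t + 1 * r)"
  define m1 where "m1 = max 0 ((- 2) + 2 * t + (- 1) * r)"
  define m2 where "m2 = max 0 ((- 2) + (- 1) * t + 2 * r)"
  define m3 where "m3 = max 0 ((- 3) + 0 * t + 2 * r)"
  define m4 where "m4 = max 0 (2 + 1 * t + (- 2) * r)"
  have k: "ramp 2 ((1 + r / 2) - t) = m0 * (2 + (- 2) * t + 1 * r) / 2^2"
    "ramp 3 ((1 + r / 2) - t) = m0 * (2 + (- 2) * t + 1 * r)^2 / 2^3"
    "ramp 3 (t - (1 + r - (1 + r / 2)) - 1) = m1 * ((- 2) + 2 * t + (- 1) * r)^2 / 2^3"
    "ramp 2 (t - 1 - r / 2) = m1 * ((- 2) + 2 * t + (- 1) * r) / 2^2"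
    "ramp 2 (r - 1 - t / 2) = m2 * ((- 2) + (- 1) * t + 2 * r) / 2^2"
    "ramp 3 ((2 * r - 2) - 1) = m3 * ((- 3) + 0 * t + 2 * r)^2 / 1^3"
    "ramp 2 ((2 * r - 2) - t) = m2 * ((- 2) + (- 1) * t + 2 * r) / 1^2"
    "ramp 3 ((2 * r - 2) - t) = m2 * ((- 2) + (- 1) * t + 2 * r)^2 / 1^3"
    "ramp 3 (t + 2 * (1 + r - (2 * r - 2)) - 4) = m4 * (2 + 1 * t + (- 2) * r)^2 / 1^3"
    unfolding m0_def m1_def m2_def m3_def m4_def by (rule ramp_kept; simp add: field_simps)+
  have "max 0 (1 + 0 * t + 0 * r) = 1" by simp
  note pevs = terms_xy.simps ramp_sum.simps aff.simps poly2.simps poly1.simps this m0_def[symmetric] m1_def[symmetric] m2_def[symmetric] m3_def[symmetric] m4_def[symmetric]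
  have "t \<in> {0..2}" "r \<in> {0..2}" using t r by auto
  note Q = fibre_py_via_fst[OF this]
  show ?thesis
    using t r unfolding Q corr_self_int_def self_primitive_def corr_xw_int_w_def corr_xy_def e pevs k
    by (simp add: ramp_pos ramp_neg field_simps power2_eq_square power3_eq_cube)
qed

lemma fibre_xy:
  "t \<in> {of_bool i..of_bool i + 1} \<Longrightarrow> r \<in> {of_bool j..of_bool j + 1} \<Longrightarrow> 96 * fibre py (via_fst t) r = ramp_sum (terms_xy i j) t r"
  using fibre_xy_00 fibre_xy_01 fibre_xy_10 fibre_xy_11 by (cases i; cases j) auto

lemma fibre_xw_00:
  assumes t: "t \<in> {0..1}" and r: "r \<in> {0..1}"
  shows "12 * fibre pw (via_fst t) r = ramp_sum (terms_xw False False) t r"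
proof -
  have e: "mid_hi r = (1 + r)" "mid_lo r = (1 - r)" "max t 1 = 1"
    using t r by (auto simp: mid_hi_def mid_lo_def)
  define m0 where "m0 = max 0 ((- 1) + 1 * t + 1 * r)"
  define m1 where "m1 = max 0 ((- 1) + 0 * t + 2 * r)"
  define m2 where "m2 = max 0 ((- 2) + (- 1) * t + 4 * r)"
  define m3 where "m3 = max 0 (1 + (- 1) * t + (- 1) * r)"
  have k: "ramp 2 (t + r - 1) = m0 * ((- 1) + 1 * t + 1 * r) / 1^2"
    "ramp 3 ((r + (1 + r) - 1) - 1) = m1 * ((- 1) + 0 * t + 2 * r)^2 / 1^3"
    "ramp 3 ((r + (1 + r) - 1) - 1 - t / 2) = m2 * ((- 2) + (- 1) * t + 4 * r)^2 / 2^3"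
    "ramp 2 ((1 - r) - t) = m3 * (1 + (- 1) * t + (- 1) * r) / 1^2"
    "ramp 3 ((1 - r) - t) = m3 * (1 + (- 1) * t + (- 1) * r)^2 / 1^3"
    unfolding m0_def m1_def m2_def m3_def by (rule ramp_kept; simp add: field_simps)+
  have "max 0 (1 + 0 * t + 0 * r) = 1" by simp
  note pevs = terms_xw.simps ramp_sum.simps aff.simps poly2.simps poly1.simps this m0_def[symmetric] m1_def[symmetric] m2_def[symmetric] m3_def[symmetric]
  have "t \<in> {0..2}" "r \<in> {0..2}" using t r by auto
  note Q = fibre_pw_via_fst[OF this]
  show ?thesis
    using t r unfolding Q corr_self_int_def self_primitive_def corr_xw_def corr_xy_int_def e pevs k
    by (simp add: ramp_pos ramp_neg field_simps power2_eq_square power3_eq_cube)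
qed

lemma fibre_xw_01:
  assumes t: "t \<in> {0..1}" and r: "r \<in> {1..2}"
  shows "12 * fibre pw (via_fst t) r = ramp_sum (terms_xw False True) t r"
proof -
  have e: "mid_hi r = (4 - 2 * r)" "mid_lo r = 0" "max t 1 = 1"
    using t r by (auto simp: mid_hi_def mid_lo_def)
  define m0 where "m0 = max 0 (3 + 0 * t + (- 2) * r)"
  define m1 where "m1 = max 0 (4 + (- 1) * t + (- 2) * r)"
  define m2 where "m2 = max 0 ((- 4) + 1 * t + 2 * r)"
  have k: "ramp 3 ((4 - 2 * r) - 1) = m0 * (3 + 0 * t + (- 2) * r)^2 / 1^3"
    "ramp 2 ((4 - 2 * r) - t) = m1 * (4 + (- 1) * t + (- 2) * r) / 1^2"
    "ramp 3 ((4 - 2 * r) - t) = m1 * (4 + (- 1) * t + (- 2) * r)^2 / 1^3"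
    "ramp 2 (t + 2 * r - 4) = m2 * ((- 4) + 1 * t + 2 * r) / 1^2"
    "ramp 3 ((r + (4 - 2 * r) - 1) - 1 - t / 2) = m1 * (4 + (- 1) * t + (- 2) * r)^2 / 2^3"
    unfolding m0_def m1_def m2_def by (rule ramp_kept; simp add: field_simps)+
  have "max 0 (1 + 0 * t + 0 * r) = 1" by simp
  note pevs = terms_xw.simps ramp_sum.simps aff.simps poly2.simps poly1.simps this m0_def[symmetric] m1_def[symmetric] m2_def[symmetric]
  have "t \<in> {0..2}" "r \<in> {0..2}" using t r by auto
  note Q = fibre_pw_via_fst[OF this]
  show ?thesis
    using t r unfolding Q corr_self_int_def self_primitive_def corr_xw_def corr_xy_int_def e pevs k
    by (simp add: ramp_pos ramp_neg field_simps power2_eq_square power3_eq_cube)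
qed

lemma fibre_xw_10:
  assumes t: "t \<in> {1..2}" and r: "r \<in> {0..1}"
  shows "12 * fibre pw (via_fst t) r = ramp_sum (terms_xw True False) t r"
proof -
  have e: "mid_hi r = (1 + r)" "mid_lo r = (1 - r)" "max t 1 = t"
    using t r by (auto simp: mid_hi_def mid_lo_def)
  define m0 where "m0 = max 0 (1 + (- 1) * t + 1 * r)"
  define m1 where "m1 = max 0 ((- 1) + 1 * t + (- 1) * r)"
  define m2 where "m2 = max 0 ((- 1) + 0 * t + 2 * r)"
  define m3 where "m3 = max 0 ((- 2) + (- 1) * t + 4 * r)"
  have k: "ramp 2 ((1 + r) - t) = m0 * (1 + (- 1) * t + 1 * r) / 1^2"
    "ramp 3 ((1 + r) - t) = m0 * (1 + (- 1) * t + 1 * r)^2 / 1^3"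
    "ramp 2 (t - r - 1) = m1 * ((- 1) + 1 * t + (- 1) * r) / 1^2"
    "ramp 3 ((r + (1 + r) - 1) - 1) = m2 * ((- 1) + 0 * t + 2 * r)^2 / 1^3"
    "ramp 3 (t - 1 - (r + (1 + r) - 1) / 2) = m1 * ((- 1) + 1 * t + (- 1) * r)^2 / 1^3"
    "ramp 3 ((r + (1 + r) - 1) - 1 - t / 2) = m3 * ((- 2) + (- 1) * t + 4 * r)^2 / 2^3"
    unfolding m0_def m1_def m2_def m3_def by (rule ramp_kept; simp add: field_simps)+
  have "max 0 (1 + 0 * t + 0 * r) = 1" by simp
  note pevs = terms_xw.simps ramp_sum.simps aff.simps poly2.simps poly1.simps this m0_def[symmetric] m1_def[symmetric] m2_def[symmetric] m3_def[symmetric]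
  have "t \<in> {0..2}" "r \<in> {0..2}" using t r by auto
  note Q = fibre_pw_via_fst[OF this]
  show ?thesis
    using t r unfolding Q corr_self_int_def self_primitive_def corr_xw_def corr_xy_int_def e pevs k
    by (simp add: ramp_pos ramp_neg field_simps power2_eq_square power3_eq_cube)
qed

lemma fibre_xw_11:
  assumes t: "t \<in> {1..2}" and r: "r \<in> {1..2}"
  shows "12 * fibre pw (via_fst t) r = ramp_sum (terms_xw True True) t r"
proof -
  have e: "mid_hi r = (4 - 2 * r)" "mid_lo r = 0" "max t 1 = t"
    using t r by (auto simp: mid_hi_def mid_lo_def)
  define m0 where "m0 = max 0 (3 + 0 * t + (- 2) * r)"
  define m1 where "m1 = max 0 (4 + (- 1) * t + (- 2) * r)"
  define m2 where "m2 = max 0 ((- 4) + 1 * t + 2 * r)"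
  define m3 where "m3 = max 0 ((- 5) + 2 * t + 1 * r)"
  define m4 where "m4 = max 0 ((- 1) + 2 * t + (- 1) * r)"
  have k: "ramp 3 ((4 - 2 * r) - 1) = m0 * (3 + 0 * t + (- 2) * r)^2 / 1^3"
    "ramp 2 ((4 - 2 * r) - t) = m1 * (4 + (- 1) * t + (- 2) * r) / 1^2"
    "ramp 3 ((4 - 2 * r) - t) = m1 * (4 + (- 1) * t + (- 2) * r)^2 / 1^3"
    "ramp 2 (t + 2 * r - 4) = m2 * ((- 4) + 1 * t + 2 * r) / 1^2"
    "ramp 3 (t - 1 - (r + (4 - 2 * r) - 1) / 2) = m3 * ((- 5) + 2 * t + 1 * r)^2 / 2^3"
    "ramp 3 ((r + (4 - 2 * r) - 1) - 1 - t / 2) = m1 * (4 + (- 1) * t + (- 2) * r)^2 / 2^3"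
    "ramp 3 (t - 1 - (r + 0 - 1) / 2) = m4 * ((- 1) + 2 * t + (- 1) * r)^2 / 2^3"
    unfolding m0_def m1_def m2_def m3_def m4_def by (rule ramp_kept; simp add: field_simps)+
  have "max 0 (1 + 0 * t + 0 * r) = 1" by simp
  note pevs = terms_xw.simps ramp_sum.simps aff.simps poly2.simps poly1.simps this m0_def[symmetric] m1_def[symmetric] m2_def[symmetric] m3_def[symmetric] m4_def[symmetric]
  have "t \<in> {0..2}" "r \<in> {0..2}" using t r by auto
  note Q = fibre_pw_via_fst[OF this]
  show ?thesis
    using t r unfolding Q corr_self_int_def self_primitive_def corr_xw_def corr_xy_int_def e pevs k
    by (simp add: ramp_pos ramp_neg field_simps power2_eq_square power3_eq_cube)
qed

lemma fibre_xw:
  "t \<in> {of_bool i..of_bool i + 1} \<Longrightarrow> r \<in> {of_bool j..of_bool j + 1} \<Longrightarrow> 12 * fibre pw (via_fst t) r = ramp_sum (terms_xw i j) t r"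
  using fibre_xw_00 fibre_xw_01 fibre_xw_10 fibre_xw_11 by (cases i; cases j) auto

lemma fibre_wx_00:
  assumes t: "t \<in> {0..1}" and r: "r \<in> {0..1}"
  shows "96 * fibre px (via_mid t) r = ramp_sum (terms_wx False False) t r"
proof -
  have e: "hi r = (1 + r / 2)" "lo r = 0" "max t 1 = 1"
    using t r by (auto simp: hi_def lo_def)
  define m0 where "m0 = max 0 ((- 1) + 1 * t + 1 * r)"
  define m1 where "m1 = max 0 (2 + (- 4) * t + 1 * r)"
  define m2 where "m2 = max 0 (1 + (- 1) * t + (- 1) * r)"
  have k: "ramp 2 (r + t - 1) = m0 * ((- 1) + 1 * t + 1 * r) / 1^2"
    "ramp 3 ((1 + r / 2) + 2 * (2 - t) - 4) = m1 * (2 + (- 4) * t + 1 * r)^2 / 2^3"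
    "ramp 2 ((1 + 0 - r) - t) = m2 * (1 + (- 1) * t + (- 1) * r) / 1^2"
    "ramp 3 ((1 + 0 - r) - t) = m2 * (1 + (- 1) * t + (- 1) * r)^2 / 1^3"
    unfolding m0_def m1_def m2_def by (rule ramp_kept; simp add: field_simps)+
  have "max 0 (1 + 0 * t + 0 * r) = 1" by simp
  note pevs = terms_wx.simps ramp_sum.simps aff.simps poly2.simps poly1.simps this m0_def[symmetric] m1_def[symmetric] m2_def[symmetric]
  have "t \<in> {0..2}" "r \<in> {0..2}" using t r by auto
  note Q = fibre_px_via_mid[OF this]
  show ?thesis
    using t r unfolding Q corr_self_int_def self_primitive_def corr_xw_def corr_xw_int_x_def e pevs k
    by (simp add: ramp_pos ramp_neg field_simps power2_eq_square power3_eq_cube)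
qed

lemma fibre_wx_01:
  assumes t: "t \<in> {0..1}" and r: "r \<in> {1..2}"
  shows "96 * fibre px (via_mid t) r = ramp_sum (terms_wx False True) t r"
proof -
  have e: "hi r = (1 + r / 2)" "lo r = (2 * r - 2)" "max t 1 = 1"
    using t r by (auto simp: hi_def lo_def)
  define m0 where "m0 = max 0 ((- 1) + (- 1) * t + 1 * r)"
  define m1 where "m1 = max 0 (2 + (- 4) * t + 1 * r)"
  define m2 where "m2 = max 0 ((- 3) + 0 * t + 2 * r)"
  have k: "ramp 2 (r - t - 1) = m0 * ((- 1) + (- 1) * t + 1 * r) / 1^2"
    "ramp 3 ((1 + r / 2) + 2 * (2 - t) - 4) = m1 * (2 + (- 4) * t + 1 * r)^2 / 2^3"
    "ramp 2 ((1 + (2 * r - 2) - r) - t) = m0 * ((- 1) + (- 1) * t + 1 * r) / 1^2"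
    "ramp 3 ((1 + (2 * r - 2) - r) - t) = m0 * ((- 1) + (- 1) * t + 1 * r)^2 / 1^3"
    "ramp 3 ((2 * r - 2) - 1) = m2 * ((- 3) + 0 * t + 2 * r)^2 / 1^3"
    "ramp 3 ((2 * r - 2) + 2 * (2 - t) - 4) = m0 * ((- 1) + (- 1) * t + 1 * r)^2 / (1/2)^3"
    unfolding m0_def m1_def m2_def by (rule ramp_kept; simp add: field_simps)+
  have "max 0 (1 + 0 * t + 0 * r) = 1" by simp
  note pevs = terms_wx.simps ramp_sum.simps aff.simps poly2.simps poly1.simps this m0_def[symmetric] m1_def[symmetric] m2_def[symmetric]
  have "t \<in> {0..2}" "r \<in> {0..2}" using t r by auto
  note Q = fibre_px_via_mid[OF this]
  show ?thesis
    using t r unfolding Q corr_self_int_def self_primitive_def corr_xw_def corr_xw_int_x_def e pevs k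
    by (simp add: ramp_pos ramp_neg field_simps power2_eq_square power3_eq_cube)
qed

lemma fibre_wx_10:
  assumes t: "t \<in> {1..2}" and r: "r \<in> {0..1}"
  shows "96 * fibre px (via_mid t) r = ramp_sum (terms_wx True False) t r"
proof -
  have e: "hi r = (1 + r / 2)" "lo r = 0" "max t 1 = t"
    using t r by (auto simp: hi_def lo_def)
  define m0 where "m0 = max 0 (4 + (- 2) * t + (- 1) * r)"
  define m1 where "m1 = max 0 ((- 4) + 2 * t + 1 * r)"
  have k: "ramp 2 ((1 + (1 + r / 2) - r) - t) = m0 * (4 + (- 2) * t + (- 1) * r) / 2^2"
    "ramp 3 ((1 + (1 + r / 2) - r) - t) = m0 * (4 + (- 2) * t + (- 1) * r)^2 / 2^3"
    "ramp 2 (r + 2 * t - 4) = m1 * ((- 4) + 2 * t + 1 * r) / 1^2"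
    "ramp 3 ((1 + r / 2) - (2 - t) - 1) = m1 * ((- 4) + 2 * t + 1 * r)^2 / 2^3"
    unfolding m0_def m1_def by (rule ramp_kept; simp add: field_simps)+
  have "max 0 (1 + 0 * t + 0 * r) = 1" by simp
  note pevs = terms_wx.simps ramp_sum.simps aff.simps poly2.simps poly1.simps this m0_def[symmetric] m1_def[symmetric]
  have "t \<in> {0..2}" "r \<in> {0..2}" using t r by auto
  note Q = fibre_px_via_mid[OF this]
  show ?thesis
    using t r unfolding Q corr_self_int_def self_primitive_def corr_xw_def corr_xw_int_x_def e pevs k
    by (simp add: ramp_pos ramp_neg field_simps power2_eq_square power3_eq_cube)
qed

lemma fibre_wx_11:
  assumes t: "t \<in> {1..2}" and r: "r \<in> {1..2}"
  shows "96 * fibre px (via_mid t) r = ramp_sum (terms_wx True True) t r"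
proof -
  have e: "hi r = (1 + r / 2)" "lo r = (2 * r - 2)" "max t 1 = t"
    using t r by (auto simp: hi_def lo_def)
  define m0 where "m0 = max 0 (4 + (- 2) * t + (- 1) * r)"
  define m1 where "m1 = max 0 ((- 4) + 2 * t + 1 * r)"
  define m2 where "m2 = max 0 ((- 3) + 0 * t + 2 * r)"
  define m3 where "m3 = max 0 ((- 1) + (- 1) * t + 2 * r)"
  define m4 where "m4 = max 0 ((- 5) + 1 * t + 2 * r)"
  have k: "ramp 2 ((1 + (1 + r / 2) - r) - t) = m0 * (4 + (- 2) * t + (- 1) * r) / 2^2"
    "ramp 3 ((1 + (1 + r / 2) - r) - t) = m0 * (4 + (- 2) * t + (- 1) * r)^2 / 2^3"
    "ramp 2 (r + 2 * t - 4) = m1 * ((- 4) + 2 * t + 1 * r) / 1^2"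
    "ramp 3 ((1 + r / 2) - (2 - t) - 1) = m1 * ((- 4) + 2 * t + 1 * r)^2 / 2^3"
    "ramp 3 ((2 * r - 2) - 1) = m2 * ((- 3) + 0 * t + 2 * r)^2 / 1^3"
    "ramp 3 ((2 * r - 2) + (2 - t) - 1) = m3 * ((- 1) + (- 1) * t + 2 * r)^2 / 1^3"
    "ramp 3 ((2 * r - 2) - (2 - t) - 1) = m4 * ((- 5) + 1 * t + 2 * r)^2 / 1^3"
    unfolding m0_def m1_def m2_def m3_def m4_def by (rule ramp_kept; simp add: field_simps)+
  have "max 0 (1 + 0 * t + 0 * r) = 1" by simp
  note pevs = terms_wx.simps ramp_sum.simps aff.simps poly2.simps poly1.simps this m0_def[symmetric] m1_def[symmetric] m2_def[symmetric] m3_def[symmetric] m4_def[symmetric]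
  have "t \<in> {0..2}" "r \<in> {0..2}" using t r by auto
  note Q = fibre_px_via_mid[OF this]
  show ?thesis
    using t r unfolding Q corr_self_int_def self_primitive_def corr_xw_def corr_xw_int_x_def e pevs k
    by (simp add: ramp_pos ramp_neg field_simps power2_eq_square power3_eq_cube)
qed

lemma fibre_wx:
  "t \<in> {of_bool i..of_bool i + 1} \<Longrightarrow> r \<in> {of_bool j..of_bool j + 1} \<Longrightarrow> 96 * fibre px (via_mid t) r = ramp_sum (terms_wx i j) t r"
  using fibre_wx_00 fibre_wx_01 fibre_wx_10 fibre_wx_11 by (cases i; cases j) auto

lemma fibre_ww_00:
  assumes t: "t \<in> {0..1}" and r: "r \<in> {0..1}"
  shows "6 * fibre pw (via_mid t) r = ramp_sum (terms_ww False False) t r"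
proof -
  have e: "mid_hi r = (1 + r)" "mid_lo r = (1 - r)" "max t 1 = 1"
    using t r by (auto simp: mid_hi_def mid_lo_def)
  define m0 where "m0 = max 0 (0 + (- 1) * t + 1 * r)"
  define m1 where "m1 = max 0 ((- 1) + 0 * t + 2 * r)"
  define m2 where "m2 = max 0 (0 + 1 * t + (- 1) * r)"
  have k: "ramp 1 (r - t) = m0 / 1"
    "ramp 2 (r - t) = m0 * (0 + (- 1) * t + 1 * r) / 1^2"
    "ramp 3 ((1 + r) - t - 1) = m0 * (0 + (- 1) * t + 1 * r)^2 / 1^3"
    "ramp 3 ((r + (1 + r) - 1) - 1) = m1 * ((- 1) + 0 * t + 2 * r)^2 / 1^3"
    "ramp 3 ((r + (1 + r) - 1) + 2 * (2 - t) - 4) = m0 * (0 + (- 1) * t + 1 * r)^2 / (1/2)^3"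
    "ramp 3 ((1 - r) + t - 1) = m2 * (0 + 1 * t + (- 1) * r)^2 / 1^3"
    unfolding m0_def m1_def m2_def by (rule ramp_kept; simp add: field_simps)+
  have "max 0 (1 + 0 * t + 0 * r) = 1" by simp
  note pevs = terms_ww.simps ramp_sum.simps aff.simps poly2.simps poly1.simps this m0_def[symmetric] m1_def[symmetric] m2_def[symmetric]
  have "t \<in> {0..2}" "r \<in> {0..2}" using t r by auto
  note Q = fibre_pw_via_mid[OF this]
  show ?thesis
    using t r unfolding Q corr_self_def self_primitive_def corr_xw_int_x_def e pevs k
    by (simp add: ramp_pos ramp_neg field_simps power2_eq_square power3_eq_cube)
qed

lemma fibre_ww_01:
  assumes t: "t \<in> {0..1}" and r: "r \<in> {1..2}"
  shows "6 * fibre pw (via_mid t) r = ramp_sum (terms_ww False True) t r"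
proof -
  have e: "mid_hi r = (4 - 2 * r)" "mid_lo r = 0" "max t 1 = 1"
    using t r by (auto simp: mid_hi_def mid_lo_def)
  define m0 where "m0 = max 0 (3 + 0 * t + (- 2) * r)"
  define m1 where "m1 = max 0 (3 + 1 * t + (- 2) * r)"
  define m2 where "m2 = max 0 (3 + (- 1) * t + (- 2) * r)"
  define m3 where "m3 = max 0 (3 + (- 2) * t + (- 1) * r)"
  define m4 where "m4 = max 0 ((- 1) + (- 2) * t + 1 * r)"
  have k: "ramp 3 ((4 - 2 * r) - 1) = m0 * (3 + 0 * t + (- 2) * r)^2 / 1^3"
    "ramp 3 ((4 - 2 * r) + t - 1) = m1 * (3 + 1 * t + (- 2) * r)^2 / 1^3"
    "ramp 3 ((4 - 2 * r) - t - 1) = m2 * (3 + (- 1) * t + (- 2) * r)^2 / 1^3"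
    "ramp 3 ((r + (4 - 2 * r) - 1) + 2 * (2 - t) - 4) = m3 * (3 + (- 2) * t + (- 1) * r)^2 / 1^3"
    "ramp 3 ((r + 0 - 1) + 2 * (2 - t) - 4) = m4 * ((- 1) + (- 2) * t + 1 * r)^2 / 1^3"
    unfolding m0_def m1_def m2_def m3_def m4_def by (rule ramp_kept; simp add: field_simps)+
  have "max 0 (1 + 0 * t + 0 * r) = 1" by simp
  note pevs = terms_ww.simps ramp_sum.simps aff.simps poly2.simps poly1.simps this m0_def[symmetric] m1_def[symmetric] m2_def[symmetric] m3_def[symmetric] m4_def[symmetric]
  have "t \<in> {0..2}" "r \<in> {0..2}" using t r by auto
  note Q = fibre_pw_via_mid[OF this]
  show ?thesis
    using t r unfolding Q corr_self_def self_primitive_def corr_xw_int_x_def e pevs k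
    by (simp add: ramp_pos ramp_neg field_simps power2_eq_square power3_eq_cube)
qed

lemma fibre_ww_10:
  assumes t: "t \<in> {1..2}" and r: "r \<in> {0..1}"
  shows "6 * fibre pw (via_mid t) r = ramp_sum (terms_ww True False) t r"
proof -
  have e: "mid_hi r = (1 + r)" "mid_lo r = (1 - r)" "max t 1 = t"
    using t r by (auto simp: mid_hi_def mid_lo_def)
  define m0 where "m0 = max 0 ((- 3) + 2 * t + 1 * r)"
  define m1 where "m1 = max 0 ((- 1) + 0 * t + 2 * r)"
  define m2 where "m2 = max 0 (1 + (- 1) * t + 2 * r)"
  define m3 where "m3 = max 0 ((- 3) + 1 * t + 2 * r)"
  define m4 where "m4 = max 0 ((- 3) + 2 * t + (- 1) * r)"
  have k: "ramp 3 ((1 + r) + 2 * t - 4) = m0 * ((- 3) + 2 * t + 1 * r)^2 / 1^3"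
    "ramp 3 ((r + (1 + r) - 1) - 1) = m1 * ((- 1) + 0 * t + 2 * r)^2 / 1^3"
    "ramp 3 ((r + (1 + r) - 1) + (2 - t) - 1) = m2 * (1 + (- 1) * t + 2 * r)^2 / 1^3"
    "ramp 3 ((r + (1 + r) - 1) - (2 - t) - 1) = m3 * ((- 3) + 1 * t + 2 * r)^2 / 1^3"
    "ramp 3 ((1 - r) + 2 * t - 4) = m4 * ((- 3) + 2 * t + (- 1) * r)^2 / 1^3"
    unfolding m0_def m1_def m2_def m3_def m4_def by (rule ramp_kept; simp add: field_simps)+
  have "max 0 (1 + 0 * t + 0 * r) = 1" by simp
  note pevs = terms_ww.simps ramp_sum.simps aff.simps poly2.simps poly1.simps this m0_def[symmetric] m1_def[symmetric] m2_def[symmetric] m3_def[symmetric] m4_def[symmetric]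
  have "t \<in> {0..2}" "r \<in> {0..2}" using t r by auto
  note Q = fibre_pw_via_mid[OF this]
  show ?thesis
    using t r unfolding Q corr_self_def self_primitive_def corr_xw_int_x_def e pevs k
    by (simp add: ramp_pos ramp_neg field_simps power2_eq_square power3_eq_cube)
qed

lemma fibre_ww_11:
  assumes t: "t \<in> {1..2}" and r: "r \<in> {1..2}"
  shows "6 * fibre pw (via_mid t) r = ramp_sum (terms_ww True True) t r"
proof -
  have e: "mid_hi r = (4 - 2 * r)" "mid_lo r = 0" "max t 1 = t"
    using t r by (auto simp: mid_hi_def mid_lo_def)
  define m0 where "m0 = max 0 (0 + (- 1) * t + 1 * r)"
  define m1 where "m1 = max 0 (3 + 0 * t + (- 2) * r)"
  define m2 where "m2 = max 0 (0 + 1 * t + (- 1) * r)"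
  have k: "ramp 1 (r - t) = m0 / 1"
    "ramp 2 (r - t) = m0 * (0 + (- 1) * t + 1 * r) / 1^2"
    "ramp 3 ((4 - 2 * r) - 1) = m1 * (3 + 0 * t + (- 2) * r)^2 / 1^3"
    "ramp 3 ((4 - 2 * r) + 2 * t - 4) = m2 * (0 + 1 * t + (- 1) * r)^2 / (1/2)^3"
    "ramp 3 ((r + (4 - 2 * r) - 1) - (2 - t) - 1) = m2 * (0 + 1 * t + (- 1) * r)^2 / 1^3"
    "ramp 3 ((r + 0 - 1) + (2 - t) - 1) = m0 * (0 + (- 1) * t + 1 * r)^2 / 1^3"
    unfolding m0_def m1_def m2_def by (rule ramp_kept; simp add: field_simps)+
  have "max 0 (1 + 0 * t + 0 * r) = 1" by simp
  note pevs = terms_ww.simps ramp_sum.simps aff.simps poly2.simps poly1.simps this m0_def[symmetric] m1_def[symmetric] m2_def[symmetric]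
  have "t \<in> {0..2}" "r \<in> {0..2}" using t r by auto
  note Q = fibre_pw_via_mid[OF this]
  show ?thesis
    using t r unfolding Q corr_self_def self_primitive_def corr_xw_int_x_def e pevs k
    by (simp add: ramp_pos ramp_neg field_simps power2_eq_square power3_eq_cube)
qed

lemma fibre_ww:
  "t \<in> {of_bool i..of_bool i + 1} \<Longrightarrow> r \<in> {of_bool j..of_bool j + 1} \<Longrightarrow> 6 * fibre pw (via_mid t) r = ramp_sum (terms_ww i j) t r"
  using fibre_ww_00 fibre_ww_01 fibre_ww_10 fibre_ww_11 by (cases i; cases j) auto

section \<open>Subdivisions of the unit squares\<close>

text \<open>
  The cut lines are the zero lines of the ramps of both factors. A strip ends where two of these lines, or a
  line and a side of the square, cross, and at horizontal zero lines; each strip lists the lines that cross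
  it, from left to right.
\<close>
fun cuts_xx :: "bool \<Rightarrow> bool \<Rightarrow> (real \<times> (real \<times> real) list) list" where
  "cuts_xx False False = [
     (1, [(0, 1)])]"
| "cuts_xx False True = [
     (3/2, [(2, - 1)]),
     (8/5, [(- 6, 4), (2, - 1)]),
     (7/4, [(2, - 1), (- 6, 4)]),
     (2, [(2, - 1)])]"
| "cuts_xx True False = [
     (2/5, [(3/2, 0), (3/2, 1/4), (2, - 1)]),
     (1/2, [(3/2, 0), (2, - 1), (3/2, 1/4)]),
     (1, [(2, - 1), (3/2, 0), (3/2, 1/4)])]"
| "cuts_xx True True = [
     (3/2, [(0, 1), (3/2, 0), (3/2, 1/4)]),
     (7/4, [(3/2, 0), (0, 1), (3/2, 1/4)]),
     (15/8, [(- 6, 4), (3/2, 0), (0, 1), (3/2, 1/4)]),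
     (2, [(3/2, 0), (- 6, 4), (0, 1), (3/2, 1/4)])]"

fun val_xx :: "bool \<Rightarrow> bool \<Rightarrow> real" where
  "val_xx False False = 34037/80"
| "val_xx False True = 89858241/716800"
| "val_xx True False = 89858241/716800"
| "val_xx True True = 5292019/71680"

lemma square_xx_00: "square_value (terms_xx False False) (terms_xx False False) False False (cuts_xx False False) (val_xx False False)"
  by (simp add: square_value_def at_corners_def poly1_integral_def between_lines_def)

lemma square_xx_01: "square_value (terms_xx False True) (terms_xx True False) False True (cuts_xx False True) (val_xx False True)"
  by (simp add: square_value_def at_corners_def poly1_integral_def between_lines_def)

lemma square_xx_10: "square_value (terms_xx True False) (terms_xx False True) True False (cuts_xx True False) (val_xx True False)"
  by (simp add: square_value_def at_corners_def poly1_integral_def between_lines_def)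

lemma square_xx_11: "square_value (terms_xx True True) (terms_xx True True) True True (cuts_xx True True) (val_xx True True)"
  by (simp add: square_value_def at_corners_def poly1_integral_def between_lines_def)

lemma square_xx: "square_value (terms_xx i j) (terms_xx j i) i j (cuts_xx i j) (val_xx i j)"
  using square_xx_00 square_xx_01 square_xx_10 square_xx_11 by (cases i; cases j; simp only:)

fun cuts_xy :: "bool \<Rightarrow> bool \<Rightarrow> (real \<times> (real \<times> real) list) list" where
  "cuts_xy False False = [
     (1/2, [(1, - 1/2)]),
     (2/3, [(1, - 1/2), (2, - 2)]),
     (1, [(2, - 2), (1, - 1/2)])]"
| "cuts_xy False True = [
     (6/5, [(- 2, 2), (1, - 1/2)]),
     (3/2, [(1, - 1/2), (- 2, 2)]),
     (2, [(1, - 1/2)])]"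
| "cuts_xy True False = [
     (1/4, [(1, 1/2), (3/2, 0), (2, - 2)]),
     (2/5, [(1, 1/2), (2, - 2), (3/2, 0)]),
     (1/2, [(2, - 2), (1, 1/2), (3/2, 0)]),
     (1, [(1, 1/2), (3/2, 0)])]"
| "cuts_xy True True = [
     (3/2, [(3/2, 0), (1, 1/2)]),
     (7/4, [(- 2, 2), (3/2, 0), (1, 1/2)]),
     (2, [(3/2, 0), (- 2, 2), (1, 1/2)])]"

fun val_xy :: "bool \<Rightarrow> bool \<Rightarrow> real" where
  "val_xy False False = 12653/1344"
| "val_xy False True = (- 38437/32000)"
| "val_xy True False = (- 38437/32000)"
| "val_xy True True = 84997/4480"

lemma square_xy_00: "square_value (terms_xy False False) (terms_xy False False) False False (cuts_xy False False) (val_xy False False)"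
  by (simp add: square_value_def at_corners_def poly1_integral_def between_lines_def)

lemma square_xy_01: "square_value (terms_xy False True) (terms_xy True False) False True (cuts_xy False True) (val_xy False True)"
  by (simp add: square_value_def at_corners_def poly1_integral_def between_lines_def)

lemma square_xy_10: "square_value (terms_xy True False) (terms_xy False True) True False (cuts_xy True False) (val_xy True False)"
  by (simp add: square_value_def at_corners_def poly1_integral_def between_lines_def)

lemma square_xy_11: "square_value (terms_xy True True) (terms_xy True True) True True (cuts_xy True True) (val_xy True True)"
  by (simp add: square_value_def at_corners_def poly1_integral_def between_lines_def)

lemma square_xy: "square_value (terms_xy i j) (terms_xy j i) i j (cuts_xy i j) (val_xy i j)"
  using square_xy_00 square_xy_01 square_xy_10 square_xy_11 by (cases i; cases j; simp only:)

fun cuts_xw :: "bool \<Rightarrow> bool \<Rightarrow> (real \<times> (real \<times> real) list) list" where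
  "cuts_xw False False = [
     (1/2, [(1, - 1)]),
     (3/5, [(- 2, 4), (1, - 1)]),
     (3/4, [(1, - 1), (- 2, 4)]),
     (1, [(1, - 1)])]"
| "cuts_xw False True = [
     (3/2, []),
     (2, [(4, - 2)])]"
| "cuts_xw True False = [
     (1/2, [(1, 1), (3/2, 0)]),
     (3/4, [(3/2, 0), (1, 1)]),
     (7/8, [(- 2, 4), (3/2, 0), (1, 1)]),
     (1, [(3/2, 0), (- 2, 4), (1, 1)])]"
| "cuts_xw True True = [
     (5/4, [(1/2, 1/2), (3/2, 0), (4, - 2), (5/2, - 1/2)]),
     (7/5, [(1/2, 1/2), (4, - 2), (3/2, 0), (5/2, - 1/2)]),
     (3/2, [(4, - 2), (1/2, 1/2), (3/2, 0), (5/2, - 1/2)]),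
     (2, [(1/2, 1/2), (3/2, 0), (5/2, - 1/2)])]"

fun val_xw :: "bool \<Rightarrow> bool \<Rightarrow> real" where
  "val_xw False False = (- 257619/35840)"
| "val_xw False True = 3601/1120"
| "val_xw True False = (- 100981/35840)"
| "val_xw True True = (- 21673/112000)"

lemma square_xw_00: "square_value (terms_xw False False) (terms_wx False False) False False (cuts_xw False False) (val_xw False False)"
  by (simp add: square_value_def at_corners_def poly1_integral_def between_lines_def)

lemma square_xw_01: "square_value (terms_xw False True) (terms_wx True False) False True (cuts_xw False True) (val_xw False True)"
  by (simp add: square_value_def at_corners_def poly1_integral_def between_lines_def)

lemma square_xw_10: "square_value (terms_xw True False) (terms_wx False True) True False (cuts_xw True False) (val_xw True False)"
  by (simp add: square_value_def at_corners_def poly1_integral_def between_lines_def)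

lemma square_xw_11: "square_value (terms_xw True True) (terms_wx True True) True True (cuts_xw True True) (val_xw True True)"
  by (simp add: square_value_def at_corners_def poly1_integral_def between_lines_def)

lemma square_xw: "square_value (terms_xw i j) (terms_wx j i) i j (cuts_xw i j) (val_xw i j)"
  using square_xw_00 square_xw_01 square_xw_10 square_xw_11 by (cases i; cases j; simp only:)

fun cuts_ww :: "bool \<Rightarrow> bool \<Rightarrow> (real \<times> (real \<times> real) list) list" where
  "cuts_ww False False = [
     (1/2, [(0, 1), (1/2, 0)]),
     (1, [(1/2, 0), (0, 1)])]"
| "cuts_ww False True = [
     (5/4, [(- 1/2, 1/2), (1/2, 0), (3, - 2), (3/2, - 1/2)]),
     (7/5, [(- 1/2, 1/2), (3, - 2), (1/2, 0), (3/2, - 1/2)]),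
     (3/2, [(3, - 2), (- 1/2, 1/2), (1/2, 0), (3/2, - 1/2)]),
     (5/3, [(- 3, 2), (- 1/2, 1/2), (1/2, 0), (3/2, - 1/2)]),
     (7/4, [(- 1/2, 1/2), (- 3, 2), (1/2, 0), (3/2, - 1/2)]),
     (9/5, [(- 1/2, 1/2), (1/2, 0), (- 3, 2), (3/2, - 1/2)]),
     (2, [(- 1/2, 1/2), (1/2, 0), (3/2, - 1/2), (- 3, 2)])]"
| "cuts_ww True False = [
     (1/5, [(1, 2), (3/2, - 1/2), (3/2, 0), (3/2, 1/2)]),
     (1/4, [(3/2, - 1/2), (1, 2), (3/2, 0), (3/2, 1/2)]),
     (1/3, [(3/2, - 1/2), (3/2, 0), (1, 2), (3/2, 1/2)]),
     (1/2, [(3/2, - 1/2), (3/2, 0), (3/2, 1/2), (1, 2)]),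
     (3/5, [(3/2, - 1/2), (3/2, 0), (3/2, 1/2), (3, - 2)]),
     (3/4, [(3/2, - 1/2), (3/2, 0), (3, - 2), (3/2, 1/2)]),
     (1, [(3/2, - 1/2), (3, - 2), (3/2, 0), (3/2, 1/2)])]"
| "cuts_ww True True = [
     (3/2, [(0, 1), (3/2, 0)]),
     (2, [(3/2, 0), (0, 1)])]"

fun val_ww :: "bool \<Rightarrow> bool \<Rightarrow> real" where
  "val_ww False False = 17/8"
| "val_ww False True = 51521/33600"
| "val_ww True False = 51521/33600"
| "val_ww True True = 17/8"

lemma square_ww_00: "square_value (terms_ww False False) (terms_ww False False) False False (cuts_ww False False) (val_ww False False)"
  by (simp add: square_value_def at_corners_def poly1_integral_def between_lines_def)

lemma square_ww_01: "square_value (terms_ww False True) (terms_ww True False) False True (cuts_ww False True) (val_ww False True)"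
  by (simp add: square_value_def at_corners_def poly1_integral_def between_lines_def)

lemma square_ww_10: "square_value (terms_ww True False) (terms_ww False True) True False (cuts_ww True False) (val_ww True False)"
  by (simp add: square_value_def at_corners_def poly1_integral_def between_lines_def)

lemma square_ww_11: "square_value (terms_ww True True) (terms_ww True True) True True (cuts_ww True True) (val_ww True True)"
  by (simp add: square_value_def at_corners_def poly1_integral_def between_lines_def)

lemma square_ww: "square_value (terms_ww i j) (terms_ww j i) i j (cuts_ww i j) (val_ww i j)"
  using square_ww_00 square_ww_01 square_ww_10 square_ww_11 by (cases i; cases j; simp only:)

section \<open>The four-cycle correlation as a sum over coordinates\<close>

lemma beat_measurable [measurable]:
  assumes [measurable]: "u \<in> borel_measurable M" "v \<in> borel_measurable M"
  shows "(\<lambda>x. beat (u x) (v x)) \<in> borel_measurable M"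
proof -
  have [measurable]: "(\<lambda>x. fst (u x)) \<in> borel_measurable M" "(\<lambda>x. snd (u x)) \<in> borel_measurable M" "(\<lambda>x. mid (u x)) \<in> borel_measurable M"
    "(\<lambda>x. fst (v x)) \<in> borel_measurable M" "(\<lambda>x. snd (v x)) \<in> borel_measurable M" "(\<lambda>x. mid (v x)) \<in> borel_measurable M"
    using assms by (auto intro: measurable_compose[OF _ projections_measurable(1)] measurable_compose[OF _ projections_measurable(3)] measurable_compose[OF _ projections_measurable(4)])
  show ?thesis unfolding beat_def by measurable
qed

lemma via_measurable:
  "(\<lambda>z. via_fst (fst z) (snd z)) \<in> borel_measurable (borel \<Otimes>\<^sub>M borel)"
  "(\<lambda>z. via_mid (fst z) (snd z)) \<in> borel_measurable (borel \<Otimes>\<^sub>M borel)"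
proof -
  have [measurable]: "(\<lambda>w :: ((real \<times> (real \<times> real)) \<times> (real \<times> real)). fst (snd w)) \<in> borel_measurable ((borel \<Otimes>\<^sub>M borel) \<Otimes>\<^sub>M borel)"
     "(\<lambda>w :: ((real \<times> (real \<times> real)) \<times> (real \<times> real)). mid (snd w)) \<in> borel_measurable ((borel \<Otimes>\<^sub>M borel) \<Otimes>\<^sub>M borel)"
    using measurable_compose[OF measurable_snd projections_measurable(3)] measurable_compose[OF measurable_snd projections_measurable(1)] by simp_all
  have "(\<lambda>z. \<integral>b. sgn (fst z - fst b) * beat b (snd z) \<partial>die) \<in> borel_measurable (borel \<Otimes>\<^sub>M (borel :: (real \<times> real) measure))"
    "(\<lambda>z. \<integral>b. sgn (fst z - mid b) * beat b (snd z) \<partial>die) \<in> borel_measurable (borel \<Otimes>\<^sub>M (borel :: (real \<times> real) measure))"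
    by (measurable; simp)+
  then show "(\<lambda>z. via_fst (fst z) (snd z)) \<in> borel_measurable (borel \<Otimes>\<^sub>M borel)"
    "(\<lambda>z. via_mid (fst z) (snd z)) \<in> borel_measurable (borel \<Otimes>\<^sub>M borel)"
    unfolding via_fst_def via_mid_def by simp_all
qed

lemma via_bound: "\<bar>via_fst t c\<bar> \<le> 3" "\<bar>via_mid t c\<bar> \<le> 3"
proof -
  have "\<bar>sgn x * beat b c\<bar> \<le> 3" for x b
    using mult_mono[OF sgn_bound(1)[of x] beat_bound[of b c]] by (simp add: abs_mult)
  then show "\<bar>via_fst t c\<bar> \<le> 3" "\<bar>via_mid t c\<bar> \<le> 3"
    unfolding via_fst_def via_mid_def by (auto intro!: die.expectation_bound)
qed

text \<open>
  The index 0, 1, 2 stands for the smallest, the middle and the largest entry. For the index 2,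
  \<open>flip\<close> accounts for the minus sign of \<open>snd\<close> in the outcome.
\<close>
definition via_coord :: "nat \<Rightarrow> real \<Rightarrow> real \<times> real \<Rightarrow> real" where
  "via_coord i = (if i = 0 then via_fst else if i = 1 then via_mid else (\<lambda>t c. via_fst t (flip c)))"

definition coord :: "nat \<Rightarrow> real \<times> real \<Rightarrow> real" where
  "coord i = (if i = 0 then fst else if i = 1 then mid else snd)"

lemma via_coord_measurable: "(\<lambda>z. via_coord i (fst z) (snd z)) \<in> borel_measurable (borel \<Otimes>\<^sub>M borel)"
proof -
  have "(\<lambda>z. (fst z, flip (snd z))) \<in> (borel :: real measure) \<Otimes>\<^sub>M borel \<rightarrow>\<^sub>M borel \<Otimes>\<^sub>M borel" by measurable
  from measurable_compose[OF this via_measurable(1)] show ?thesis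
    using via_measurable by (auto simp: via_coord_def)
qed

lemma via_coord_compose [measurable]:
  assumes "u \<in> borel_measurable M" "v \<in> borel_measurable M"
  shows "(\<lambda>x. via_coord i (u x) (v x)) \<in> borel_measurable M"
  using measurable_compose[OF measurable_Pair[OF assms] via_coord_measurable] by simp

lemma coord_measurable [measurable]: "coord i \<in> borel_measurable borel"
  unfolding coord_def by auto

lemma via_coord_bound: "\<bar>via_coord i t c\<bar> \<le> 3" by (auto simp: via_coord_def via_bound)

definition cycle_part :: "nat \<Rightarrow> nat \<Rightarrow> real" where
  "cycle_part i k = (\<integral>a. \<integral>c. via_coord i (coord i a) c * via_coord k (coord k c) a \<partial>die \<partial>die)"

lemma via_coord_product_bound: "\<bar>via_coord i t c * via_coord k s a\<bar> \<le> 9"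
  using mult_mono[OF via_coord_bound[of i t c] via_coord_bound[of k s a]] by (simp add: abs_mult)

lemma cycle_part_integrable: "integrable (die \<Otimes>\<^sub>M die) (\<lambda>(a, c). via_coord i (coord i a) c * via_coord k (coord k c) a)"
proof (rule die_die.integrable_const_bound[where B = 9])
  show "AE x in die \<Otimes>\<^sub>M die. norm (case x of (a, c) \<Rightarrow> via_coord i (coord i a) c * via_coord k (coord k c) a) \<le> 9"
    using via_coord_product_bound by auto
qed measurable

lemma cycle_part_sym: "cycle_part i k = cycle_part k i"
proof -
  have "cycle_part i k = (\<integral>c. \<integral>a. via_coord i (coord i a) c * via_coord k (coord k c) a \<partial>die \<partial>die)"
    unfolding cycle_part_def by (rule die_die.Fubini_integral[symmetric, OF cycle_part_integrable])
  then show ?thesis unfolding cycle_part_def by (simp add: mult.commute)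
qed

definition two_step :: "real \<times> real \<Rightarrow> real \<times> real \<Rightarrow> real" where
  "two_step a c = (\<integral>b. beat a b * beat b c \<partial>die)"

text \<open>
  Linearity of the outcome in the coordinate signs of its first argument.
\<close>
lemma two_step_eq: "two_step a c = (\<Sum>i<3. via_coord i (coord i a) c)"
proof -
  have bm: "(\<lambda>b. sgn (x - f b) * beat b c) \<in> borel_measurable borel" if "f \<in> borel_measurable borel" for x :: real and f :: "real \<times> real \<Rightarrow> real"
    using that by measurable
  have bd: "\<bar>sgn x * beat b c\<bar> \<le> 3" for x :: real and b
    using mult_mono[OF sgn_bound(1)[of x] beat_bound[of b c]] by (simp add: abs_mult)
  have int: "integrable die (\<lambda>b. sgn (x - f b) * beat b c)" if "f \<in> borel_measurable borel" for x :: real and f :: "real \<times> real \<Rightarrow> real"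
    by (rule die_integrable[OF bm[OF that] bd])
  have "via_fst (snd a) (flip c) = (\<integral>b. sgn (snd a - fst (flip b)) * beat (flip b) (flip c) \<partial>die)"
    unfolding via_fst_def by (rule die_flip[symmetric]) measurable
  also have "\<dots> = (\<integral>b. - (sgn (snd a - snd b) * beat b c) \<partial>die)"
    by (simp add: beat_flip)
  finally have 3: "via_fst (snd a) (flip c) = - (\<integral>b. sgn (snd a - snd b) * beat b c \<partial>die)"
    by simp
  have "two_step a c = (\<integral>b. sgn (fst a - fst b) * beat b c + sgn (mid a - mid b) * beat b c - sgn (snd a - snd b) * beat b c \<partial>die)"
  proof -
    have "beat a b * beat b c = sgn (fst a - fst b) * beat b c + sgn (mid a - mid b) * beat b c - sgn (snd a - snd b) * beat b c" for b
      unfolding beat_def[of a b] using sgn_minus[of "snd a - snd b"] by (simp add: algebra_simps)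
    then show ?thesis unfolding two_step_def by simp
  qed
  also have "\<dots> = via_fst (fst a) c + via_mid (mid a) c + via_fst (snd a) (flip c)"
    unfolding 3 unfolding via_fst_def via_mid_def using int[OF projections_measurable(3)] int[OF projections_measurable(1)] int[OF projections_measurable(4)] by simp
  finally show ?thesis by (simp add: via_coord_def coord_def numeral_3_eq_3)
qed

lemma two_step_measurable [measurable]:
  assumes [measurable]: "u \<in> borel_measurable M" "v \<in> borel_measurable M"
  shows "(\<lambda>x. two_step (u x) (v x)) \<in> borel_measurable M"
proof -
  have "(\<lambda>x. coord i (u x)) \<in> borel_measurable M" for i
    by (rule measurable_compose[OF assms(1)]) measurable
  then show ?thesis unfolding two_step_eq by measurable
qed

lemma two_step_cycle: "(\<integral>a. \<integral>c. two_step a c * two_step c a \<partial>die \<partial>die) = (\<Sum>i<3. \<Sum>k<3. cycle_part i k)"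
proof -
  have 1: "integrable die (\<lambda>c. via_coord i (coord i a) c * via_coord k (coord k c) a)" for i k a
    by (rule die_integrable[where B = 9]) (measurable, rule via_coord_product_bound)
  have 2: "integrable die (\<lambda>a. \<integral>c. via_coord i (coord i a) c * via_coord k (coord k c) a \<partial>die)" for i k
    using die_die.integrable_fst'[OF cycle_part_integrable[of i k]] by simp
  have "(\<integral>c. two_step a c * two_step c a \<partial>die) = (\<Sum>i<3. \<Sum>k<3. \<integral>c. via_coord i (coord i a) c * via_coord k (coord k c) a \<partial>die)" for a
    unfolding two_step_eq sum_product by (simp add: Bochner_Integration.integral_sum 1)
  then show ?thesis unfolding cycle_part_def by (simp add: Bochner_Integration.integral_sum 2)
qed

lemma via_mid_flip: "via_mid (2 - t) (flip a) = via_mid t a"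
proof -
  have "via_mid (2 - t) (flip a) = (\<integral>b. sgn (2 - t - mid (flip b)) * beat (flip b) (flip a) \<partial>die)"
    unfolding via_mid_def by (rule die_flip[symmetric]) measurable
  also have "\<dots> = via_mid t a"
    unfolding via_mid_def
  proof (rule Bochner_Integration.integral_cong[OF refl])
    show "sgn (2 - t - mid (flip b)) * beat (flip b) (flip a) = sgn (t - mid b) * beat b a" for b
      using sgn_minus[of "t - mid b"] by (simp add: beat_flip)
  qed
  finally show ?thesis .
qed

text \<open>
  The reflection exchanges the indices 0 and 2 and fixes 1.
\<close>
lemma cycle_part_flip: "cycle_part 2 2 = cycle_part 0 0" "cycle_part 2 1 = cycle_part 0 1"
proof -
  define h where "h k a = (\<integral>c. via_coord 0 (coord 0 a) c * via_coord k (coord k c) a \<partial>die)" for k a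
  have [measurable]: "h k \<in> borel_measurable borel" for k
  proof -
    have "(\<lambda>z. via_coord 0 (coord 0 (fst z)) (snd z) * via_coord k (coord k (snd z)) (fst z)) \<in> borel_measurable (borel \<Otimes>\<^sub>M borel)"
      by measurable
    then show ?thesis unfolding h_def by measurable
  qed
  have "(\<integral>c. via_fst (snd a) (flip c) * via_fst (snd c) (flip a) \<partial>die) = h 0 (flip a)" for a
  proof -
    have "h 0 (flip a) = (\<integral>c. via_coord 0 (coord 0 (flip a)) (flip c) * via_coord 0 (coord 0 (flip c)) (flip a) \<partial>die)"
      unfolding h_def by (rule die_flip[symmetric]) measurable
    then show ?thesis by (simp add: via_coord_def coord_def)
  qed
  then have "cycle_part 2 2 = (\<integral>a. h 0 (flip a) \<partial>die)" by (simp add: cycle_part_def via_coord_def coord_def)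
  also have "\<dots> = cycle_part 0 0" unfolding cycle_part_def h_def[symmetric] by (rule die_flip) measurable
  finally show "cycle_part 2 2 = cycle_part 0 0" .
  have "(\<integral>c. via_fst (snd a) (flip c) * via_mid (mid c) a \<partial>die) = h 1 (flip a)" for a
  proof -
    have "h 1 (flip a) = (\<integral>c. via_coord 0 (coord 0 (flip a)) (flip c) * via_coord 1 (coord 1 (flip c)) (flip a) \<partial>die)"
      unfolding h_def by (rule die_flip[symmetric]) measurable
    then show ?thesis by (simp add: via_coord_def coord_def via_mid_flip)
  qed
  then have "cycle_part 2 1 = (\<integral>a. h 1 (flip a) \<partial>die)" by (simp add: cycle_part_def via_coord_def coord_def)
  also have "\<dots> = cycle_part 0 1" unfolding cycle_part_def h_def[symmetric] by (rule die_flip) measurable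
  finally show "cycle_part 2 1 = cycle_part 0 1" .
qed

lemma two_step_cycle_eq: "(\<integral>a. \<integral>c. two_step a c * two_step c a \<partial>die \<partial>die) = 2 * cycle_part 0 0 + 2 * cycle_part 0 2 + cycle_part 1 1 + 4 * cycle_part 0 1"
  using cycle_part_flip cycle_part_sym[of 1 0] cycle_part_sym[of 2 0] cycle_part_sym[of 1 2]
  unfolding two_step_cycle by (simp add: numeral_3_eq_3 numeral_2_eq_2)

lemma cycle_part_fibre:
  fixes f g :: "real \<Rightarrow> real \<times> real \<Rightarrow> real"
  assumes "chart p" "chart q" "\<And>t y. coord i (p t y) = t" "\<And>t y. coord k (q t y) = t"
  shows "cycle_part i k = (\<integral>r. \<integral>t. fibre q (via_coord i t) r * fibre p (via_coord k r) t \<partial>seg \<partial>seg)"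
proof -
  have "cycle_part k i = (\<integral>r. \<integral>t. fibre p (via_coord k r) t * fibre q (via_coord i t) r \<partial>seg \<partial>seg)"
    unfolding cycle_part_def
    by (rule cycle_fibre[OF assms(2,1) via_coord_measurable via_coord_measurable via_coord_bound via_coord_bound coord_measurable coord_measurable assms(4,3)])
  then show ?thesis by (simp add: cycle_part_sym[of i k] mult.commute)
qed

lemma fibre_flip: "fibre px (\<lambda>c. g (flip c)) t = fibre py g t"
proof -
  have "indicat_real kite (t, y) = indicat_real kite (y, t)" for y
    using kite_swap[of t y] by (simp add: indicator_def)
  then show ?thesis unfolding fibre_def px_def py_def by (simp add: flip_def)
qed

section \<open>The value of the four-cycle correlation\<close>

lemma cycle_part_xx: "cycle_part 0 0 = 32813 / 1612800"
proof -
  have "cycle_part 0 0 = (\<integral>r. \<integral>t. fibre px (via_fst t) r * fibre px (via_fst r) t \<partial>seg \<partial>seg)"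
    using cycle_part_fibre[of px px 0 0] by (simp add: chart_px coord_def via_coord_def px_def)
  also have "\<dots> = (val_xx False False + val_xx True False + val_xx False True + val_xx True True) / (4 * 96 * 96)"
    by (rule cycle_value[OF chart_px chart_px via_measurable(1) via_measurable(1) via_bound(1) via_bound(1) fibre_xx fibre_xx square_xx]) auto
  finally show ?thesis by simp
qed

lemma cycle_part_xy: "cycle_part 0 2 = 38977 / 55296000"
proof -
  have "cycle_part 0 2 = (\<integral>r. \<integral>t. fibre py (via_fst t) r * fibre py (via_fst r) t \<partial>seg \<partial>seg)"
    using cycle_part_fibre[of px py 0 2] by (simp add: chart_px chart_py coord_def via_coord_def px_def py_def fibre_flip)
  also have "\<dots> = (val_xy False False + val_xy True False + val_xy False True + val_xy True True) / (4 * 96 * 96)"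
    by (rule cycle_value[OF chart_py chart_py via_measurable(1) via_measurable(1) via_bound(1) via_bound(1) fibre_xy fibre_xy square_xy]) auto
  finally show ?thesis by simp
qed

lemma cycle_part_ww: "cycle_part 1 1 = 122921 / 2419200"
proof -
  have "cycle_part 1 1 = (\<integral>r. \<integral>t. fibre pw (via_mid t) r * fibre pw (via_mid r) t \<partial>seg \<partial>seg)"
    using cycle_part_fibre[of pw pw 1 1] by (simp add: chart_pw coord_def via_coord_def pw_def mid_def)
  also have "\<dots> = (val_ww False False + val_ww True False + val_ww False True + val_ww True True) / (4 * 6 * 6)"
    by (rule cycle_value[OF chart_pw chart_pw via_measurable(2) via_measurable(2) via_bound(2) via_bound(2) fibre_ww fibre_ww square_ww]) auto
  finally show ?thesis by simp
qed

lemma cycle_part_xw: "cycle_part 0 1 = - 391099 / 258048000"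
proof -
  have "cycle_part 0 1 = (\<integral>r. \<integral>t. fibre pw (via_fst t) r * fibre px (via_mid r) t \<partial>seg \<partial>seg)"
    using cycle_part_fibre[of px pw 0 1] by (simp add: chart_pw chart_px coord_def via_coord_def pw_def px_def mid_def)
  also have "\<dots> = (val_xw False False + val_xw True False + val_xw False True + val_xw True True) / (4 * 12 * 96)"
    by (rule cycle_value[OF chart_px chart_pw via_measurable via_bound fibre_xw fibre_wx square_xw]) auto
  finally show ?thesis by simp
qed

lemma two_step_cycle_value: "(\<integral>a. \<integral>c. two_step a c * two_step c a \<partial>die \<partial>die) = 8404171 / 96768000"
  unfolding two_step_cycle_eq cycle_part_xx cycle_part_xy cycle_part_ww cycle_part_xw by simp

section \<open>Moments of the score\<close>

definition score :: "real \<times> real \<Rightarrow> real" where "score a = (\<integral>b. beat a b \<partial>die)"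

lemma score_measurable [measurable]: "score \<in> borel_measurable borel"
proof -
  have "(\<lambda>a. \<integral>b. beat a b \<partial>die) \<in> borel_measurable borel"
  proof (rule die.borel_measurable_lebesgue_integral)
    show "(\<lambda>(a, b). beat a b) \<in> borel_measurable (borel \<Otimes>\<^sub>M die)" by (simp add: case_prod_unfold) measurable
  qed
  then show ?thesis by (simp add: score_def[abs_def])
qed

lemma score_bound: "\<bar>score a\<bar> \<le> 3"
  unfolding score_def by (rule die.expectation_bound) (rule beat_bound)

lemma score_flip: "score (flip a) = - score a"
proof -
  have "score (flip a) = (\<integral>b. beat (flip a) (flip b) \<partial>die)"
    unfolding score_def by (rule die_flip[symmetric]) measurable
  then show ?thesis by (simp add: beat_flip score_def)
qed

text \<open>
  The reflection preserves the distribution of \<open>a\<close> and changes the sign of its score.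
\<close>
lemma score_cube: "(\<integral>a. score a ^ 3 \<partial>die) = 0"
proof -
  have "(\<integral>a. score a ^ 3 \<partial>die) = (\<integral>a. score (flip a) ^ 3 \<partial>die)"
    by (rule die_flip[symmetric]) measurable
  also have "\<dots> = - (\<integral>a. score a ^ 3 \<partial>die)" by (simp add: score_flip)
  finally show ?thesis by simp
qed

lemma AE_kite: "AE b in die. b \<in> kite"
  unfolding die_def by (rule AE_uniform_measureI) auto

text \<open>
  A line on which a coordinate is constant is a null set, since it is a single point in the outer variable of
  a chart.
\<close>
lemma coord_null:
  assumes p: "chart p" and f [measurable]: "f \<in> borel_measurable borel" "\<And>x y. f (p x y) = x"
  shows "AE b in die. f b \<noteq> t"
proof -
  let ?E = "{b. f b = t}"
  have E [measurable]: "?E \<in> sets borel" using measurable_sets[OF f(1), of "{t}"] by (simp add: vimage_def)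
  have "measure die ?E = (\<integral>b. indicator ?E b \<partial>die)" by simp
  also have "\<dots> = (\<integral>x. fibre p (indicator ?E) x \<partial>seg)"
    by (rule die_fibre[OF p, where B = 1]) (auto simp: indicator_def)
  also have "\<dots> = 0"
  proof (rule integral_eq_zero_AE)
    have "AE x in seg. x \<noteq> t"
      unfolding seg_def by (rule AE_uniform_measureI) (use AE_lborel_singleton[of t] in auto)
    then show "AE x in seg. fibre p (indicator ?E) x = 0"
      by eventually_elim (simp add: fibre_def f(2))
  qed
  finally have "measure die ?E = 0" .
  then show ?thesis using E by (auto simp: die.emeasure_eq_measure intro!: AE_I[of _ _ ?E])
qed

text \<open>
  All dice lie below the value 2 of the first coordinate, so the sign in \<open>via_fst 2\<close> is 1 almost
  surely.
\<close>
lemma score_eq: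
  assumes c: "c \<in> kite"
  shows "score c = - via_fst 2 c"
proof -
  have fst2: "AE b in die. fst b \<noteq> 2" by (rule coord_null[OF chart_px]) (auto simp: px_def)
  have "via_fst 2 c = (\<integral>b. beat b c \<partial>die)"
    unfolding via_fst_def
  proof (rule integral_cong_AE)
    show "AE b in die. sgn (2 - fst b) * beat b c = beat b c"
      using AE_kite fst2
    proof eventually_elim
      case (elim b)
      then have "fst b < 2" using kite_coords[of b] by (auto simp: less_le)
      then show ?case by (simp add: sgn_if)
    qed
  qed measurable
  also have "\<dots> = (\<integral>b. - beat c b \<partial>die)"
  proof (rule Bochner_Integration.integral_cong[OF refl])
    show "beat b c = - beat c b" for b
      using sgn_minus[of "fst b - fst c"] sgn_minus[of "mid b - mid c"] sgn_minus[of "snd b - snd c"]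
      by (simp add: beat_def)
  qed
  finally show ?thesis by (simp add: score_def)
qed

text \<open>
  Four times the negative score at \<open>(x, y)\<close>, with \<open>y\<close> as the first variable, for
  \<open>x\<close> below and above 1.
\<close>
fun terms_score :: "bool \<Rightarrow> ramp_term list" where
  "terms_score False = [((1, 0, 0), [[0, 4, - 5], [- 4, 8], [- 3]]), ((- 1, 1, 0), [[4], [- 4]]), ((0, 1, - 1), [[0, - 8], [8]])]"
| "terms_score True = [((1, 0, 0), [[4, - 4, - 1], [- 4, 8], [- 3]]), ((- 1, 1, 0), [[4], [- 4]]), ((0, 1, - 1), [[0, - 8], [8]])]"

lemma score_ramp_sum:
  assumes x: "x \<in> {of_bool j..of_bool j + 1}" and c: "(x, y) \<in> kite"
  shows "4 * score (x, y) = - ramp_sum (terms_score j) y x"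
proof -
  have b: "0 \<le> x" "x \<le> 2" "0 \<le> y" "y \<le> 2" using kite_bounds[OF c] by auto
  have pos: "ramp 2 u = max 0 u * u" for u by (cases "0 \<le> u") (auto simp: ramp_def power2_eq_square)
  have s1: "score (x, y) = - (corr_self 1 (1 / 4) 1 2 x + corr_xw 2 (1 + y - x) + corr_xy 2 y)"
    using via_fst_eq[OF _ c, of 2] score_eq[OF c] by (simp add: mid_def)
  have s2: "corr_self 1 (1 / 4) 1 2 x = 1 - x - x\<^sup>2 / 4 + ramp 2 (x - 1)"
    using b by (simp add: corr_self_def self_primitive_def ramp_pos ramp_neg power2_eq_square)
  have s3: "ramp 2 (x - 1) = (if j then (x - 1)\<^sup>2 else 0)" using x by (auto simp: ramp_pos ramp_neg)
  have s4: "corr_xw 2 (1 + y - x) = 1 - (1 + y - x)\<^sup>2 + 2 * ramp 2 (y - x)"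
  proof -
    have "y - x \<le> 1" "x - y \<le> 1" using c by (auto simp: kite_def)
    then show ?thesis
      using b by (cases "0 \<le> y - x") (simp_all add: corr_xw_def ramp_pos ramp_neg power2_eq_square field_simps)
  qed
  have s5: "corr_xy 2 y = - 1 + y + y\<^sup>2 / 4 - ramp 2 (y - 1)"
    using b by (simp add: corr_xy_def ramp_pos ramp_neg power2_eq_square field_simps)
  show ?thesis
    unfolding s1 s2 s3 s4 s5 unfolding pos by (cases j) (simp_all add: power2_eq_square field_simps)
qed

lemma continuous_integral:
  fixes k :: "real \<Rightarrow> real"
  assumes "continuous_on UNIV k"
  shows "has_bochner_integral lborel (\<lambda>y. k y * indicator {l..h} y) (integral {l..h} k)"
proof -
  have "set_integrable lborel {l..h} k"
    by (rule borel_integrable_atLeastAtMost') (rule continuous_on_subset[OF assms], simp)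
  then show ?thesis
    using set_borel_integral_eq_integral[of "{l..h}" k]
    by (simp add: has_bochner_integral_iff set_integrable_def set_lebesgue_integral_def mult.commute)
qed

text \<open>
  The exact integrator, applied to the kite itself: between the lower boundary \<open>lo\<close>, which
  changes at \<open>x = 1\<close>, and the upper boundary \<open>hi\<close>.
\<close>
lemma score_square: "(\<integral>a. score a ^ 2 \<partial>die) = 13 / 960"
proof -
  define I where "I j x = integral {lo x..hi x} (\<lambda>y. ramp_sum (terms_score j) y x * ramp_sum (terms_score j) y x) / 16" for j x
  have fib: "fibre px (\<lambda>a. score a ^ 2) x = I j x" if x: "x \<in> {of_bool j..of_bool j + 1}" for x j
  proof -
    have x2: "x \<in> {0..2}" using x by (cases j) auto
    have "fibre px (\<lambda>a. score a ^ 2) x = integral {lo x..hi x} (\<lambda>y. ramp_sum (terms_score j) y x * ramp_sum (terms_score j) y x / 16)"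
    proof (rule fibre_interval)
      show "has_bochner_integral lborel (\<lambda>y. (ramp_sum (terms_score j) y x * ramp_sum (terms_score j) y x / 16) * indicator {lo x..hi x} y)
         (integral {lo x..hi x} (\<lambda>y. ramp_sum (terms_score j) y x * ramp_sum (terms_score j) y x / 16))"
        by (rule continuous_integral) (intro continuous_intros continuous_ramp_sum, simp)
      show "score (px x y) ^ 2 = ramp_sum (terms_score j) y x * ramp_sum (terms_score j) y x / 16" if "y \<in> {lo x..hi x}" for y
      proof -
        have "(x, y) \<in> kite" using that x2 by (simp add: kite_iff)
        from score_ramp_sum[OF x this] have "score (x, y) = - ramp_sum (terms_score j) y x / 4" by simp
        then show ?thesis by (simp add: px_def power2_eq_square)
      qed
    qed (use x2 in \<open>auto simp: px_kite lo_hi_bounds\<close>)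
    then show ?thesis by (simp add: I_def)
  qed
  have 1: "(I False has_integral grid_value (terms_score False) (terms_score False) (0, 0) (1, 1 / 2) 0 [(1, [(0, 1), (1, 0)])] / 16) {0..1}"
  proof -
    have "grid_ok (terms_score False) (terms_score False) (0, 0) (1, 1 / 2) 0 [(1, [(0, 1), (1, 0)])]"
      by (simp add: at_corners_def)
    from has_integral_divide[OF conjunct1[OF grid_integral[OF this]], of 16]
    have "((\<lambda>z. integral {0..1 + z / 2} (\<lambda>x. ramp_sum (terms_score False) x z * ramp_sum (terms_score False) x z) / 16) has_integral
      grid_value (terms_score False) (terms_score False) (0, 0) (1, 1 / 2) 0 [(1, [(0, 1), (1, 0)])] / 16) {0..1}"
      by (simp del: grid_value.simps ramp_sum.simps terms_score.simps)
    then show ?thesis by (rule has_integral_eq[rotated]) (auto simp: I_def lo_def hi_def)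
  qed
  have 2: "(I True has_integral grid_value (terms_score True) (terms_score True) (- 2, 2) (1, 1 / 2) 1 [(3/2, [(1, 0), (0, 1)]), (2, [(0, 1)])] / 16) {1..2}"
  proof -
    have "grid_ok (terms_score True) (terms_score True) (- 2, 2) (1, 1 / 2) 1 [(3/2, [(1, 0), (0, 1)]), (2, [(0, 1)])]"
      by (simp add: at_corners_def)
    from has_integral_divide[OF conjunct1[OF grid_integral[OF this]], of 16]
    have "((\<lambda>z. integral {z * 2 - 2..1 + z / 2} (\<lambda>x. ramp_sum (terms_score True) x z * ramp_sum (terms_score True) x z) / 16) has_integral
      grid_value (terms_score True) (terms_score True) (- 2, 2) (1, 1 / 2) 1 [(3/2, [(1, 0), (0, 1)]), (2, [(0, 1)])] / 16) {1..2}"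
      by (simp del: grid_value.simps ramp_sum.simps terms_score.simps)
    then show ?thesis by (rule has_integral_eq[rotated]) (auto simp: I_def lo_def hi_def mult.commute)
  qed
  have "(fibre px (\<lambda>a. score a ^ 2) has_integral 13 / 480) {0..2}"
  proof (rule has_integral_combine[where c = 1, THEN has_integral_eq_rhs])
    show "(fibre px (\<lambda>a. score a ^ 2) has_integral grid_value (terms_score False) (terms_score False) (0, 0) (1, 1 / 2) 0 [(1, [(0, 1), (1, 0)])] / 16) {0..1}"
      by (rule has_integral_eq[OF _ 1]) (simp add: fib[of _ False])
    show "(fibre px (\<lambda>a. score a ^ 2) has_integral grid_value (terms_score True) (terms_score True) (- 2, 2) (1, 1 / 2) 1 [(3/2, [(1, 0), (0, 1)]), (2, [(0, 1)])] / 16) {1..2}"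
      by (rule has_integral_eq[OF _ 2]) (simp add: fib[of _ True])
  qed (simp_all add: at_corners_def poly1_integral_def between_lines_def)
  moreover have "\<bar>score a ^ 2\<bar> \<le> 9" for a using power_mono[OF score_bound[of a], of 2] by simp
  moreover have "(\<lambda>z. score (snd z) ^ 2) \<in> borel_measurable (borel \<Otimes>\<^sub>M borel)" by measurable
  moreover have "fibre px (\<lambda>a. score a ^ 2) \<in> borel_measurable borel"
    by (rule fibre_measurable[OF chart_px, where f = "\<lambda>_ a. score a ^ 2" and u = "\<lambda>_. 0" and v = "\<lambda>x. x"]) measurable
  ultimately have "(\<integral>x. fibre px (\<lambda>a. score a ^ 2) x \<partial>seg) = 13 / 480 / 2"
    by (intro seg_integral_HK[where B = "2 * 9"] fibre_bound)
  moreover have "(\<integral>a. score a ^ 2 \<partial>die) = (\<integral>x. fibre px (\<lambda>a. score a ^ 2) x \<partial>seg)"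
    by (rule die_fibre[OF chart_px _ \<open>\<And>a. \<bar>score a ^ 2\<bar> \<le> 9\<close>]) measurable
  ultimately show ?thesis by simp
qed

section \<open>Sorted balanced dice are uniform on the kite\<close>

definition coords :: "real ^ 3 \<Rightarrow> real \<times> real" where
  "coords a = (4 * min (a $ 1) (min (a $ 2) (a $ 3)), 4 - 4 * max (a $ 1) (max (a $ 2) (a $ 3)))"

definition sorted_coords :: "real \<Rightarrow> real \<Rightarrow> real \<times> real" where
  "sorted_coords x y = (4 * min x (min y (3/2 - x - y)), 4 - 4 * max x (max y (3/2 - x - y)))"

lemma coords_measurable [measurable]: "coords \<in> borel_measurable borel"
  unfolding coords_def by (intro borel_measurable_continuous_onI continuous_intros)

lemma vector_measurable [measurable]: "(\<lambda>(x, y). vector [x, y, 3/2 - x - y] :: real ^ 3) \<in> borel_measurable borel"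
proof (rule borel_measurable_continuous_onI)
  have "continuous_on UNIV (\<lambda>z :: real \<times> real. (\<chi> i. if i = 1 then fst z else if i = 2 then snd z else 3/2 - fst z - snd z) :: real ^ 3)"
  proof (rule continuous_on_vec_lambda)
    show "continuous_on UNIV (\<lambda>z :: real \<times> real. if i = 1 then fst z else if i = 2 then snd z else 3/2 - fst z - snd z)" for i :: 3
      by (cases "i = 1"; cases "i = 2"; simp; intro continuous_intros)
  qed
  moreover have "(\<lambda>(x, y). vector [x, y, 3/2 - x - y] :: real ^ 3)
      = (\<lambda>z. \<chi> i. if i = 1 then fst z else if i = 2 then snd z else 3/2 - fst z - snd z)"
    by (auto simp: fun_eq_iff vec_eq_iff forall_3 vector_3)
  ultimately show "continuous_on UNIV (\<lambda>(x, y). vector [x, y, 3/2 - x - y] :: real ^ 3)" by simp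
qed

lemma projection_sets [measurable]: "balanced_projection \<in> sets borel"
proof -
  have "closed balanced_projection" unfolding balanced_projection_def case_prod_unfold
    by (intro closed_Collect_conj closed_Collect_le continuous_intros)
  then show ?thesis by simp
qed

lemma nn_integral_swap_order:
  fixes f :: "real \<Rightarrow> real \<Rightarrow> ennreal"
  assumes "(\<lambda>z. f (fst z) (snd z)) \<in> borel_measurable borel"
  shows "(\<integral>\<^sup>+x. \<integral>\<^sup>+y. f x y \<partial>lborel \<partial>lborel) = (\<integral>\<^sup>+y. \<integral>\<^sup>+x. f x y \<partial>lborel \<partial>lborel)"
  using nn_integral_lborel_Pair(1)[OF assms] nn_integral_lborel_Pair(2)[OF assms] by simp

lemma nn_integral_reflect:
  fixes f :: "real \<Rightarrow> ennreal"
  assumes "f \<in> borel_measurable borel"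
  shows "(\<integral>\<^sup>+y. f (c - y) \<partial>lborel) = (\<integral>\<^sup>+y. f y \<partial>lborel)"
  using nn_integral_real_affine[of f "- 1" c] assms by simp

lemma nn_integral_quarter:
  fixes f :: "real \<Rightarrow> ennreal"
  assumes "f \<in> borel_measurable borel"
  shows "(\<integral>\<^sup>+y. f y \<partial>lborel) = ennreal (1 / 4) * (\<integral>\<^sup>+y. f (c + y / 4) \<partial>lborel)"
  using nn_integral_real_affine[of f "1 / 4" c] assms by (simp add: field_simps)

lemma fixed_measurable:
  fixes f :: "real \<Rightarrow> real \<Rightarrow> ennreal"
  assumes f: "(\<lambda>z. f (fst z) (snd z)) \<in> borel_measurable borel"
    and uv: "continuous_on UNIV u" "continuous_on UNIV v"
  shows "(\<lambda>x :: 'a :: topological_space. f (u x) (v x)) \<in> borel_measurable borel"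
  using measurable_compose[OF borel_measurable_continuous_onI[OF continuous_on_Pair[OF uv]] f] by simp

text \<open>
  A symmetric integrand gives the same integral on each of the six order cones. Symmetry under the two
  transpositions generates the rest: exchanging \<open>x\<close> and \<open>y\<close> is Fubini, and
  exchanging \<open>y\<close> with the third entry is a reflection of the inner variable.
\<close>
lemma six_orders:
  fixes k :: "real \<Rightarrow> real \<Rightarrow> ennreal"
  assumes k [measurable]: "(\<lambda>z. k (fst z) (snd z)) \<in> borel_measurable borel"
    and sym: "\<And>x y. k y x = k x y" "\<And>x y. k x (3/2 - x - y) = k x y"
  shows "(\<integral>\<^sup>+x. \<integral>\<^sup>+y. k x y \<partial>lborel \<partial>lborel)
    = 6 * (\<integral>\<^sup>+x. \<integral>\<^sup>+y. k x y * indicator {y. x \<le> y \<and> y \<le> 3/2 - x - y} y \<partial>lborel \<partial>lborel)"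
proof -
  define I where "I R = (\<integral>\<^sup>+x. \<integral>\<^sup>+y. k x y * of_bool (R x y (3/2 - x - y)) \<partial>lborel \<partial>lborel)" for R
  define O3 where "O3 = {R :: real \<Rightarrow> real \<Rightarrow> real \<Rightarrow> bool. {z. R (fst z) (snd z) (3/2 - fst z - snd z)} \<in> sets borel}"
  have mO: "(\<lambda>z. k (fst z) (snd z) * of_bool (R (fst z) (snd z) (3/2 - fst z - snd z))) \<in> borel_measurable borel"
    if "R \<in> O3" for R
  proof -
    have "(\<lambda>z. k (fst z) (snd z) * indicator {z. R (fst z) (snd z) (3/2 - fst z - snd z)} z) \<in> borel_measurable borel"
      using that k by (intro borel_measurable_times_ennreal borel_measurable_indicator) (auto simp: O3_def)
    then show ?thesis by (simp add: indicator_def)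
  qed
  have swap1: "I (\<lambda>x y z. R y x z) = I R" if R: "R \<in> O3" for R
  proof -
    from nn_integral_swap_order[of "\<lambda>x y. k x y * of_bool (R x y (3/2 - x - y))", OF mO[OF R]]
    show ?thesis unfolding I_def by (simp add: sym(1) algebra_simps)
  qed
  have swap2: "I (\<lambda>x y z. R x z y) = I R" if R: "R \<in> O3" for R
    unfolding I_def
  proof (rule nn_integral_cong)
    fix x
    from fixed_measurable[of "\<lambda>x y. k x y * of_bool (R x y (3/2 - x - y))", OF mO[OF R], of "\<lambda>_. x" "\<lambda>y. y"]
    have "(\<lambda>y. k x y * of_bool (R x y (3/2 - x - y))) \<in> borel_measurable borel" by simp
    from nn_integral_reflect[OF this, of "3/2 - x"]
    show "(\<integral>\<^sup>+y. k x y * of_bool (R x (3/2 - x - y) y) \<partial>lborel) = (\<integral>\<^sup>+y. k x y * of_bool (R x y (3/2 - x - y)) \<partial>lborel)"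
      by (simp add: sym(2))
  qed
  let ?L = "\<lambda>x y z :: real. x \<le> y \<and> y \<le> z"
  have O3: "(\<lambda>x y z. ?L x y z) \<in> O3" "(\<lambda>x y z. ?L x z y) \<in> O3" "(\<lambda>x y z. ?L y x z) \<in> O3" "(\<lambda>x y z. ?L y z x) \<in> O3"
     "(\<lambda>x y z. ?L z x y) \<in> O3" "(\<lambda>x y z. ?L z y x) \<in> O3"
    unfolding O3_def mem_Collect_eq by (intro borel_closed closed_Collect_conj closed_Collect_le continuous_intros)+
  have I: "I (\<lambda>x y z. ?L x z y) = I ?L" "I (\<lambda>x y z. ?L y x z) = I ?L" "I (\<lambda>x y z. ?L y z x) = I ?L"
    "I (\<lambda>x y z. ?L z x y) = I ?L" "I (\<lambda>x y z. ?L z y x) = I ?L"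
    using swap2[OF O3(1)] swap1[OF O3(1)] swap1[OF O3(2)] swap2[OF O3(3)] swap2[OF O3(4)] by simp_all
  have m: "(\<lambda>y. k x y * of_bool (R x y (3/2 - x - y))) \<in> borel_measurable borel"
     "(\<lambda>x. \<integral>\<^sup>+y. k x y * of_bool (R x y (3/2 - x - y)) \<partial>lborel) \<in> borel_measurable borel" if "R \<in> O3" for R x
  proof -
    show "(\<lambda>y. k x y * of_bool (R x y (3/2 - x - y))) \<in> borel_measurable borel"
      using fixed_measurable[of "\<lambda>x y. k x y * of_bool (R x y (3/2 - x - y))", OF mO[OF that], of "\<lambda>_. x" "\<lambda>y. y"] by simp
    have "(\<lambda>z. k (fst z) (snd z) * of_bool (R (fst z) (snd z) (3/2 - fst z - snd z))) \<in> borel_measurable (borel \<Otimes>\<^sub>M lborel)"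
      unfolding measurable_cong_sets[OF sets_pair_measure_cong[OF refl sets_lborel] refl] borel_prod
      by (rule mO[OF that])
    then show "(\<lambda>x. \<integral>\<^sup>+y. k x y * of_bool (R x y (3/2 - x - y)) \<partial>lborel) \<in> borel_measurable borel"
      by (intro lborel.borel_measurable_nn_integral) (simp add: case_prod_unfold)
  qed
  have "(\<integral>\<^sup>+x. \<integral>\<^sup>+y. k x y \<partial>lborel \<partial>lborel) = (\<integral>\<^sup>+x. \<integral>\<^sup>+y.
      k x y * of_bool (?L x y (3/2 - x - y)) + k x y * of_bool (?L x (3/2 - x - y) y) + k x y * of_bool (?L y x (3/2 - x - y))
      + k x y * of_bool (?L y (3/2 - x - y) x) + k x y * of_bool (?L (3/2 - x - y) x y) + k x y * of_bool (?L (3/2 - x - y) y x) \<partial>lborel \<partial>lborel)"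
  proof (rule nn_integral_cong, rule nn_integral_cong_AE)
    fix x :: real
    show "AE y in lborel. k x y = k x y * of_bool (?L x y (3/2 - x - y)) + k x y * of_bool (?L x (3/2 - x - y) y) + k x y * of_bool (?L y x (3/2 - x - y))
      + k x y * of_bool (?L y (3/2 - x - y) x) + k x y * of_bool (?L (3/2 - x - y) x y) + k x y * of_bool (?L (3/2 - x - y) y x)"
      using AE_lborel_singleton[of x] AE_lborel_singleton[of "3/2 - 2 * x"] AE_lborel_singleton[of "3/4 - x / 2"]
    proof eventually_elim
      case (elim y)
      then have "x \<noteq> y" "x \<noteq> 3/2 - x - y" "y \<noteq> 3/2 - x - y" by auto
      then consider "x < y" "y < 3/2 - x - y" | "x < 3/2 - x - y" "3/2 - x - y < y" | "y < x" "x < 3/2 - x - y"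
        | "y < 3/2 - x - y" "3/2 - x - y < x" | "3/2 - x - y < x" "x < y" | "3/2 - x - y < y" "y < x" by linarith
      then show ?case by cases simp_all
    qed
  qed
  also have "\<dots> = I ?L + I (\<lambda>x y z. ?L x z y) + I (\<lambda>x y z. ?L y x z) + I (\<lambda>x y z. ?L y z x)
      + I (\<lambda>x y z. ?L z x y) + I (\<lambda>x y z. ?L z y x)"
    unfolding I_def using m(1)[OF O3(1)] m(1)[OF O3(2)] m(1)[OF O3(3)] m(1)[OF O3(4)] m(1)[OF O3(5)] m(1)[OF O3(6)]
      m(2)[OF O3(1)] m(2)[OF O3(2)] m(2)[OF O3(3)] m(2)[OF O3(4)] m(2)[OF O3(5)] m(2)[OF O3(6)]
    by (simp add: nn_integral_add)
  also have "\<dots> = 6 * I ?L" unfolding I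
  proof -
    have "(6 :: ennreal) = 1 + 1 + 1 + 1 + 1 + 1" by simp
    then show "I ?L + I ?L + I ?L + I ?L + I ?L + I ?L = 6 * I ?L" by (simp only: distrib_right mult_1)
  qed
  finally show ?thesis unfolding I_def indicator_def by (simp add: of_bool_def)
qed

lemma sorted_measurable: "(\<lambda>z. sorted_coords (fst z) (snd z)) \<in> borel_measurable borel"
  unfolding sorted_coords_def by (intro borel_measurable_continuous_onI continuous_intros)

text \<open>
  The factor is six orders times the Jacobian 1/16 of the scaling of both coordinates by 4.
\<close>
lemma projection_to_kite:
  assumes A [measurable]: "A \<in> sets borel"
  shows "(\<integral>\<^sup>+x. \<integral>\<^sup>+y. indicator balanced_projection (x, y) * indicator A (sorted_coords x y) \<partial>lborel \<partial>lborel)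
    = ennreal (3 / 8) * emeasure lborel (kite \<inter> A)"
proof -
  let ?k = "\<lambda>x y. indicator balanced_projection (x, y) * indicator A (sorted_coords x y) :: ennreal"
  have k0: "(\<lambda>z. indicator balanced_projection z * indicator A (sorted_coords (fst z) (snd z)) :: ennreal) \<in> borel_measurable borel"
  proof (rule borel_measurable_times_ennreal)
    show "(\<lambda>z. indicator A (sorted_coords (fst z) (snd z)) :: ennreal) \<in> borel_measurable borel"
      by (rule measurable_compose[OF sorted_measurable]) measurable
  qed measurable
  then have km: "(\<lambda>z. ?k (fst z) (snd z)) \<in> borel_measurable borel" by simp
  have g: "(\<lambda>x. \<integral>\<^sup>+y. indicator (kite \<inter> A) (x, y) \<partial>lborel) \<in> borel_measurable borel"
  proof -
    have "indicator (kite \<inter> A) \<in> borel_measurable (borel \<Otimes>\<^sub>M lborel)"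
      unfolding measurable_cong_sets[OF sets_pair_measure_cong[OF refl sets_lborel] refl] borel_prod by measurable
    then show ?thesis by (intro lborel.borel_measurable_nn_integral) (simp add: case_prod_unfold)
  qed
  have "(\<integral>\<^sup>+x. \<integral>\<^sup>+y. ?k x y \<partial>lborel \<partial>lborel)
      = 6 * (\<integral>\<^sup>+x. \<integral>\<^sup>+y. ?k x y * indicator {y. x \<le> y \<and> y \<le> 3/2 - x - y} y \<partial>lborel \<partial>lborel)"
  proof (rule six_orders[OF km])
    have "sorted_coords y x = sorted_coords x y" "sorted_coords x (3/2 - x - y) = sorted_coords x y" for x y
    proof -
      have "3/2 - y - x = 3/2 - x - y" "3/2 - x - (3/2 - x - y) = y" by simp_all
      then show "sorted_coords y x = sorted_coords x y" "sorted_coords x (3/2 - x - y) = sorted_coords x y"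
        by (simp_all only: sorted_coords_def min.commute min.left_commute max.commute max.left_commute)
    qed
    then show "?k y x = ?k x y" "?k x (3/2 - x - y) = ?k x y" for x y
      by (auto simp: balanced_projection_def indicator_def)
  qed
  also have "(\<lambda>x. \<integral>\<^sup>+y. ?k x y * indicator {y. x \<le> y \<and> y \<le> 3/2 - x - y} y \<partial>lborel)
      = (\<lambda>x. \<integral>\<^sup>+y. indicator (kite \<inter> A) (4 * x, 4 * x + 4 * y - 2) \<partial>lborel)"
  proof (intro ext nn_integral_cong)
    fix x y :: real
    have "sorted_coords x y = (4 * x, 4 * x + 4 * y - 2)" if "x \<le> y" "y \<le> 3/2 - x - y"
      using that by (auto simp: sorted_coords_def min_def max_def)
    moreover have "(4 * x, 4 * x + 4 * y - 2) \<in> kite \<longleftrightarrow> (x, y) \<in> balanced_projection \<and> x \<le> y \<and> y \<le> 3/2 - x - y"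
      by (auto simp: kite_def balanced_projection_def)
    ultimately show "?k x y * indicator {y. x \<le> y \<and> y \<le> 3/2 - x - y} y = indicator (kite \<inter> A) (4 * x, 4 * x + 4 * y - 2)"
      by (auto simp: indicator_def)
  qed
  also have "(\<integral>\<^sup>+x. \<integral>\<^sup>+y. indicator (kite \<inter> A) (4 * x, 4 * x + 4 * y - 2) \<partial>lborel \<partial>lborel)
      = (\<integral>\<^sup>+x. ennreal (1 / 4) * (\<integral>\<^sup>+y. indicator (kite \<inter> A) (4 * x, y) \<partial>lborel) \<partial>lborel)"
  proof (rule nn_integral_cong)
    fix x :: real
    have m: "(\<lambda>y. indicator (kite \<inter> A) (4 * x, 4 * x + 4 * y - 2) :: ennreal) \<in> borel_measurable borel"
      by (rule measurable_compose[OF borel_measurable_continuous_onI[of "\<lambda>y. (4 * x, 4 * x + 4 * y - 2)"]])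
        (auto intro!: continuous_intros)
    show "(\<integral>\<^sup>+y. indicator (kite \<inter> A) (4 * x, 4 * x + 4 * y - 2) \<partial>lborel)
        = ennreal (1 / 4) * (\<integral>\<^sup>+y. indicator (kite \<inter> A) (4 * x, y) \<partial>lborel)"
      by (subst nn_integral_quarter[OF m, of "1 / 2 - x"]) (simp add: field_simps)
  qed
  also have "\<dots> = ennreal (1 / 4) * (\<integral>\<^sup>+x. \<integral>\<^sup>+y. indicator (kite \<inter> A) (4 * x, y) \<partial>lborel \<partial>lborel)"
    by (rule nn_integral_cmult) (use measurable_compose[OF borel_measurable_continuous_onI[of "\<lambda>x. 4 * x"] g] in \<open>simp add: continuous_intros\<close>)
  also have "(\<integral>\<^sup>+x. \<integral>\<^sup>+y. indicator (kite \<inter> A) (4 * x, y) \<partial>lborel \<partial>lborel)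
      = ennreal (1 / 4) * (\<integral>\<^sup>+x. \<integral>\<^sup>+y. indicator (kite \<inter> A) (x, y) \<partial>lborel \<partial>lborel)"
    by (subst nn_integral_quarter[of _ 0]) (use measurable_compose[OF borel_measurable_continuous_onI[of "\<lambda>x. 4 * x"] g] in \<open>simp_all add: continuous_intros\<close>)
  also have "(\<integral>\<^sup>+x. \<integral>\<^sup>+y. indicator (kite \<inter> A) (x, y) \<partial>lborel \<partial>lborel) = emeasure lborel (kite \<inter> A)"
    using nn_integral_lborel_Pair(1)[of "indicator (kite \<inter> A)"] by simp
  finally have "(\<integral>\<^sup>+x. \<integral>\<^sup>+y. ?k x y \<partial>lborel \<partial>lborel) = (6 * (ennreal (1 / 4) * ennreal (1 / 4))) * emeasure lborel (kite \<inter> A)"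
    by (simp add: mult.assoc)
  also have "6 * (ennreal (1 / 4) * ennreal (1 / 4)) = ennreal 6 * (ennreal (1 / 4) * ennreal (1 / 4))" by simp
  also have "\<dots> = ennreal (3 / 8)" by (subst ennreal_mult'[symmetric], simp, subst ennreal_mult'[symmetric], simp_all)
  finally show ?thesis .
qed

lemma distr_balanced_die: "distr balanced_die borel coords = die"
proof (rule measure_eqI)
  fix A assume "A \<in> sets (distr balanced_die borel coords)"
  then have A [measurable]: "A \<in> sets borel" by simp
  have P: "emeasure lborel (balanced_projection \<inter> {z. sorted_coords (fst z) (snd z) \<in> B}) = ennreal (3 / 8) * emeasure lborel (kite \<inter> B)"
    if B: "B \<in> sets borel" for B
  proof -
    have S: "{z. sorted_coords (fst z) (snd z) \<in> B} \<in> sets borel"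
      using measurable_sets[OF sorted_measurable B] by (simp add: vimage_def)
    have "emeasure lborel (balanced_projection \<inter> {z. sorted_coords (fst z) (snd z) \<in> B})
        = (\<integral>\<^sup>+z. indicator (balanced_projection \<inter> {z. sorted_coords (fst z) (snd z) \<in> B}) z \<partial>lborel)"
      using S by simp
    also have "\<dots> = (\<integral>\<^sup>+x. \<integral>\<^sup>+y. indicator (balanced_projection \<inter> {z. sorted_coords (fst z) (snd z) \<in> B}) (x, y) \<partial>lborel \<partial>lborel)"
      using S by (intro nn_integral_lborel_Pair(1)) auto
    also have "\<dots> = (\<integral>\<^sup>+x. \<integral>\<^sup>+y. indicator balanced_projection (x, y) * indicator B (sorted_coords x y) \<partial>lborel \<partial>lborel)"
      by (intro nn_integral_cong) (auto simp: indicator_def)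
    finally show ?thesis using projection_to_kite[OF B] by simp
  qed
  have total: "emeasure lborel balanced_projection = ennreal (3 / 4)"
    using P[of UNIV] kite_measure by (simp add: ennreal_mult'[symmetric] flip: ennreal_numeral)
  have c: "coords (vector [x, y, 3/2 - x - y]) = sorted_coords x y" for x y
    by (simp add: coords_def sorted_coords_def vector_3)
  have v: "(\<lambda>(x, y). vector [x, y, 3/2 - x - y] :: real ^ 3) \<in> uniform_measure lborel balanced_projection \<rightarrow>\<^sub>M borel"
    using vector_measurable by (simp cong: measurable_cong_sets)
  have "emeasure (distr balanced_die borel coords) A
      = emeasure (uniform_measure lborel balanced_projection) {z. sorted_coords (fst z) (snd z) \<in> A}"
    unfolding balanced_die_def
    using emeasure_distr[OF measurable_comp[OF v coords_measurable] A]
    by (subst distr_distr[OF coords_measurable v]) (simp add: comp_def c case_prod_unfold vimage_def)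
  also have "\<dots> = ennreal (3 / 8) * emeasure lborel (kite \<inter> A) / ennreal (3 / 4)"
    using measurable_sets[OF sorted_measurable A] by (simp add: P[OF A] total vimage_def)
  also have "\<dots> = emeasure lborel (kite \<inter> A) / 2"
  proof -
    have "emeasure lborel (kite \<inter> A) \<le> 2" using emeasure_mono[of "kite \<inter> A" kite lborel] kite_measure by simp
    then obtain m where "emeasure lborel (kite \<inter> A) = ennreal m" "0 \<le> m"
      by (cases "emeasure lborel (kite \<inter> A)") (auto simp: top_unique)
    moreover have "ennreal (3 / 8) * ennreal m / ennreal (3 / 4) = ennreal (m / 2)"
      using \<open>0 \<le> m\<close> by (subst ennreal_mult'[symmetric]) (simp_all add: divide_ennreal del: ennreal_divide_numeral)
    moreover have "ennreal m / 2 = ennreal (m / 2)" using \<open>0 \<le> m\<close> by (rule ennreal_divide_numeral)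
    ultimately show ?thesis by simp
  qed
  also have "\<dots> = emeasure die A" by (simp add: die_def kite_measure)
  finally show "emeasure (distr balanced_die borel coords) A = emeasure die A" .
qed simp

section \<open>Dominance and tournament classes\<close>

text \<open>
  Stating that sums of an arbitrary function agree on the sorted and the unsorted entries spares the
  permutation.
\<close>
lemma sorted3_cases:
  fixes x y z :: real
  obtains p q r where "p \<le> q" "q \<le> r" "p = min x (min y z)" "r = max x (max y z)" "q = x + y + z - p - r"
    and "\<And>g :: real \<Rightarrow> real. g x + g y + g z = g p + g q + g r"
proof -
  consider "x \<le> y" "y \<le> z" | "x \<le> z" "z \<le> y" | "y \<le> x" "x \<le> z" | "y \<le> z" "z \<le> x" | "z \<le> x" "x \<le> y" | "z \<le> y" "y \<le> x"
    by linarith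
  then show ?thesis
  proof cases
    case 1 then show ?thesis by (intro that[of x y z]) (simp_all add: min_def max_def)
  next
    case 2 then show ?thesis by (intro that[of x z y]) (simp_all add: min_def max_def)
  next
    case 3 then show ?thesis by (intro that[of y x z]) (simp_all add: min_def max_def)
  next
    case 4 then show ?thesis by (intro that[of y z x]) (simp_all add: min_def max_def)
  next
    case 5 then show ?thesis by (intro that[of z x y]) (simp_all add: min_def max_def)
  next
    case 6 then show ?thesis by (intro that[of z y x]) (simp_all add: min_def max_def)
  qed
qed

text \<open>
  The differences of sorted entries sum to zero, so one or two of them are positive. Two positive ones force
  five of the nine comparisons in the same direction, by monotonicity; for instance \<open>q > v\<close> and
  \<open>r > w\<close> also give \<open>q > u\<close>, \<open>r > u\<close> and \<open>r > v\<close>.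
\<close>
lemma majority:
  fixes p q r u v w :: real
  assumes "p \<le> q" "q \<le> r" "u \<le> v" "v \<le> w" and sum: "p + q + r = u + v + w"
    and ne: "p \<noteq> u" "q \<noteq> v" "r \<noteq> w"
  shows "sgn (p - u) + sgn (q - v) + sgn (r - w) \<in> {1, - 1}"
    and "0 < (sgn (p - u) + sgn (p - v) + sgn (p - w)) + (sgn (q - u) + sgn (q - v) + sgn (q - w))
          + (sgn (r - u) + sgn (r - v) + sgn (r - w))
        \<longleftrightarrow> sgn (p - u) + sgn (q - v) + sgn (r - w) = 1"
proof -
  have "p < u \<or> u < p" "q < v \<or> v < q" "r < w \<or> w < r" using ne by auto
  then consider "u < p" "v < q" "r < w" | "u < p" "q < v" "w < r" | "p < u" "v < q" "w < r"
    | "p < u" "q < v" "w < r" | "p < u" "v < q" "r < w" | "u < p" "q < v" "r < w"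
    using sum by linarith
  note cases = this
  show "sgn (p - u) + sgn (q - v) + sgn (r - w) \<in> {1, - 1}"
    using cases by cases auto
  have b: "- 1 \<le> sgn x" "sgn x \<le> 1" for x :: real by (auto simp: sgn_if)
  show "0 < (sgn (p - u) + sgn (p - v) + sgn (p - w)) + (sgn (q - u) + sgn (q - v) + sgn (q - w))
          + (sgn (r - u) + sgn (r - v) + sgn (r - w))
        \<longleftrightarrow> sgn (p - u) + sgn (q - v) + sgn (r - w) = 1"
    using cases assms(1-4) b[of "p - v"] b[of "p - w"] b[of "q - u"] b[of "q - w"] b[of "r - u"] b[of "r - v"]
    by cases (simp_all add: sgn_pos sgn_neg)
qed

lemma dominates_beat:
  assumes a: "a $ 1 + a $ 2 + a $ 3 = 3 / 2" and b: "b $ 1 + b $ 2 + b $ 3 = 3 / 2"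
    and ne: "fst (coords a) \<noteq> fst (coords b)" "mid (coords a) \<noteq> mid (coords b)" "snd (coords a) \<noteq> snd (coords b)"
  shows "beat (coords a) (coords b) \<in> {1, - 1}" "dominates a b \<longleftrightarrow> beat (coords a) (coords b) = 1"
proof -
  obtain p q r where p: "p \<le> q" "q \<le> r" "p = min (a $ 1) (min (a $ 2) (a $ 3))" "r = max (a $ 1) (max (a $ 2) (a $ 3))"
      "q = a $ 1 + a $ 2 + a $ 3 - p - r"
    and A: "\<And>g :: real \<Rightarrow> real. g (a $ 1) + g (a $ 2) + g (a $ 3) = g p + g q + g r"
    by (rule sorted3_cases[where x = "a $ 1" and y = "a $ 2" and z = "a $ 3"]) (rule that)
  obtain u v w where u: "u \<le> v" "v \<le> w" "u = min (b $ 1) (min (b $ 2) (b $ 3))" "w = max (b $ 1) (max (b $ 2) (b $ 3))"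
      "v = b $ 1 + b $ 2 + b $ 3 - u - w"
    and B: "\<And>g :: real \<Rightarrow> real. g (b $ 1) + g (b $ 2) + g (b $ 3) = g u + g v + g w"
    by (rule sorted3_cases[where x = "b $ 1" and y = "b $ 2" and z = "b $ 3"]) (rule that)
  have qv: "q = 3 / 2 - p - r" "v = 3 / 2 - u - w" using p(5) u(5) a b by simp_all
  have coords: "coords a = (4 * p, 4 - 4 * r)" "coords b = (4 * u, 4 - 4 * w)"
    by (simp_all add: coords_def p(3,4) u(3,4))
  have "sgn (4 * x - 4 * y) = sgn (x - y)" for x y :: real by (auto simp: sgn_if)
  from this[of p u] this[of q v] this[of r w]
  have beat: "beat (coords a) (coords b) = sgn (p - u) + sgn (q - v) + sgn (r - w)"
    by (simp add: beat_def mid_def coords qv algebra_simps)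
  have ne': "p \<noteq> u" "q \<noteq> v" "r \<noteq> w" using ne by (auto simp: coords mid_def qv)
  have sum: "p + q + r = u + v + w" by (simp add: qv)
  note m = majority[OF p(1,2) u(1,2) sum ne']
  show "beat (coords a) (coords b) \<in> {1, - 1}" unfolding beat by (rule m(1))
  have "(\<Sum>i\<in>UNIV. \<Sum>j\<in>UNIV. sgn (a $ i - b $ j))
      = (sgn (p - u) + sgn (p - v) + sgn (p - w)) + (sgn (q - u) + sgn (q - v) + sgn (q - w)) + (sgn (r - u) + sgn (r - v) + sgn (r - w))"
    unfolding sum_3 using A[of "\<lambda>x. sgn (x - b $ 1) + sgn (x - b $ 2) + sgn (x - b $ 3)"]
      B[of "\<lambda>y. sgn (p - y)"] B[of "\<lambda>y. sgn (q - y)"] B[of "\<lambda>y. sgn (r - y)"] by simp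
  then show "dominates a b \<longleftrightarrow> beat (coords a) (coords b) = 1"
    unfolding dominates_def beat using m(2) by simp
qed

lemma sgn_diff: "sgn (x - y) = - sgn (y - x :: real)"
  by (simp add: sgn_if)

lemma beat_antisym: "beat b a = - beat a b"
  unfolding beat_def using sgn_diff[of "fst b" "fst a"] sgn_diff[of "mid b" "mid a"] sgn_diff[of "snd a" "snd b"] by linarith

lemma dominates_irrefl: "\<not> dominates a a"
proof -
  have "sgn (x - x) + sgn (x - y) + sgn (x - z) + (sgn (y - x) + sgn (y - y) + sgn (y - z))
      + (sgn (z - x) + sgn (z - y) + sgn (z - z)) = 0" for x y z :: real
    using sgn_diff[of x y] sgn_diff[of x z] sgn_diff[of y z] by (simp only: diff_self sgn_zero)
  then show ?thesis unfolding dominates_def sum_3 by (simp only: less_irrefl not_False_eq_True)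
qed

lemma four_set:
  fixes w x y z :: nat
  shows "distinct [w, x, y, z] \<and> {..<4} = {w, x, y, z} \<and> P \<longleftrightarrow>
    w \<in> {0, 1, 2, 3} \<and> x \<in> {0, 1, 2, 3} \<and> y \<in> {0, 1, 2, 3} \<and> z \<in> {0, 1, 2, 3} \<and> distinct [w, x, y, z] \<and> P"
proof -
  have four: "{..<4 :: nat} = {0, 1, 2, 3}" by auto
  have 1: "{..<4} = {w, x, y, z}" if "{w, x, y, z} \<subseteq> {..<4}" "distinct [w, x, y, z]"
    using card_subset_eq[of "{..<4}" "{w, x, y, z}"] that distinct_card[of "[w, x, y, z]"] by simp
  have 2: "w \<in> {..<4} \<and> x \<in> {..<4} \<and> y \<in> {..<4} \<and> z \<in> {..<4}" if "{..<4} = {w, x, y, z}"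
    unfolding that by simp
  show ?thesis unfolding four[symmetric] using 1 2 by blast
qed

lemma ex_four:
  fixes P :: "nat \<Rightarrow> nat \<Rightarrow> nat \<Rightarrow> nat \<Rightarrow> bool"
  shows "(\<exists>w x y z. distinct [w, x, y, z] \<and> {..<4} = {w, x, y, z} \<and> P w x y z) \<longleftrightarrow>
    (\<exists>w\<in>{0, 1, 2, 3}. \<exists>x\<in>{0, 1, 2, 3}. \<exists>y\<in>{0, 1, 2, 3}. \<exists>z\<in>{0, 1, 2, 3}. distinct [w, x, y, z] \<and> P w x y z)"
  unfolding four_set by blast

text \<open>
  Each class has one score sequence, and the four statistics are linear in the class indicators: a 4-cycle
  product is negative for exactly the cycles with an odd number of reversed edges, and the statistics at a
  vertex depend on its score alone. The proof runs through the 64 tournaments.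
\<close>
lemma tournament_classes:
  fixes R :: "nat \<Rightarrow> nat \<Rightarrow> bool" and s :: "nat \<Rightarrow> nat \<Rightarrow> real"
  assumes R: "\<And>i. i < 4 \<Longrightarrow> \<not> R i i" "\<And>i j. i < 4 \<Longrightarrow> j < 4 \<Longrightarrow> i \<noteq> j \<Longrightarrow> R j i \<longleftrightarrow> \<not> R i j"
    and s: "\<And>i j. s i j = (if R i j then 1 else - 1)"
  defines "t \<equiv> of_bool (transitive_chain {..<4} R)" and "c \<equiv> of_bool (intransitive_4_cycle {..<4} R)"
    and "w \<equiv> of_bool (winner_3_cycle {..<4} R)" and "l \<equiv> of_bool (loser_3_cycle {..<4} R)"
  shows "t + c + w + l = (1 :: real)"
    and "s 0 1 * s 1 2 * s 2 3 * s 3 0 + s 0 1 * s 1 3 * s 3 2 * s 2 0 + s 0 2 * s 2 1 * s 1 3 * s 3 0 = t + c - 3 * (w + l)"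
    and "s 0 1 * s 0 2 * s 0 3 + s 1 0 * s 1 2 * s 1 3 + s 2 0 * s 2 1 * s 2 3 + s 3 0 * s 3 1 * s 3 2 = 4 * w - 4 * l"
    and "(s 0 1 * s 0 2 + s 0 1 * s 0 3 + s 0 2 * s 0 3) + (s 1 0 * s 1 2 + s 1 0 * s 1 3 + s 1 2 * s 1 3)
      + (s 2 0 * s 2 1 + s 2 0 * s 2 3 + s 2 1 * s 2 3) + (s 3 0 * s 3 1 + s 3 0 * s 3 2 + s 3 1 * s 3 2) = 4 * t - 4 * c"
proof -
  have T: "tournament_on {..<4} R" using R unfolding tournament_on_def by blast
  have D: "\<not> R 0 0" "\<not> R 1 1" "\<not> R 2 2" "\<not> R 3 3" using R(1) by auto
  have A: "R 1 0 = (\<not> R 0 1)" "R 2 0 = (\<not> R 0 2)" "R 3 0 = (\<not> R 0 3)" "R 2 1 = (\<not> R 1 2)" "R 3 1 = (\<not> R 1 3)" "R 3 2 = (\<not> R 2 3)"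
    using R(2)[of 0 1] R(2)[of 0 2] R(2)[of 0 3] R(2)[of 1 2] R(2)[of 1 3] R(2)[of 2 3] by auto
  note classes = transitive_chain_def[of "{..<4}" R] intransitive_4_cycle_def[of "{..<4}" R]
    winner_3_cycle_def[of "{..<4}" R] loser_3_cycle_def[of "{..<4}" R]
  note [simp del] = One_nat_def
  note [simp] = A T
  note cl = classes[unfolded ex_four, simplified]
  have "t + c + w + l = (1 :: real) \<and>
    s 0 1 * s 1 2 * s 2 3 * s 3 0 + s 0 1 * s 1 3 * s 3 2 * s 2 0 + s 0 2 * s 2 1 * s 1 3 * s 3 0 = t + c - 3 * (w + l) \<and>
    s 0 1 * s 0 2 * s 0 3 + s 1 0 * s 1 2 * s 1 3 + s 2 0 * s 2 1 * s 2 3 + s 3 0 * s 3 1 * s 3 2 = 4 * w - 4 * l \<and>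
    (s 0 1 * s 0 2 + s 0 1 * s 0 3 + s 0 2 * s 0 3) + (s 1 0 * s 1 2 + s 1 0 * s 1 3 + s 1 2 * s 1 3)
      + (s 2 0 * s 2 1 + s 2 0 * s 2 3 + s 2 1 * s 2 3) + (s 3 0 * s 3 1 + s 3 0 * s 3 2 + s 3 1 * s 3 2) = 4 * t - 4 * c"
    unfolding t_def c_def w_def l_def s A using cl
    by (cases "R 0 1"; cases "R 0 2"; cases "R 0 3"; cases "R 1 2"; cases "R 1 3"; cases "R 2 3"; simp only: simp_thms if_True if_False of_bool_eq A T; simp)
  then show "t + c + w + l = (1 :: real)"
    and "s 0 1 * s 1 2 * s 2 3 * s 3 0 + s 0 1 * s 1 3 * s 3 2 * s 2 0 + s 0 2 * s 2 1 * s 1 3 * s 3 0 = t + c - 3 * (w + l)"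
    and "s 0 1 * s 0 2 * s 0 3 + s 1 0 * s 1 2 * s 1 3 + s 2 0 * s 2 1 * s 2 3 + s 3 0 * s 3 1 * s 3 2 = 4 * w - 4 * l"
    and "(s 0 1 * s 0 2 + s 0 1 * s 0 3 + s 0 2 * s 0 3) + (s 1 0 * s 1 2 + s 1 0 * s 1 3 + s 1 2 * s 1 3)
      + (s 2 0 * s 2 1 + s 2 0 * s 2 3 + s 2 1 * s 2 3) + (s 3 0 * s 3 1 + s 3 0 * s 3 2 + s 3 1 * s 3 2) = 4 * t - 4 * c"
    by auto
qed

section \<open>Four independent dice\<close>

interpretation dice: product_sigma_finite "\<lambda>_ :: nat. die" by standard

lemma balanced_sum: "AE a in balanced_die. a $ 1 + a $ 2 + a $ 3 = 3 / 2"
proof -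
  have v: "(\<lambda>(x, y). vector [x, y, 3/2 - x - y] :: real ^ 3) \<in> uniform_measure lborel balanced_projection \<rightarrow>\<^sub>M borel"
    using vector_measurable by (simp cong: measurable_cong_sets)
  have [measurable]: "(\<lambda>a :: real ^ 3. a $ i) \<in> borel_measurable borel" for i
    by (intro borel_measurable_continuous_onI continuous_intros)
  show ?thesis
    unfolding balanced_die_def by (subst AE_distr_iff[OF v]) (auto simp: vector_3)
qed

lemma integrate_out:
  fixes G :: "(nat \<Rightarrow> real \<times> real) \<Rightarrow> real \<times> real \<Rightarrow> real"
  assumes I: "finite I" "i \<notin> I" and B: "\<And>x a. \<bar>G x a\<bar> \<le> B"
    and G: "(\<lambda>x. G x (x i)) \<in> borel_measurable (PiM (insert i I) (\<lambda>_. die))"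
    and indep: "\<And>x a. G (x(i := a)) a = G x a"
  shows "(\<integral>x. G x (x i) \<partial>PiM (insert i I) (\<lambda>_. die)) = (\<integral>x. \<integral>a. G x a \<partial>die \<partial>PiM I (\<lambda>_. die))"
proof -
  interpret P: prob_space "PiM (insert i I) (\<lambda>_. die)" by (rule prob_space_PiM) (rule die_props)
  have "integrable (PiM (insert i I) (\<lambda>_. die)) (\<lambda>x. G x (x i))"
    by (rule P.integrable_const_bound[OF _ G, of B]) (use B in auto)
  from dice.product_integral_insert[OF I this]
  show ?thesis by (simp add: indep)
qed

lemma iterated_die_integral:
  fixes i j k l :: nat
    and G :: "real \<times> real \<Rightarrow> real \<times> real \<Rightarrow> real \<times> real \<Rightarrow> real \<times> real \<Rightarrow> real"
  assumes d: "distinct [i, j, k, l]"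
    and G: "(\<lambda>z. G (fst z) (fst (snd z)) (fst (snd (snd z))) (snd (snd (snd z)))) \<in> borel_measurable (borel \<Otimes>\<^sub>M borel \<Otimes>\<^sub>M borel \<Otimes>\<^sub>M borel)"
    and B: "\<And>a b c d. \<bar>G a b c d\<bar> \<le> B"
  shows "(\<integral>x. G (x i) (x j) (x k) (x l) \<partial>PiM {i, j, k, l} (\<lambda>_. die)) = (\<integral>a. \<integral>b. \<integral>c. \<integral>d. G a b c d \<partial>die \<partial>die \<partial>die \<partial>die)"
proof -
  have Gm [measurable]: "(\<lambda>x. G (u x) (v x) (w x) (y x)) \<in> borel_measurable N"
    if "u \<in> borel_measurable N" "v \<in> borel_measurable N" "w \<in> borel_measurable N" "y \<in> borel_measurable N" for u v w y and N :: "'c measure"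
    using measurable_compose[OF measurable_Pair[OF that(1) measurable_Pair[OF that(2) measurable_Pair[OF that(3,4)]]] G] by simp
  have comp: "(\<lambda>x. x n) \<in> borel_measurable (PiM I (\<lambda>_. die))" if "n \<in> I" for n :: nat and I
    by (subst measurable_cong_sets[OF refl die_props(2)[symmetric]]) (rule measurable_component_singleton[OF that])
  define G3 where "G3 a b c = (\<integral>d. G a b c d \<partial>die)" for a b c
  define G2 where "G2 a b = (\<integral>c. G3 a b c \<partial>die)" for a b
  define G1 where "G1 a = (\<integral>b. G2 a b \<partial>die)" for a
  have G3m [measurable]: "(\<lambda>x. G3 (u x) (v x) (w x)) \<in> borel_measurable N"
    if [measurable]: "u \<in> borel_measurable N" "v \<in> borel_measurable N" "w \<in> borel_measurable N" for u v w and N :: "'c measure"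
    unfolding G3_def by measurable
  have G2m [measurable]: "(\<lambda>x. G2 (u x) (v x)) \<in> borel_measurable N"
    if [measurable]: "u \<in> borel_measurable N" "v \<in> borel_measurable N" for u v and N :: "'c measure"
    unfolding G2_def by measurable
  have G1m [measurable]: "(\<lambda>x. G1 (u x)) \<in> borel_measurable N"
    if [measurable]: "u \<in> borel_measurable N" for u and N :: "'c measure"
    unfolding G1_def by measurable
  have B3: "\<bar>G3 a b c\<bar> \<le> B" for a b c unfolding G3_def by (rule die.expectation_bound) (rule B)
  have B2: "\<bar>G2 a b\<bar> \<le> B" for a b unfolding G2_def by (rule die.expectation_bound) (rule B3)
  have B1: "\<bar>G1 a\<bar> \<le> B" for a unfolding G1_def by (rule die.expectation_bound) (rule B2)
  have "(\<integral>x. G (x i) (x j) (x k) (x l) \<partial>PiM (insert l {i, j, k}) (\<lambda>_. die)) = (\<integral>x. \<integral>d. G (x i) (x j) (x k) d \<partial>die \<partial>PiM {i, j, k} (\<lambda>_. die))"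
    by (rule integrate_out[where G = "\<lambda>x d. G (x i) (x j) (x k) d", OF _ _ B]) (use d in \<open>auto intro!: Gm comp\<close>)
  also have "\<dots> = (\<integral>x. G3 (x i) (x j) (x k) \<partial>PiM (insert k {i, j}) (\<lambda>_. die))"
    by (simp add: G3_def insert_commute)
  also have "\<dots> = (\<integral>x. \<integral>c. G3 (x i) (x j) c \<partial>die \<partial>PiM {i, j} (\<lambda>_. die))"
    by (rule integrate_out[where G = "\<lambda>x c. G3 (x i) (x j) c", OF _ _ B3]) (use d in \<open>auto intro!: G3m comp\<close>)
  also have "\<dots> = (\<integral>x. G2 (x i) (x j) \<partial>PiM (insert j {i}) (\<lambda>_. die))"
    by (simp add: G2_def insert_commute)
  also have "\<dots> = (\<integral>x. \<integral>b. G2 (x i) b \<partial>die \<partial>PiM {i} (\<lambda>_. die))"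
    by (rule integrate_out[where G = "\<lambda>x b. G2 (x i) b", OF _ _ B2]) (use d in \<open>auto intro!: G2m comp\<close>)
  also have "\<dots> = (\<integral>x. G1 (x i) \<partial>PiM (insert i {}) (\<lambda>_. die))"
    by (simp add: G1_def)
  also have "\<dots> = (\<integral>a. G1 a \<partial>die)"
    by (subst integrate_out[where G = "\<lambda>x a. G1 a", OF _ _ B1]) (use d in \<open>auto intro!: G1m comp simp: PiM_empty\<close>)
  finally show ?thesis
    by (simp add: G1_def G2_def G3_def insert_commute)
qed

locale four_dice = prob_space +
  fixes X :: "nat \<Rightarrow> 'a \<Rightarrow> real ^ 3"
  assumes indep: "indep_vars (\<lambda>_. borel) X {..<4}"
    and distrX: "\<And>i. i < 4 \<Longrightarrow> distr M borel (X i) = balanced_die"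
begin

lemma X_measurable [measurable]: "i < 4 \<Longrightarrow> X i \<in> borel_measurable M"
  using indep by (auto simp: indep_vars_def2)

definition Y :: "nat \<Rightarrow> 'a \<Rightarrow> real \<times> real" where "Y i \<omega> = coords (X i \<omega>)"

lemma Y_measurable [measurable]: "i < 4 \<Longrightarrow> Y i \<in> borel_measurable M"
  unfolding Y_def[abs_def] by measurable

lemma distr_Y: "i < 4 \<Longrightarrow> distr M borel (Y i) = die"
  using distr_distr[OF coords_measurable X_measurable[of i]] distrX[of i] distr_balanced_die
  by (simp add: Y_def[abs_def] comp_def)

lemma indep_Y: "indep_vars (\<lambda>_. borel) Y {..<4}"
  unfolding Y_def[abs_def] by (rule indep_vars_compose2[OF indep]) measurable

lemma expectation_Y:
  fixes G :: "real \<times> real \<Rightarrow> real \<times> real \<Rightarrow> real \<times> real \<Rightarrow> real \<times> real \<Rightarrow> real"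
  assumes d: "distinct [i, j, k, l]" "{i, j, k, l} \<subseteq> {..<4}"
    and G: "(\<lambda>z. G (fst z) (fst (snd z)) (fst (snd (snd z))) (snd (snd (snd z)))) \<in> borel_measurable (borel \<Otimes>\<^sub>M borel \<Otimes>\<^sub>M borel \<Otimes>\<^sub>M borel)"
    and B: "\<And>a b c d. \<bar>G a b c d\<bar> \<le> B"
  shows "expectation (\<lambda>\<omega>. G (Y i \<omega>) (Y j \<omega>) (Y k \<omega>) (Y l \<omega>)) = (\<integral>a. \<integral>b. \<integral>c. \<integral>d. G a b c d \<partial>die \<partial>die \<partial>die \<partial>die)"
proof -
  let ?I = "{i, j, k, l}"
  have I: "?I = {..<4}"
    using card_subset_eq[of "{..<4}" ?I] d distinct_card[of "[i, j, k, l]"] by simp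
  have "distr M (PiM ?I (\<lambda>_. borel)) (\<lambda>\<omega>. \<lambda>n\<in>?I. Y n \<omega>) = PiM ?I (\<lambda>n. distr M borel (Y n))"
    unfolding I using indep_Y by (subst (asm) indep_vars_iff_distr_eq_PiM') (auto simp: lessThan_empty_iff)
  also have "\<dots> = PiM ?I (\<lambda>_. die)"
    by (rule PiM_cong) (use d(2) distr_Y in auto)
  finally have joint: "distr M (PiM ?I (\<lambda>_. borel)) (\<lambda>\<omega>. \<lambda>n\<in>?I. Y n \<omega>) = PiM ?I (\<lambda>_. die)" .
  have Gm: "(\<lambda>x. G (x i) (x j) (x k) (x l)) \<in> borel_measurable (PiM ?I (\<lambda>_. borel))"
  proof -
    have c: "(\<lambda>x. x n) \<in> borel_measurable (PiM ?I (\<lambda>_. borel))" if "n \<in> ?I" for n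
      by (rule measurable_component_singleton[OF that])
    have "(\<lambda>x. (x i, x j, x k, x l)) \<in> PiM ?I (\<lambda>_. borel) \<rightarrow>\<^sub>M borel \<Otimes>\<^sub>M borel \<Otimes>\<^sub>M borel \<Otimes>\<^sub>M borel"
      by (intro measurable_Pair c) auto
    from measurable_compose[OF this G] show ?thesis by simp
  qed
  have Ym: "(\<lambda>\<omega>. \<lambda>n\<in>?I. Y n \<omega>) \<in> M \<rightarrow>\<^sub>M PiM ?I (\<lambda>_. borel)"
    by (rule measurable_restrict) (use d(2) in auto)
  have "(\<integral>x. G (x i) (x j) (x k) (x l) \<partial>PiM ?I (\<lambda>_. die)) = expectation (\<lambda>\<omega>. G (Y i \<omega>) (Y j \<omega>) (Y k \<omega>) (Y l \<omega>))"
    unfolding joint[symmetric] by (subst integral_distr[OF Ym Gm]) simp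
  then show ?thesis using iterated_die_integral[OF d(1) G B] by simp
qed

definition outcome :: "nat \<Rightarrow> nat \<Rightarrow> 'a \<Rightarrow> real" where "outcome i j \<omega> = beat (Y i \<omega>) (Y j \<omega>)"

lemma outcome_measurable [measurable]: "i < 4 \<Longrightarrow> j < 4 \<Longrightarrow> outcome i j \<in> borel_measurable M"
  unfolding outcome_def[abs_def] by measurable

lemma beat_products:
  "\<bar>beat a b * beat c d\<bar> \<le> 9" "\<bar>beat a b * beat c d * beat e f\<bar> \<le> 27" "\<bar>beat a b * beat c d * beat e f * beat g h\<bar> \<le> 81"
proof -
  show 1: "\<bar>beat a b * beat c d\<bar> \<le> 9" for a b c d
    using mult_mono[OF beat_bound[of a b] beat_bound[of c d]] by (simp add: abs_mult)
  show 2: "\<bar>beat a b * beat c d * beat e f\<bar> \<le> 27" for a b c d e f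
    using mult_mono[OF 1[of a b c d] beat_bound[of e f]] by (simp add: abs_mult)
  show "\<bar>beat a b * beat c d * beat e f * beat g h\<bar> \<le> 81"
    using mult_mono[OF 2[of a b c d e f] beat_bound[of g h]] by (simp add: abs_mult)
qed

text \<open>
  For fixed dice \<open>i\<close> and \<open>k\<close>, opposite in the cycle, the other two dice contribute
  the factors \<open>two_step a c\<close> and \<open>two_step c a\<close>.
\<close>
lemma expectation_cycle:
  assumes d: "distinct [i, j, k, l]" "{i, j, k, l} \<subseteq> {..<4}"
  shows "expectation (\<lambda>\<omega>. outcome i j \<omega> * outcome j k \<omega> * outcome k l \<omega> * outcome l i \<omega>) = 8404171 / 96768000"
proof -
  have "expectation (\<lambda>\<omega>. outcome i j \<omega> * outcome j k \<omega> * outcome k l \<omega> * outcome l i \<omega>)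
      = (\<integral>a. \<integral>c. \<integral>b. \<integral>d. beat a b * beat b c * beat c d * beat d a \<partial>die \<partial>die \<partial>die \<partial>die)"
    unfolding outcome_def
    by (rule expectation_Y[of i k j l "\<lambda>a c b d. beat a b * beat b c * beat c d * beat d a" 81])
      (use d beat_products(3) in \<open>auto, measurable\<close>)
  also have "\<dots> = (\<integral>a. \<integral>c. two_step a c * two_step c a \<partial>die \<partial>die)"
  proof -
    have "(\<integral>d. beat a b * beat b c * beat c d * beat d a \<partial>die) = (beat a b * beat b c) * two_step c a" for a b c
      unfolding two_step_def by (subst integral_mult_right_zero[symmetric]) (simp add: mult.assoc)
    moreover have "(\<integral>b. (beat a b * beat b c) * two_step c a \<partial>die) = two_step a c * two_step c a" for a c
      unfolding two_step_def[of a c] by (rule integral_mult_left_zero)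
    ultimately show ?thesis by (simp only:)
  qed
  finally show ?thesis by (simp add: two_step_cycle_value)
qed

lemma expectation_cube:
  assumes d: "distinct [i, j, k, l]" "{i, j, k, l} \<subseteq> {..<4}"
  shows "expectation (\<lambda>\<omega>. outcome i j \<omega> * outcome i k \<omega> * outcome i l \<omega>) = 0"
proof -
  have "expectation (\<lambda>\<omega>. outcome i j \<omega> * outcome i k \<omega> * outcome i l \<omega>)
      = (\<integral>a. \<integral>b. \<integral>c. \<integral>d. beat a b * beat a c * beat a d \<partial>die \<partial>die \<partial>die \<partial>die)"
    unfolding outcome_def
    by (rule expectation_Y[of i j k l "\<lambda>a b c d. beat a b * beat a c * beat a d" 27])
      (use d beat_products(2) in \<open>auto, measurable\<close>)
  also have "\<dots> = (\<integral>a. score a ^ 3 \<partial>die)"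
    by (simp add: score_def power3_eq_cube mult.assoc)
  finally show ?thesis by (simp add: score_cube)
qed

lemma expectation_square:
  assumes d: "distinct [i, j, k, l]" "{i, j, k, l} \<subseteq> {..<4}"
  shows "expectation (\<lambda>\<omega>. outcome i j \<omega> * outcome i k \<omega>) = 13 / 960"
proof -
  have "expectation (\<lambda>\<omega>. outcome i j \<omega> * outcome i k \<omega>)
      = (\<integral>a. \<integral>b. \<integral>c. \<integral>d. beat a b * beat a c \<partial>die \<partial>die \<partial>die \<partial>die)"
    unfolding outcome_def
    by (rule expectation_Y[of i j k l "\<lambda>a b c d. beat a b * beat a c" 9])
      (use d beat_products(1) in \<open>auto, measurable\<close>)
  also have "\<dots> = (\<integral>a. score a ^ 2 \<partial>die)"
    using die.prob_space by (simp add: score_def power2_eq_square mult.assoc)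
  finally show ?thesis by (simp add: score_square)
qed

lemma other_two: "i < 4 \<Longrightarrow> j < 4 \<Longrightarrow> i \<noteq> j \<Longrightarrow> \<exists>k l. distinct [i, j, k, l] \<and> {i, j, k, l} \<subseteq> {..<4 :: nat}"
proof -
  assume "i < 4" "j < 4" "i \<noteq> j"
  then have "card ({..<4} - {i, j}) = 2" by (subst card_Diff_subset) auto
  then obtain k l where "{..<4} - {i, j} = {k, l}" "k \<noteq> l" by (auto simp: card_2_iff)
  then have "k \<in> {..<4} - {i, j}" "l \<in> {..<4} - {i, j}" "k \<noteq> l" by auto
  with \<open>i < 4\<close> \<open>j < 4\<close> \<open>i \<noteq> j\<close> show ?thesis by (intro exI[of _ k] exI[of _ l]) auto
qed

lemma coord_distinct:
  assumes p: "chart p" and f [measurable]: "f \<in> borel_measurable borel" "\<And>x y. f (p x y) = x" and ij: "i < 4" "j < 4" "i \<noteq> j"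
  shows "AE \<omega> in M. f (Y i \<omega>) \<noteq> f (Y j \<omega>)"
proof -
  obtain k l where kl: "distinct [i, j, k, l]" "{i, j, k, l} \<subseteq> {..<4}" using other_two[OF ij] by blast
  have fm [measurable]: "(\<lambda>x. f (u x)) \<in> borel_measurable N" if "u \<in> borel_measurable N" for u and N :: "'c measure"
    by (rule measurable_compose[OF that f(1)])
  let ?g = "\<lambda>a b. of_bool (f a = f b) :: real"
  have gm: "(\<lambda>x. ?g (u x) (v x)) \<in> borel_measurable N" if [measurable]: "u \<in> borel_measurable N" "v \<in> borel_measurable N" for u v and N :: "'c measure"
    unfolding of_bool_def by measurable
  have "expectation (\<lambda>\<omega>. ?g (Y i \<omega>) (Y j \<omega>)) = (\<integral>a. \<integral>b. \<integral>c. \<integral>d. ?g a b \<partial>die \<partial>die \<partial>die \<partial>die)"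
    by (rule expectation_Y[of i j k l "\<lambda>a b c d. ?g a b" 1]) (use kl in \<open>auto intro!: gm\<close>)
  also have "\<dots> = (\<integral>a. \<integral>b. ?g a b \<partial>die \<partial>die)" using die.prob_space by simp
  also have "\<dots> = (\<integral>a. 0 \<partial>die)"
  proof (rule Bochner_Integration.integral_cong[OF refl], rule integral_eq_zero_AE)
    show "AE b in die. ?g a b = 0" for a
      using coord_null[OF p f, of "f a"] by eventually_elim auto
  qed
  finally have 0: "expectation (\<lambda>\<omega>. ?g (Y i \<omega>) (Y j \<omega>)) = 0" by simp
  have int: "integrable M (\<lambda>\<omega>. ?g (Y i \<omega>) (Y j \<omega>))"
    by (rule integrable_const_bound[of _ 1]) (use ij in \<open>auto intro!: gm\<close>)
  have "AE \<omega> in M. ?g (Y i \<omega>) (Y j \<omega>) = 0"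
    using integral_nonneg_eq_0_iff_AE[OF int] 0 by simp
  then show ?thesis by eventually_elim auto
qed

lemma AE_sum: "i < 4 \<Longrightarrow> AE \<omega> in M. X i \<omega> $ 1 + X i \<omega> $ 2 + X i \<omega> $ 3 = 3 / 2"
proof -
  assume i: "i < 4"
  have [measurable]: "(\<lambda>a :: real ^ 3. a $ n) \<in> borel_measurable borel" for n
    by (intro borel_measurable_continuous_onI continuous_intros)
  show ?thesis
    using balanced_sum unfolding distrX[OF i, symmetric] by (subst (asm) AE_distr_iff[OF X_measurable[OF i]]) auto
qed

end

section \<open>Class probabilities\<close>

lemma class_equations:
  fixes t c w l :: real
  assumes "t + c + w + l = 1" "3 * (8404171 / 96768000) = t + c - 3 * (w + l)" "0 = 4 * w - 4 * l" "12 * (13 / 960) = 4 * t - 4 * c"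
  shows "t = 110413771 / 258048000" "c = 99930571 / 258048000" "w = 23851829 / 258048000" "l = 23851829 / 258048000"
  using assms by simp_all

context four_dice
begin

definition beats :: "'a \<Rightarrow> nat \<Rightarrow> nat \<Rightarrow> bool" where "beats \<omega> i j \<longleftrightarrow> dominates (X i \<omega>) (X j \<omega>)"

lemma beats_measurable [measurable]: "i < 4 \<Longrightarrow> j < 4 \<Longrightarrow> Measurable.pred M (\<lambda>\<omega>. beats \<omega> i j)"
proof -
  assume [measurable]: "i < 4" "j < 4"
  have [measurable]: "(\<lambda>\<omega>. X i \<omega> $ n) \<in> borel_measurable M" if "i < 4" for i n
    by (rule measurable_compose[OF X_measurable[OF that]]) (intro borel_measurable_continuous_onI continuous_intros)
  show ?thesis unfolding beats_def dominates_def by measurable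
qed

text \<open>
  Almost surely no two dice share a sorted coordinate, so dominance is read off from the outcome.
\<close>
lemma generic_dice:
  "AE \<omega> in M. \<forall>i<4. \<forall>j<4. i \<noteq> j \<longrightarrow> outcome i j \<omega> \<in> {1, - 1} \<and> (beats \<omega> i j \<longleftrightarrow> outcome i j \<omega> = 1)"
proof -
  have pair: "AE \<omega> in M. outcome i j \<omega> \<in> {1, - 1} \<and> (beats \<omega> i j \<longleftrightarrow> outcome i j \<omega> = 1)" if ij: "i < 4" "j < 4" "i \<noteq> j" for i j
  proof -
    have 1: "AE \<omega> in M. fst (Y i \<omega>) \<noteq> fst (Y j \<omega>)" by (rule coord_distinct[OF chart_px _ _ ij]) (auto simp: px_def)
    have 2: "AE \<omega> in M. snd (Y i \<omega>) \<noteq> snd (Y j \<omega>)" by (rule coord_distinct[OF chart_py _ _ ij]) (auto simp: py_def)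
    have 3: "AE \<omega> in M. mid (Y i \<omega>) \<noteq> mid (Y j \<omega>)" by (rule coord_distinct[OF chart_pw _ _ ij]) (auto simp: pw_def mid_def)
    from 1 2 3 AE_sum[OF ij(1)] AE_sum[OF ij(2)] show ?thesis
    proof eventually_elim
      case (elim \<omega>)
      then show ?case
        using dominates_beat[of "X i \<omega>" "X j \<omega>"] by (simp add: outcome_def beats_def Y_def)
    qed
  qed
  then have "AE \<omega> in M. \<forall>i\<in>{..<4}. \<forall>j\<in>{..<4}. i \<noteq> j \<longrightarrow> outcome i j \<omega> \<in> {1, - 1} \<and> (beats \<omega> i j \<longleftrightarrow> outcome i j \<omega> = 1)"
    by (intro AE_finite_allI) (auto intro: AE_impI)
  then show ?thesis by (simp add: Ball_def)
qed

lemma class_measurable: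
  "Measurable.pred M (\<lambda>\<omega>. transitive_chain {..<4} (beats \<omega>))" "Measurable.pred M (\<lambda>\<omega>. intransitive_4_cycle {..<4} (beats \<omega>))"
  "Measurable.pred M (\<lambda>\<omega>. winner_3_cycle {..<4} (beats \<omega>))" "Measurable.pred M (\<lambda>\<omega>. loser_3_cycle {..<4} (beats \<omega>))"
proof -
  have B: "Measurable.pred M (\<lambda>\<omega>. beats \<omega> i j)" if "i \<in> {0, 1, 2, 3}" "j \<in> {0, 1, 2, 3}" for i j
    by (rule beats_measurable) (use that in auto)
  have T: "Measurable.pred M (\<lambda>\<omega>. tournament_on {..<4} (beats \<omega>))"
    unfolding tournament_on_def
    by (intro pred_intros_countable_bounded pred_intros_logic beats_measurable countableI_type) auto
  show "Measurable.pred M (\<lambda>\<omega>. transitive_chain {..<4} (beats \<omega>))" "Measurable.pred M (\<lambda>\<omega>. intransitive_4_cycle {..<4} (beats \<omega>))"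
    "Measurable.pred M (\<lambda>\<omega>. winner_3_cycle {..<4} (beats \<omega>))" "Measurable.pred M (\<lambda>\<omega>. loser_3_cycle {..<4} (beats \<omega>))"
    unfolding transitive_chain_def intransitive_4_cycle_def winner_3_cycle_def loser_3_cycle_def ex_four
    by (intro pred_intros_logic(3) T pred_intros_countable_bounded pred_intros_logic B countableI_type; assumption?; simp)+
qed

lemma outcome_integrable:
  assumes "i < 4" "j < 4" "k < 4" "l < 4"
  shows "a < 4 \<Longrightarrow> b < 4 \<Longrightarrow> c < 4 \<Longrightarrow> d < 4 \<Longrightarrow> integrable M (\<lambda>\<omega>. outcome i j \<omega> * outcome k l \<omega> * outcome a b \<omega> * outcome c d \<omega>)"
    and "a < 4 \<Longrightarrow> b < 4 \<Longrightarrow> integrable M (\<lambda>\<omega>. outcome i j \<omega> * outcome k l \<omega> * outcome a b \<omega>)"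
    and "integrable M (\<lambda>\<omega>. outcome i j \<omega> * outcome k l \<omega>)"
proof -
  show "integrable M (\<lambda>\<omega>. outcome i j \<omega> * outcome k l \<omega> * outcome a b \<omega> * outcome c d \<omega>)" if "a < 4" "b < 4" "c < 4" "d < 4"
    by (rule integrable_const_bound[of _ 81]) (use assms that beat_products(3) in \<open>auto simp: outcome_def\<close>)
  show "integrable M (\<lambda>\<omega>. outcome i j \<omega> * outcome k l \<omega> * outcome a b \<omega>)" if "a < 4" "b < 4"
    by (rule integrable_const_bound[of _ 27]) (use assms that beat_products(2) in \<open>auto simp: outcome_def\<close>)
  show "integrable M (\<lambda>\<omega>. outcome i j \<omega> * outcome k l \<omega>)"
    by (rule integrable_const_bound[of _ 9]) (use assms beat_products(1) in \<open>auto simp: outcome_def\<close>)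
qed

lemma class_probabilities:
  "prob {\<omega> \<in> space M. transitive_chain {..<4} (beats \<omega>)} = 110413771 / 258048000"
  "prob {\<omega> \<in> space M. intransitive_4_cycle {..<4} (beats \<omega>)} = 99930571 / 258048000"
  "prob {\<omega> \<in> space M. winner_3_cycle {..<4} (beats \<omega>)} = 23851829 / 258048000"
  "prob {\<omega> \<in> space M. loser_3_cycle {..<4} (beats \<omega>)} = 23851829 / 258048000"
proof -
  define t c w l where "t \<omega> = (of_bool (transitive_chain {..<4} (beats \<omega>)) :: real)"
    and "c \<omega> = (of_bool (intransitive_4_cycle {..<4} (beats \<omega>)) :: real)"
    and "w \<omega> = (of_bool (winner_3_cycle {..<4} (beats \<omega>)) :: real)"
    and "l \<omega> = (of_bool (loser_3_cycle {..<4} (beats \<omega>)) :: real)" for \<omega>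
  have ev: "expectation (\<lambda>\<omega>. of_bool (P \<omega>)) = prob {\<omega> \<in> space M. P \<omega>}" "integrable M (\<lambda>\<omega>. of_bool (P \<omega>) :: real)"
    if P: "Measurable.pred M P" for P
  proof -
    have E: "{\<omega> \<in> space M. P \<omega>} \<in> sets M" using P by (simp add: pred_def)
    have eq: "of_bool (P \<omega>) = (indicator {\<omega> \<in> space M. P \<omega>} \<omega> :: real)" if "\<omega> \<in> space M" for \<omega>
      using that by (simp add: indicator_def)
    show "expectation (\<lambda>\<omega>. of_bool (P \<omega>)) = prob {\<omega> \<in> space M. P \<omega>}"
      using E by (subst Bochner_Integration.integral_cong[OF refl eq]) auto
    show "integrable M (\<lambda>\<omega>. of_bool (P \<omega>) :: real)"
      using E by (subst Bochner_Integration.integrable_cong[OF refl eq]) (auto simp: emeasure_eq_measure)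
  qed
  note int [simp] = ev(2)[OF class_measurable(1), folded t_def] ev(2)[OF class_measurable(2), folded c_def]
    ev(2)[OF class_measurable(3), folded w_def] ev(2)[OF class_measurable(4), folded l_def]
  note prob = ev(1)[OF class_measurable(1), folded t_def] ev(1)[OF class_measurable(2), folded c_def]
    ev(1)[OF class_measurable(3), folded w_def] ev(1)[OF class_measurable(4), folded l_def]
  let ?cycles = "\<lambda>\<omega>. outcome 0 1 \<omega> * outcome 1 2 \<omega> * outcome 2 3 \<omega> * outcome 3 0 \<omega> + outcome 0 1 \<omega> * outcome 1 3 \<omega> * outcome 3 2 \<omega> * outcome 2 0 \<omega>
      + outcome 0 2 \<omega> * outcome 2 1 \<omega> * outcome 1 3 \<omega> * outcome 3 0 \<omega>"
  let ?stars = "\<lambda>\<omega>. outcome 0 1 \<omega> * outcome 0 2 \<omega> * outcome 0 3 \<omega> + outcome 1 0 \<omega> * outcome 1 2 \<omega> * outcome 1 3 \<omega> + outcome 2 0 \<omega> * outcome 2 1 \<omega> * outcome 2 3 \<omega>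
      + outcome 3 0 \<omega> * outcome 3 1 \<omega> * outcome 3 2 \<omega>"
  let ?pairs = "\<lambda>\<omega>. (outcome 0 1 \<omega> * outcome 0 2 \<omega> + outcome 0 1 \<omega> * outcome 0 3 \<omega> + outcome 0 2 \<omega> * outcome 0 3 \<omega>)
      + (outcome 1 0 \<omega> * outcome 1 2 \<omega> + outcome 1 0 \<omega> * outcome 1 3 \<omega> + outcome 1 2 \<omega> * outcome 1 3 \<omega>)
      + (outcome 2 0 \<omega> * outcome 2 1 \<omega> + outcome 2 0 \<omega> * outcome 2 3 \<omega> + outcome 2 1 \<omega> * outcome 2 3 \<omega>)
      + (outcome 3 0 \<omega> * outcome 3 1 \<omega> + outcome 3 0 \<omega> * outcome 3 2 \<omega> + outcome 3 1 \<omega> * outcome 3 2 \<omega>)"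
  have AE: "AE \<omega> in M. t \<omega> + c \<omega> + w \<omega> + l \<omega> = 1 \<and> ?cycles \<omega> = t \<omega> + c \<omega> - 3 * (w \<omega> + l \<omega>) \<and>
      ?stars \<omega> = 4 * w \<omega> - 4 * l \<omega> \<and> ?pairs \<omega> = 4 * t \<omega> - 4 * c \<omega>"
    using generic_dice
  proof eventually_elim
    case (elim \<omega>)
    define r where "r i j = (if beats \<omega> i j then 1 else - 1 :: real)" for i j
    have sr: "outcome i j \<omega> = r i j" if "i < 4" "j < 4" "i \<noteq> j" for i j
      using elim that by (auto simp: r_def)
    have irrefl: "\<not> beats \<omega> i i" for i by (simp add: beats_def dominates_irrefl)
    have anti: "beats \<omega> j i \<longleftrightarrow> \<not> beats \<omega> i j" if "i < 4" "j < 4" "i \<noteq> j" for i j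
    proof -
      have "outcome j i \<omega> = - outcome i j \<omega>" by (simp add: outcome_def beat_antisym[of "Y i \<omega>"])
      then show ?thesis using elim that by force
    qed
    note cls = tournament_classes[of "beats \<omega>" r, OF irrefl anti r_def, folded t_def c_def w_def l_def]
    show ?case using cls by (simp add: sr)
  qed
  have "expectation (\<lambda>\<omega>. t \<omega> + c \<omega> + w \<omega> + l \<omega>) = expectation (\<lambda>_. 1)"
    by (rule integral_cong_AE) (use AE in \<open>auto intro: borel_measurable_integrable\<close>)
  then have 1: "expectation t + expectation c + expectation w + expectation l = 1"
    using prob_space by simp
  have "expectation ?cycles = expectation (\<lambda>\<omega>. t \<omega> + c \<omega> - 3 * (w \<omega> + l \<omega>))"
    by (rule integral_cong_AE) (use AE in \<open>auto intro!: borel_measurable_integrable outcome_integrable Bochner_Integration.integrable_add\<close>)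
  then have 2: "3 * (8404171 / 96768000) = expectation t + expectation c - 3 * (expectation w + expectation l)"
    by (simp add: outcome_integrable expectation_cycle)
  have "expectation ?stars = expectation (\<lambda>\<omega>. 4 * w \<omega> - 4 * l \<omega>)"
    by (rule integral_cong_AE) (use AE in \<open>auto intro!: borel_measurable_integrable outcome_integrable Bochner_Integration.integrable_add\<close>)
  moreover have "expectation ?stars = 0"
    using expectation_cube[of 0 1 2 3] expectation_cube[of 1 0 2 3] expectation_cube[of 2 0 1 3] expectation_cube[of 3 0 1 2]
    by (simp add: outcome_integrable)
  ultimately have 3: "0 = 4 * expectation w - 4 * expectation l" by simp
  have "expectation ?pairs = expectation (\<lambda>\<omega>. 4 * t \<omega> - 4 * c \<omega>)"
    by (rule integral_cong_AE) (use AE in \<open>auto intro!: borel_measurable_integrable outcome_integrable Bochner_Integration.integrable_add\<close>)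
  \<comment> \<open>four vertices with three pairs of edges each\<close>
  moreover have "expectation ?pairs = 12 * (13 / 960)"
    using expectation_square[of 0 1 2 3] expectation_square[of 0 1 3 2] expectation_square[of 0 2 3 1]
      expectation_square[of 1 0 2 3] expectation_square[of 1 0 3 2] expectation_square[of 1 2 3 0]
      expectation_square[of 2 0 1 3] expectation_square[of 2 0 3 1] expectation_square[of 2 1 3 0]
      expectation_square[of 3 0 1 2] expectation_square[of 3 0 2 1] expectation_square[of 3 1 2 0]
    by (simp add: outcome_integrable)
  ultimately have 4: "12 * (13 / 960) = 4 * expectation t - 4 * expectation c" by simp
  note solution = class_equations[OF 1 2 3 4, unfolded prob]
  show "prob {\<omega> \<in> space M. transitive_chain {..<4} (beats \<omega>)} = 110413771 / 258048000"
    by (rule solution(1))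
  show "prob {\<omega> \<in> space M. intransitive_4_cycle {..<4} (beats \<omega>)} = 99930571 / 258048000"
    by (rule solution(2))
  show "prob {\<omega> \<in> space M. winner_3_cycle {..<4} (beats \<omega>)} = 23851829 / 258048000"
    by (rule solution(3))
  show "prob {\<omega> \<in> space M. loser_3_cycle {..<4} (beats \<omega>)} = 23851829 / 258048000"
    by (rule solution(4))
qed

end

theorem theorem11:
  fixes M :: "'a measure" and X :: "nat \<Rightarrow> 'a \<Rightarrow> real ^ 3"
  assumes "prob_space M"
    and "prob_space.indep_vars M (\<lambda>_. borel) X {..<4}"
    and "\<And>i. i < 4 \<Longrightarrow> distr M borel (X i) = balanced_die"
  shows
    "measure M {\<omega> \<in> space M. transitive_chain {..<4} (\<lambda>i j. dominates (X i \<omega>) (X j \<omega>))}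
       = 110413771 / 258048000 \<and>
     measure M {\<omega> \<in> space M. intransitive_4_cycle {..<4} (\<lambda>i j. dominates (X i \<omega>) (X j \<omega>))}
       = 99930571 / 258048000 \<and>
     measure M {\<omega> \<in> space M. winner_3_cycle {..<4} (\<lambda>i j. dominates (X i \<omega>) (X j \<omega>))}
       = 23851829 / 258048000 \<and>
     measure M {\<omega> \<in> space M. loser_3_cycle {..<4} (\<lambda>i j. dominates (X i \<omega>) (X j \<omega>))}
       = 23851829 / 258048000"
proof -
  interpret four_dice M X
    using assms by (simp add: four_dice_def four_dice_axioms_def)
  show ?thesis
    using class_probabilities unfolding beats_def[abs_def] by blast
qed

end
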